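(* Let $n\ge 2$ and $1\le i\le n-1$. Let $Y(sl_n)$ be the Yangian with Drinfel'd generating series $e_i(u),f_i(u),h_i(u)$, and let $\Delta$ be the comultiplication of $Y(sl_n)$, defined in the RTT realisation by $\Delta(T_{k,l}(u))=\sum_{r=1}^n T_{k,r}(u)\otimes T_{r,l}(u)$ and transported to the Drinfel'd realisation by the isomorphism $\phi$. Put $$g_i(u)=h_i(u)+f_i(u)\,e_i(u+1),\qquad \widetilde g_i(u)=h_i(u)+f_i(u+1)\,e_i(u).$$ Let ${}^{i}E_{a_1,\dots,a_i}(u)$, $E^{i}_{a_1,\dots,a_i}(u)$, ${}^{i}F_{a_1,\dots,a_i}(u)$, $F^{i}_{a_1,\dots,a_i}(u)$ be the iterated generalised adjoint actions defined in the context. Then, as identities of formal power series in $u^{-1}$ with coefficients in $Y(sl_n)\otimes Y(sl_n)$ (shifted arguments being expanded in $u^{-1}$): \begin{align*} \Delta(e_i(u))={}&\sum_{m=0}^{\infty}(-1)^m\Bigg(\sum_{\substack{1\le b_1<\cdots<b_i\le n\\ b_i\ne i}}{}^{i}E_{b_1,\dots,b_i}(u)(e_i(u))\otimes{}^{i}F_{b_1,\dots,b_i}(u+1)(f_i(u+1))\Bigg)^m\\ &\times\Bigg(1\otimes e_i(u)+\sum_{\substack{1\le a_1<\cdots<a_i\le n\\ a_i\ne i}}{}^{i}E_{a_1,\dots,a_i}(u)(e_i(u))\otimes{}^{i}F_{a_1,\dots,a_i}(u+1)(\widetilde g_i(u))\Bigg),\\[1mm] \Delta(f_i(u))={}&\Bigg(f_i(u)\otimes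 1+\sum_{\substack{1\le a_1<\cdots<a_i\le n\\ a_i\ne i}}E^{i}_{a_1,\dots,a_i}(u+1)(g_i(u))\otimes F^{i}_{a_1,\dots,a_i}(u)(f_i(u))\Bigg)\\ &\times\sum_{m=0}^{\infty}(-1)^m\Bigg(\sum_{\substack{1\le b_1<\cdots<b_i\le n\\ b_i\ne i}}E^{i}_{b_1,\dots,b_i}(u+1)(e_i(u+1))\otimes F^{i}_{b_1,\dots,b_i}(u)(f_i(u))\Bigg)^m,\\[1mm] \Delta(h_i(u))={}&\Bigg(f_i(u)\otimes e_i(u+1)+\sum_{\substack{1\le a_1<\cdots<a_i\le n\\ a_i\ne i}}E^{i}_{a_1,\dots,a_i}(u+1)(g_i(u))\otimes F^{i}_{a_1,\dots,a_i}(u)(g_i(u))\Bigg)\\ &\times\sum_{m=0}^{\infty}(-1)^m\Bigg(\sum_{\substack{1\le b_1<\cdots<b_i\le n\\ b_i\ne i}}E^{i}_{b_1,\dots,b_i}(u+1)(e_i(u+1))\otimes F^{i}_{b_1,\dots,b_i}(u)(f_i(u))\Bigg)^m\\ &-\Delta(f_i(u))\,\Delta(e_i(u+1)). \end{align*}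
   Context: Base field $\mathbb C$. RTT realisation. $Y(sl_n)$ is the associative unital algebra $U(R)$ generated by $T_{i,j}^{(k)}$ ($1\le i,j\le n$, $k\ge1$), gathered in $T_{i,j}(u)=\delta_{ij}+\sum_{k\ge1}T_{i,j}^{(k)}u^{-k}$, with relations $$-(u-v)[T_{i,j}(u),T_{k,l}(v)]=T_{k,j}(u)T_{i,l}(v)-T_{k,j}(v)T_{i,l}(u)$$ and $\sum_{\sigma\in\mathfrak S_n}\mathrm{sgn}(\sigma)\,T_{\sigma(1),1}(u)T_{\sigma(2),2}(u+1)\cdots T_{\sigma(n),n}(u+n-1)=1$. All shifted series are expanded in $u^{-1}$. Quantum minors: $$t\binom{a_1\cdots a_m}{b_1\cdots b_m}(u)=\sum_{\sigma\in\mathfrak S_m}\mathrm{sgn}(\sigma)\,T_{a_{\sigma(1)},b_1}(u)\cdots T_{a_{\sigma(m)},b_m}(u+m-1),$$ equal to $1$ when $m=0$. Drinfel'd realisation. $Y(sl_n)$ is also isomorphic to the algebra $\mathcal A$ generated by $e_i^{(k)},f_i^{(k)},h_i^{(k)}$ ($1\le i\le n-1$, $k\ge0$) with relations, where $a_{ij}=(\alpha_i,\alpha_j)$ is the Cartan matrix of $sl_n$: $[h_i^{(k)},h_j^{(l)}]=0$; $[e_i^{(k)},f_j^{(l)}]=\delta_{ij}h_i^{(k+l)}$; $[h_i^{(0)},e_j^{(l)}]=a_{ij}e_j^{(l)}$; $[h_i^{(0)},f_j^{(l)}]=-a_{ij}f_j^{(l)}$; $[h_i^{(k+1)},e_j^{(l)}]-[h_i^{(k)},e_j^{(l+1)}]=\tfrac12a_{ij}(h_i^{(k)}e_j^{(l)}+e_j^{(l)}h_i^{(k)})$;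 $[h_i^{(k+1)},f_j^{(l)}]-[h_i^{(k)},f_j^{(l+1)}]=-\tfrac12a_{ij}(h_i^{(k)}f_j^{(l)}+f_j^{(l)}h_i^{(k)})$; $[e_i^{(k+1)},e_j^{(l)}]-[e_i^{(k)},e_j^{(l+1)}]=\tfrac12a_{ij}(e_i^{(k)}e_j^{(l)}+e_j^{(l)}e_i^{(k)})$; $[f_i^{(k+1)},f_j^{(l)}]-[f_i^{(k)},f_j^{(l+1)}]=-\tfrac12a_{ij}(f_i^{(k)}f_j^{(l)}+f_j^{(l)}f_i^{(k)})$; and, for $i\neq j$ and $N=1-a_{ij}$, $\sum_{\sigma\in\mathfrak S_N}[e_i^{(k_{\sigma(1)})},[\dots,[e_i^{(k_{\sigma(N)})},e_j^{(l)}]\dots]]=0$ and the same with $f$ in place of $e$. Set $e_i(u)=\sum_{k\ge0}e_i^{(k)}u^{-k-1}$, $f_i(u)=\sum_{k\ge0}f_i^{(k)}u^{-k-1}$, $h_i(u)=1+\sum_{k\ge0}h_i^{(k)}u^{-k-1}$. Isomorphism (known). The two realisations are identified by the algebra isomorphism $\phi:\mathcal A\to U(R)$ (omitted from the notation): $$e_i\big(u+\tfrac{i-2}2\big)\mapsto \Big(t\tbinom{1\cdots i}{1\cdots i}(u)\Big)^{-1}t\tbinom{1\cdots i-1\;i}{1\cdots i-1\;i+1}(u),\qquad f_i\big(u+\tfrac{i-2}2\big)\mapsto t\tbinom{1\cdots i-1\;i+1}{1\cdots i-1\;i}(u)\Big(t\tbinom{1\cdots i}{1\cdots i}(u)\Big)^{-1},$$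 $$h_i\big(u+\tfrac{i-2}2\big)\mapsto \Big(t\tbinom{1\cdots i}{1\cdots i}(u)\Big)^{-1}t\tbinom{1\cdots i-1}{1\cdots i-1}(u)\;t\tbinom{1\cdots i+1}{1\cdots i+1}(u-1)\Big(t\tbinom{1\cdots i}{1\cdots i}(u-1)\Big)^{-1}.$$ Adjoint actions. For $1\le i<j\le n$ put $e_{i,j}^{(0)}=T_{i,j}^{(1)}=[\cdots[[e_{j-1}^{(0)},e_{j-2}^{(0)}],e_{j-3}^{(0)}],\cdots,e_i^{(0)}]$ and $f_{j,i}^{(0)}=T_{j,i}^{(1)}=[f_i^{(0)},[f_{i+1}^{(0)},[\cdots,[f_{j-2}^{(0)},f_{j-1}^{(0)}]\cdots]]]$ (so $e^{(0)}_{i,i+1}=e^{(0)}_i$, $f^{(0)}_{i+1,i}=f^{(0)}_i$). Define, for $X\in Y(sl_n)$ (and coefficientwise for series), $Ad^{\pm}_{e_{i,j}}(X)=\pm[e_{i,j}^{(0)},X]$, $Ad^{\pm}_{f_{j,i}}(X)=\pm[f_{j,i}^{(0)},X]$ for $i<j$, and $Ad^{\pm}_{e_{i,i}}(X)=Ad^{\pm}_{f_{i,i}}(X)=X$. Generalised adjoint actions. For $1\le i\le j\le n$ and $1\le\alpha\le n$, with $\delta_{i\le\alpha<j}=1$ if $i\le\alpha<j$ and $0$ otherwise: $${}^{\alpha}\mathcal E_{i,j}(u)(X)=Ad^+_{e_{i,j}}(X)+\delta_{i\le\alpha<j}\,Ad^-_{e_{i,\alpha}}\big(Ad^+_{e_{\alpha+1,j}}(e_\alpha(u))\big)\,X,$$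 $$\mathcal E^{\alpha}_{i,j}(u)(X)=Ad^+_{e_{i,j}}(X)+\delta_{i\le\alpha<j}\,X\,Ad^-_{e_{i,\alpha}}\big(Ad^+_{e_{\alpha+1,j}}(e_\alpha(u))\big),$$ $${}^{\alpha}\mathcal F_{j,i}(u)(X)=Ad^-_{f_{j,i}}(X)+\delta_{i\le\alpha<j}\,Ad^+_{f_{\alpha,i}}\big(Ad^-_{f_{j,\alpha+1}}(f_\alpha(u))\big)\,X,$$ $$\mathcal F^{\alpha}_{j,i}(u)(X)=Ad^-_{f_{j,i}}(X)+\delta_{i\le\alpha<j}\,X\,Ad^+_{f_{\alpha,i}}\big(Ad^-_{f_{j,\alpha+1}}(f_\alpha(u))\big).$$ Iterated actions. For $1\le k_1<\cdots<k_m\le n$ with $k_m\ne m$: $${}^{\alpha}E_{k_1,\dots,k_m}(u)={}^{\alpha}\mathcal E_{1,k_1}(u)\circ\cdots\circ{}^{\alpha}\mathcal E_{m-1,k_{m-1}}(u)\circ{}^{\alpha}\mathcal E_{m+1,k_m}(u),$$ $${}^{\alpha}F_{k_1,\dots,k_m}(u)={}^{\alpha}\mathcal F_{k_1,1}(u)\circ\cdots\circ{}^{\alpha}\mathcal F_{k_{m-1},m-1}(u)\circ{}^{\alpha}\mathcal F_{k_m,m+1}(u)$$ (the rightmost map is applied first), and $E^{\alpha}_{k_1,\dots,k_m}(u)$, $F^{\alpha}_{k_1,\dots,k_m}(u)$ are defined by the same formulas with $\mathcal E^{\alpha},\mathcal F^{\alpha}$ in place of ${}^{\alpha}\mathcal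 E,{}^{\alpha}\mathcal F$. *)

theory Defs
  imports
    Complex_Main
    "HOL-Library.Cardinality"
    "HOL-Library.Poly_Mapping"
    "HOL-Combinatorics.Permutations"
    "HOL-Computational_Algebra.Formal_Power_Series"
begin

section \<open>Complex algebras, presentations and tensor products\<close>

class complex_algebra_1 = ring_1 +
  fixes scaleC :: "complex \<Rightarrow> 'a \<Rightarrow> 'a"  (infixr \<open>*\<^sub>C\<close> 75)
  assumes scaleC_add_right: "a *\<^sub>C (x + y) = a *\<^sub>C x + a *\<^sub>C y"
    and scaleC_add_left: "(a + b) *\<^sub>C x = a *\<^sub>C x + b *\<^sub>C x"
    and scaleC_scaleC: "a *\<^sub>C (b *\<^sub>C x) = (a * b) *\<^sub>C x"
    and scaleC_one: "1 *\<^sub>C x = x"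
    and mult_scaleC_left: "(a *\<^sub>C x) * y = a *\<^sub>C (x * y)"
    and mult_scaleC_right: "x * (a *\<^sub>C y) = a *\<^sub>C (x * y)"

lemma vector_space_scaleC: "vector_space (scaleC :: complex \<Rightarrow> 'a :: complex_algebra_1 \<Rightarrow> 'a)"
  by unfold_locales (simp_all add: scaleC_add_right scaleC_add_left scaleC_scaleC scaleC_one)

lemma scaleC_conv_mult: "c *\<^sub>C x = (c *\<^sub>C 1) * (x :: 'a :: complex_algebra_1)"
  by (simp add: mult_scaleC_left)

definition algebra_hom :: "('a :: complex_algebra_1 \<Rightarrow> 'b :: complex_algebra_1) \<Rightarrow> bool" where
  "algebra_hom f \<longleftrightarrow> Vector_Spaces.linear scaleC scaleC f \<and> f 1 = 1 \<and> (\<forall>x y. f (x * y) = f x * f y)"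

definition algebra_iso :: "('a :: complex_algebra_1 \<Rightarrow> 'b :: complex_algebra_1) \<Rightarrow> bool" where
  "algebra_iso f \<longleftrightarrow> algebra_hom f \<and> bij f"

definition comm :: "'a :: ring \<Rightarrow> 'a \<Rightarrow> 'a" where
  "comm x y = x * y - y * x"

lemma poly_mapping_add_induct [case_names zero single add]:
  fixes p :: "'a \<Rightarrow>\<^sub>0 'b :: comm_monoid_add"
  assumes "P 0" "\<And>k v. P (Poly_Mapping.single k v)" "\<And>p q. P p \<Longrightarrow> P q \<Longrightarrow> P (p + q)"
  shows "P p"
proof (rule update_induct[of P])
  fix f :: "'a \<Rightarrow>\<^sub>0 'b" and a b
  assume f: "a \<notin> Poly_Mapping.keys f" "P f"
  have "Poly_Mapping.update a b f = f + Poly_Mapping.single a b"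
    using f(1) by (intro poly_mapping_eqI)
      (auto simp: lookup_update lookup_add lookup_single when_def in_keys_iff)
  with f assms show "P (Poly_Mapping.update a b f)" by simp
qed (rule assms)

instantiation complex :: complex_algebra_1
begin
definition "scaleC_complex (c :: complex) (x :: complex) = c * x"
instance by standard (simp_all add: scaleC_complex_def algebra_simps)
end

instantiation poly_mapping :: (monoid_add, complex_algebra_1) complex_algebra_1
begin

definition scaleC_poly_mapping :: "complex \<Rightarrow> ('a \<Rightarrow>\<^sub>0 'b) \<Rightarrow> ('a \<Rightarrow>\<^sub>0 'b)" where
  "scaleC_poly_mapping c p = Poly_Mapping.single 0 (c *\<^sub>C 1) * p"

instance
proof
  fix a b :: complex and x y :: "'a \<Rightarrow>\<^sub>0 'b"
  show "a *\<^sub>C (x + y) = a *\<^sub>C x + a *\<^sub>C y"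
    by (simp add: scaleC_poly_mapping_def distrib_left)
  show "(a + b) *\<^sub>C x = a *\<^sub>C x + b *\<^sub>C x"
    by (simp add: scaleC_poly_mapping_def distrib_right scaleC_add_left single_add)
  show "a *\<^sub>C (b *\<^sub>C x) = (a * b) *\<^sub>C x"
    by (simp add: scaleC_poly_mapping_def mult.assoc[symmetric] mult_single mult_scaleC_left
        scaleC_scaleC)
  show "1 *\<^sub>C x = x"
    by (simp add: scaleC_poly_mapping_def scaleC_one)
  show "(a *\<^sub>C x) * y = a *\<^sub>C (x * y)"
    by (simp add: scaleC_poly_mapping_def mult.assoc)
  have central: "z * Poly_Mapping.single 0 (a *\<^sub>C 1) = Poly_Mapping.single 0 (a *\<^sub>C 1) * z"
    for z :: "'a \<Rightarrow>\<^sub>0 'b"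
    by (induction z rule: poly_mapping_add_induct)
       (simp_all add: mult_single mult_scaleC_left mult_scaleC_right algebra_simps)
  show "x * (a *\<^sub>C y) = a *\<^sub>C (x * y)"
    unfolding scaleC_poly_mapping_def mult.assoc[symmetric] central ..
qed

end

inductive_set ideal_generated :: "'a :: ring_1 set \<Rightarrow> 'a set" for R where
  zero: "0 \<in> ideal_generated R"
| generator: "r \<in> R \<Longrightarrow> a * r * b \<in> ideal_generated R"
| add: "x \<in> ideal_generated R \<Longrightarrow> y \<in> ideal_generated R \<Longrightarrow> x + y \<in> ideal_generated R"

lemma ideal_generated_mult_left: "x \<in> ideal_generated R \<Longrightarrow> c * x \<in> ideal_generated R"
proof (induction rule: ideal_generated.induct)
  case (generator r a b)
  then show ?case using ideal_generated.generator[of r R "c * a" b] by (simp add: mult.assoc)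
qed (auto simp: distrib_left intro: ideal_generated.intros)

lemma ideal_generated_mult_right: "x \<in> ideal_generated R \<Longrightarrow> x * c \<in> ideal_generated R"
proof (induction rule: ideal_generated.induct)
  case (generator r a b)
  then show ?case using ideal_generated.generator[of r R a "b * c"] by (simp add: mult.assoc)
qed (auto simp: distrib_right intro: ideal_generated.intros)

lemma ideal_generated_uminus: "x \<in> ideal_generated R \<Longrightarrow> - x \<in> ideal_generated R"
  using ideal_generated_mult_left[of x R "-1"] by simp

definition ideal_cong :: "'a :: ring_1 set \<Rightarrow> 'a \<Rightarrow> 'a \<Rightarrow> bool" where
  "ideal_cong R x y \<longleftrightarrow> x - y \<in> ideal_generated R"

lemma ideal_cong_refl: "ideal_cong R x x"
  by (simp add: ideal_cong_def ideal_generated.zero)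

lemma ideal_cong_eqI: "x = y \<Longrightarrow> ideal_cong R x y"
  by (simp add: ideal_cong_refl)

lemma ideal_cong_add: "ideal_cong R a b \<Longrightarrow> ideal_cong R c d \<Longrightarrow> ideal_cong R (a + c) (b + d)"
  unfolding ideal_cong_def using ideal_generated.add[of "a - b" R "c - d"] by (simp add: algebra_simps)

lemma ideal_cong_uminus: "ideal_cong R a b \<Longrightarrow> ideal_cong R (- a) (- b)"
  unfolding ideal_cong_def using ideal_generated_uminus[of "a - b" R] by simp

lemma ideal_cong_minus: "ideal_cong R a b \<Longrightarrow> ideal_cong R c d \<Longrightarrow> ideal_cong R (a - c) (b - d)"
  using ideal_cong_add[OF _ ideal_cong_uminus, of R a b c d] by simp

lemma ideal_cong_mult: "ideal_cong R a b \<Longrightarrow> ideal_cong R c d \<Longrightarrow> ideal_cong R (a * c) (b * d)"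
proof (unfold ideal_cong_def)
  assume "a - b \<in> ideal_generated R" "c - d \<in> ideal_generated R"
  then have "(a - b) * c + b * (c - d) \<in> ideal_generated R"
    by (intro ideal_generated.add ideal_generated_mult_left ideal_generated_mult_right)
  then show "a * c - b * d \<in> ideal_generated R"
    by (simp add: algebra_simps)
qed

lemma ideal_cong_scaleC:
  "ideal_cong R a b \<Longrightarrow> ideal_cong R (z *\<^sub>C a) (z *\<^sub>C (b :: 'a :: complex_algebra_1))"
  by (subst (1 2) scaleC_conv_mult) (intro ideal_cong_mult ideal_cong_refl)

lemma equivp_ideal_cong: "equivp (ideal_cong R)"
proof (intro equivpI reflpI sympI transpI)
  fix x y z
  show "ideal_cong R x x" by (rule ideal_cong_refl)
  show "ideal_cong R x y \<Longrightarrow> ideal_cong R y x"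
    unfolding ideal_cong_def using ideal_generated_uminus[of "x - y" R] by simp
  show "ideal_cong R x y \<Longrightarrow> ideal_cong R y z \<Longrightarrow> ideal_cong R x z"
    unfolding ideal_cong_def using ideal_generated.add[of "x - y" R "y - z"] by simp
qed

lemma not_ideal_cong_0_1:
  fixes F :: "'a :: ring_1 \<Rightarrow> 'b :: ab_group_add"
  assumes "\<And>x y. F (x + y) = F x + F y" "\<And>a r b. r \<in> R \<Longrightarrow> F (a * r * b) = 0" "F 1 \<noteq> 0"
  shows "\<not> ideal_cong R 0 1"
proof
  assume "ideal_cong R 0 1"
  then have 1: "1 \<in> ideal_generated R"
    unfolding ideal_cong_def using ideal_generated_uminus[of "-1 :: 'a" R] by simp
  have "F x = 0" if "x \<in> ideal_generated R" for x
    using that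
  proof induction
    case zero
    show ?case using assms(1)[of 0 0] by simp
  qed (simp_all add: assms)
  with 1 assms(3) show False by blast
qed

text \<open>The free algebra on a set of generators is the monoid algebra of the monoid of words,
  written additively because \<^typ>\<open>'a \<Rightarrow>\<^sub>0 'b\<close> is the monoid algebra of an additive monoid.\<close>

datatype 'g word = Word "'g list"

instantiation word :: (type) monoid_add
begin
definition "0 = Word []"
fun plus_word where "Word v + Word w = Word (v @ w)"
instance
proof
  fix a b c :: "'a word"
  show "a + b + c = a + (b + c)" by (cases a; cases b; cases c) simp
  show "0 + a = a" "a + 0 = a" by (cases a; simp add: zero_word_def)+
qed
end

type_synonym 'g free_algebra = "'g word \<Rightarrow>\<^sub>0 complex"

definition gen :: "'g \<Rightarrow> 'g free_algebra" where
  "gen g = Poly_Mapping.single (Word [g]) 1"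

definition linear_extension :: "('k \<Rightarrow> complex) \<Rightarrow> ('k \<Rightarrow>\<^sub>0 complex) \<Rightarrow> complex" where
  "linear_extension h p = (\<Sum>k\<in>Poly_Mapping.keys p. Poly_Mapping.lookup p k * h k)"

lemma linear_extension_add:
  "linear_extension h (p + q) = linear_extension h p + linear_extension h q"
  unfolding linear_extension_def
  by (rule setsum_keys_plus_distrib) (simp_all add: distrib_right)

lemma linear_extension_single [simp]: "linear_extension h (Poly_Mapping.single k v) = v * h k"
  by (simp add: linear_extension_def)

lemma linear_extension_0 [simp]: "linear_extension h 0 = 0"
  by (simp add: linear_extension_def)

lemma linear_extension_diff:
  "linear_extension h (p - q) = linear_extension h p - linear_extension h q"
  using linear_extension_add[of h "p - q" q] by simp

lemma linear_extension_mult: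
  fixes h :: "'k :: monoid_add \<Rightarrow> complex"
  assumes "\<And>k l. h (k + l) = h k * h l"
  shows "linear_extension h (p * q) = linear_extension h p * linear_extension h q"
proof (induction p rule: poly_mapping_add_induct)
  case (single k v)
  show ?case
    by (induction q rule: poly_mapping_add_induct)
       (simp_all add: mult_single assms distrib_left linear_extension_add)
qed (simp_all add: distrib_right linear_extension_add)

text \<open>The augmentation of the free algebra, which annihilates the generators; it serves to show that
  the algebras presented below are nonzero.\<close>

definition augmentation :: "'g free_algebra \<Rightarrow> complex" where
  "augmentation = linear_extension (\<lambda>w. if w = 0 then 1 else 0)"

lemma augmentation_add: "augmentation (p + q) = augmentation p + augmentation q"
  by (simp add: augmentation_def linear_extension_add)

lemma augmentation_0 [simp]: "augmentation 0 = 0"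
  by (simp add: augmentation_def)

lemma augmentation_diff: "augmentation (p - q) = augmentation p - augmentation q"
  by (simp add: augmentation_def linear_extension_diff)

lemma augmentation_uminus: "augmentation (- p) = - augmentation p"
  using augmentation_diff[of 0 p] by simp

lemma augmentation_sum: "augmentation (sum f A) = (\<Sum>x\<in>A. augmentation (f x))"
  by (induction A rule: infinite_finite_induct) (simp_all add: augmentation_add)

lemma augmentation_1 [simp]: "augmentation 1 = 1"
  by (simp add: augmentation_def single_one[symmetric] del: single_one)

lemma augmentation_mult: "augmentation (p * q) = augmentation p * augmentation q"
  unfolding augmentation_def
proof (rule linear_extension_mult)
  fix k l :: "'a word"
  show "(if k + l = 0 then 1 else 0) = (if k = 0 then 1 else 0) * (if l = 0 then 1 else 0 :: complex)"
    by (cases k; cases l) (simp add: zero_word_def)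
qed

lemma augmentation_gen [simp]: "augmentation (gen g) = 0"
  by (simp add: augmentation_def gen_def zero_word_def)

lemma augmentation_scaleC: "augmentation (c *\<^sub>C p) = c * augmentation p"
  by (simp add: scaleC_poly_mapping_def augmentation_mult)
     (simp add: augmentation_def scaleC_complex_def)

lemmas augmentation_simps = augmentation_add augmentation_diff augmentation_uminus augmentation_sum
  augmentation_mult augmentation_scaleC

lemma presentation_nontrivial:
  assumes "\<And>r. r \<in> R \<Longrightarrow> augmentation r = 0"
  shows "\<not> ideal_cong R 0 1"
  by (rule not_ideal_cong_0_1[where F = augmentation]) (simp_all add: augmentation_simps assms)

text \<open>The tensor product over the complex numbers is the free vector space on the pairs \<open>(a, b)\<close>,
  multiplied componentwise, modulo the bilinearity relations. The span of these relations is closed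
  under multiplication by pairs, so it is the two-sided ideal that they generate.\<close>

datatype ('a, 'b) pure_tensor = Pure 'a 'b

instantiation pure_tensor :: (monoid_mult, monoid_mult) monoid_add
begin
definition "0 = Pure 1 1"
fun plus_pure_tensor where "Pure a b + Pure c d = Pure (a * c) (b * d)"
instance
proof
  fix x y z :: "('a, 'b) pure_tensor"
  show "x + y + z = x + (y + z)" by (cases x; cases y; cases z) (simp add: mult.assoc)
  show "0 + x = x" "x + 0 = x" by (cases x; simp add: zero_pure_tensor_def)+
qed
end

inductive_set tensor_relators ::
  "(('a :: complex_algebra_1, 'b :: complex_algebra_1) pure_tensor \<Rightarrow>\<^sub>0 complex) set" where
  "Poly_Mapping.single (Pure (a + a') b) 1
     - (Poly_Mapping.single (Pure a b) 1 + Poly_Mapping.single (Pure a' b) 1) \<in> tensor_relators"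
| "Poly_Mapping.single (Pure a (b + b')) 1
     - (Poly_Mapping.single (Pure a b) 1 + Poly_Mapping.single (Pure a b') 1) \<in> tensor_relators"
| "Poly_Mapping.single (Pure (c *\<^sub>C a) b) 1 - Poly_Mapping.single (Pure a b) c \<in> tensor_relators"
| "Poly_Mapping.single (Pure a (c *\<^sub>C b)) 1 - Poly_Mapping.single (Pure a b) c \<in> tensor_relators"

quotient_type (overloaded) ('a, 'b) tensor =
    "('a :: complex_algebra_1, 'b :: complex_algebra_1) pure_tensor \<Rightarrow>\<^sub>0 complex"
  / "ideal_cong tensor_relators"
  by (rule equivp_ideal_cong)

lemma linear_functional_1:
  "\<exists>f :: 'a :: complex_algebra_1 \<Rightarrow> complex. Vector_Spaces.linear scaleC (*) f \<and> f 1 = 1"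
proof -
  interpret A: vector_space "scaleC :: complex \<Rightarrow> 'a \<Rightarrow> 'a"
    by (rule vector_space_scaleC)
  interpret vector_space_pair "scaleC :: complex \<Rightarrow> 'a \<Rightarrow> 'a" "(*) :: complex \<Rightarrow> complex \<Rightarrow> complex"
    by unfold_locales (simp_all add: algebra_simps)
  have "\<not> A.dependent {1}" by simp
  from linear_independent_extend[OF this, of "\<lambda>_. 1"] show ?thesis by auto
qed

lemma tensor_nontrivial:
  "\<not> ideal_cong (tensor_relators ::
     (('a :: complex_algebra_1, 'b :: complex_algebra_1) pure_tensor \<Rightarrow>\<^sub>0 complex) set) 0 1"
proof -
  obtain f :: "'a \<Rightarrow> complex" where f: "Vector_Spaces.linear scaleC (*) f" "f 1 = 1"
    using linear_functional_1 by blast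
  obtain g :: "'b \<Rightarrow> complex" where g: "Vector_Spaces.linear scaleC (*) g" "g 1 = 1"
    using linear_functional_1 by blast
  interpret f: Vector_Spaces.linear scaleC "(*)" f by (rule f)
  interpret g: Vector_Spaces.linear scaleC "(*)" g by (rule g)
  define F where "F = linear_extension (\<lambda>t. case t of Pure a b \<Rightarrow> f a * g b)"
  have F_add: "F (p + q) = F p + F q" and F_diff: "F (p - q) = F p - F q" for p q
    by (simp_all add: F_def linear_extension_add linear_extension_diff)
  have F_single: "F (Poly_Mapping.single (Pure a b) v) = v * (f a * g b)" for a b v
    by (simp add: F_def)
  have F_0: "F 0 = 0"
    by (simp add: F_def)
  note F_simps = left_diff_distrib right_diff_distrib distrib_left distrib_right F_add F_diff
    mult_single F_single f.add g.add f.scale g.scale mult_scaleC_left mult_scaleC_right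
  have single: "F (Poly_Mapping.single s v * r * Poly_Mapping.single t w) = 0"
    if r: "r \<in> tensor_relators" for r s t v w
  proof -
    obtain a\<^sub>0 b\<^sub>0 a\<^sub>1 b\<^sub>1 where st: "s = Pure a\<^sub>0 b\<^sub>0" "t = Pure a\<^sub>1 b\<^sub>1"
      by (metis pure_tensor.exhaust)
    from r show ?thesis
      unfolding st by cases (simp_all add: F_simps)
  qed
  have right: "F (Poly_Mapping.single s v * r * q) = 0" if "r \<in> tensor_relators" for r s v q
    by (induction q rule: poly_mapping_add_induct)
       (simp_all add: single[OF that] F_add F_0 distrib_left)
  have "F (p * r * q) = 0" if "r \<in> tensor_relators" for r p q
    by (induction p rule: poly_mapping_add_induct)
       (simp_all add: right[OF that] F_add F_0 distrib_right)
  moreover have "F 1 = 1"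
    by (simp add: F_def single_one[symmetric] zero_pure_tensor_def f g del: single_one)
  ultimately show ?thesis
    using not_ideal_cong_0_1[of F] F_add by (metis zero_neq_one)
qed

instantiation tensor :: (complex_algebra_1, complex_algebra_1) complex_algebra_1
begin

lift_definition zero_tensor :: "('a, 'b) tensor" is 0 .
lift_definition one_tensor :: "('a, 'b) tensor" is 1 .
lift_definition plus_tensor :: "('a, 'b) tensor \<Rightarrow> ('a, 'b) tensor \<Rightarrow> ('a, 'b) tensor" is "(+)"
  by (rule ideal_cong_add)
lift_definition uminus_tensor :: "('a, 'b) tensor \<Rightarrow> ('a, 'b) tensor" is uminus
  by (rule ideal_cong_uminus)
lift_definition minus_tensor :: "('a, 'b) tensor \<Rightarrow> ('a, 'b) tensor \<Rightarrow> ('a, 'b) tensor" is "(-)"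
  by (rule ideal_cong_minus)
lift_definition times_tensor :: "('a, 'b) tensor \<Rightarrow> ('a, 'b) tensor \<Rightarrow> ('a, 'b) tensor" is "(*)"
  by (rule ideal_cong_mult)
lift_definition scaleC_tensor :: "complex \<Rightarrow> ('a, 'b) tensor \<Rightarrow> ('a, 'b) tensor" is scaleC
  by (rule ideal_cong_scaleC)

instance
proof
  show "(0 :: ('a, 'b) tensor) \<noteq> 1"
    by transfer (rule tensor_nontrivial)
qed (transfer, rule ideal_cong_eqI,
      simp add: distrib_left distrib_right mult.assoc add.assoc add.commute scaleC_add_right
        scaleC_add_left scaleC_scaleC scaleC_one mult_scaleC_left mult_scaleC_right)+

end

lift_definition tensor_elem ::
  "'a \<Rightarrow> 'b \<Rightarrow> ('a :: complex_algebra_1, 'b :: complex_algebra_1) tensor" is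
  "\<lambda>a b. Poly_Mapping.single (Pure a b) 1" .


section \<open>Power series in \<open>u\<inverse>\<close>\<close>

text \<open>The variable of \<^typ>\<open>'a fps\<close> stands for \<open>u\<inverse>\<close>, so \<^term>\<open>fps_nth F k\<close> is the coefficient of
  \<open>u\<close> to the power \<open>-k\<close>; the metric topology of \<^typ>\<open>'a fps\<close> is the \<open>u\<inverse>\<close>-adic one.\<close>

definition fps_map :: "('a :: zero \<Rightarrow> 'b :: zero) \<Rightarrow> 'a fps \<Rightarrow> 'b fps" where
  "fps_map f F = Abs_fps (\<lambda>k. f (fps_nth F k))"

text \<open>\<open>translate c F\<close> is \<open>F(u + c)\<close>. In powers of \<open>x = u\<inverse>\<close> one has
  \<open>(u + c)\<close> to the power \<open>-k\<close> equal to \<open>\<Sum>r. ((-k) gchoose r) c^r x^(k + r)\<close>.\<close>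

definition translate :: "complex \<Rightarrow> 'a :: complex_algebra_1 fps \<Rightarrow> 'a fps" where
  "translate c F = Abs_fps (\<lambda>m. \<Sum>k\<le>m. (((- of_nat k) gchoose (m - k)) * c ^ (m - k)) *\<^sub>C fps_nth F k)"

definition tensor_fps ::
  "'a :: complex_algebra_1 fps \<Rightarrow> 'b :: complex_algebra_1 fps \<Rightarrow> ('a, 'b) tensor fps"
  (infixl \<open>\<otimes>\<close> 75) where
  "F \<otimes> G = Abs_fps (\<lambda>m. \<Sum>k\<le>m. tensor_elem (fps_nth F k) (fps_nth G (m - k)))"


section \<open>The RTT realisation\<close>

text \<open>The series collecting elements \<open>t i j k\<close>, with the constant term prescribed by the Kronecker
  delta.\<close>

definition T_series :: "(nat \<Rightarrow> nat \<Rightarrow> nat \<Rightarrow> 'a :: ring_1) \<Rightarrow> nat \<Rightarrow> nat \<Rightarrow> 'a fps" where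
  "T_series t i j = Abs_fps (\<lambda>k. if k = 0 then (if i = j then 1 else 0) else t i j k)"

text \<open>Rows and columns are given by lists of equal length \<open>m\<close>, indexed from \<open>0\<close>; accordingly the
  \<open>r\<close>-th factor carries the argument \<open>u + r\<close>.\<close>

definition quantum_minor ::
  "(nat \<Rightarrow> nat \<Rightarrow> 'a :: complex_algebra_1 fps) \<Rightarrow> nat list \<Rightarrow> nat list \<Rightarrow> 'a fps" where
  "quantum_minor T as bs =
     (\<Sum>\<sigma> | \<sigma> permutes {..<length as}. of_int (sign \<sigma>) *
        prod_list (map (\<lambda>r. translate (of_nat r) (T (as ! \<sigma> r) (bs ! r))) [0..<length as]))"

datatype rtt_generator = TGen nat nat nat

abbreviation T_free :: "nat \<Rightarrow> nat \<Rightarrow> rtt_generator free_algebra fps" where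
  "T_free \<equiv> T_series (\<lambda>i j k. gen (TGen i j k))"

text \<open>The second rule is the coefficient of \<open>u\<close> to the \<open>-r\<close> and \<open>v\<close> to the \<open>-s\<close> in the RTT relation;
  its coefficients with \<open>r = -1\<close> or \<open>s = -1\<close> only say that the constant terms are central. The first
  rule discards the symbols which are not among the generators.\<close>

inductive_set rtt_relators :: "nat \<Rightarrow> rtt_generator free_algebra set" for n where
  out_of_range:
    "\<not> (i \<in> {1..n} \<and> j \<in> {1..n} \<and> 1 \<le> k) \<Longrightarrow> gen (TGen i j k) \<in> rtt_relators n"
| rtt:
    "i \<in> {1..n} \<Longrightarrow> j \<in> {1..n} \<Longrightarrow> k \<in> {1..n} \<Longrightarrow> l \<in> {1..n} \<Longrightarrow>
     - (comm (fps_nth (T_free i j) (Suc r)) (fps_nth (T_free k l) s)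
          - comm (fps_nth (T_free i j) r) (fps_nth (T_free k l) (Suc s)))
     - (fps_nth (T_free k j) r * fps_nth (T_free i l) s
          - fps_nth (T_free k j) s * fps_nth (T_free i l) r) \<in> rtt_relators n"
| quantum_determinant:
    "fps_nth (quantum_minor T_free [1..<n+1] [1..<n+1] - 1) k \<in> rtt_relators n"

lemma augmentation_T_free: "augmentation (fps_nth (T_free i j) k) = (if i = j \<and> k = 0 then 1 else 0)"
  by (simp add: T_series_def)

lemma fps_map_augmentation_mult:
  "fps_map augmentation (F * G) = fps_map augmentation F * fps_map augmentation G"
  by (rule fps_ext) (simp add: fps_map_def fps_mult_nth augmentation_simps)

lemma fps_map_augmentation_sum:
  "fps_map augmentation (sum f A) = (\<Sum>x\<in>A. fps_map augmentation (f x))"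
  by (rule fps_ext) (simp add: fps_map_def fps_sum_nth augmentation_simps)

lemma fps_map_augmentation_1 [simp]: "fps_map augmentation 1 = 1"
  by (rule fps_ext) (simp add: fps_map_def)

lemma fps_map_augmentation_of_int:
  "fps_map augmentation (of_int z :: 'a free_algebra fps) = of_int z"
proof -
  have nat: "fps_map augmentation (of_nat m :: 'a free_algebra fps) = of_nat m" for m
  proof (induction m)
    case (Suc m)
    then show ?case
      by (intro fps_ext) (simp add: fps_eq_iff fps_map_def augmentation_simps)
  qed (simp add: fps_map_def fps_eq_iff)
  show ?thesis
  proof (cases z)
    case (neg m)
    have "fps_map augmentation (- F) = - fps_map augmentation F" for F :: "'a free_algebra fps"
      by (simp add: fps_eq_iff fps_map_def augmentation_uminus)
    then show ?thesis by (simp only: neg nat of_int_minus of_int_of_nat_eq)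
  qed (simp add: nat)
qed

lemma fps_map_augmentation_translate_T:
  "fps_map augmentation (translate c (T_free i j)) = (if i = j then 1 else 0)"
proof (rule fps_ext)
  fix m
  have "(\<Sum>k\<le>m. ((- of_nat k gchoose (m - k)) * c ^ (m - k)) * (if i = j \<and> k = 0 then 1 else 0))
      = (\<Sum>k\<le>m. if k = 0 then (if i = j \<and> m = 0 then 1 else 0) else 0)"
    by (intro sum.cong) (auto simp: gbinomial_0_left)
  then show "fps_nth (fps_map augmentation (translate c (T_free i j))) m = fps_nth (if i = j then 1 else 0) m"
    by (simp add: fps_map_def translate_def augmentation_simps augmentation_T_free)
qed

lemma fps_map_augmentation_quantum_minor:
  assumes "distinct as"
  shows "fps_map augmentation (quantum_minor T_free as as) = 1"
proof -
  let ?m = "length as"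
  have "prod_list (map (\<lambda>r. if as ! \<sigma> r = as ! r then 1 else (0 :: complex fps)) [0..<?m]) =
      (if \<sigma> = id then 1 else 0)" if s: "\<sigma> permutes {..<?m}" for \<sigma>
  proof (cases "\<sigma> = id")
    case True
    then show ?thesis by (simp add: map_replicate_const)
  next
    case False
    then obtain r where r: "\<sigma> r \<noteq> r" by (auto simp: fun_eq_iff)
    then have "r < ?m" using s by (auto simp: permutes_def)
    moreover have "\<sigma> r < ?m" using permutes_in_image[OF s, of r] \<open>r < ?m\<close> by simp
    ultimately have "as ! \<sigma> r \<noteq> as ! r" using r assms by (simp add: nth_eq_iff_index_eq)
    with \<open>r < ?m\<close> False show ?thesis by (auto simp: prod_list_zero_iff)
  qed
  note perm = this
  have map_prod_list: "fps_map augmentation (prod_list xs) = prod_list (map (fps_map augmentation) xs)"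
    for xs :: "rtt_generator free_algebra fps list"
    by (induction xs) (simp_all add: fps_map_augmentation_mult)
  have "fps_map augmentation (quantum_minor T_free as as) =
      (\<Sum>\<sigma> | \<sigma> permutes {..<?m}. of_int (sign \<sigma>) * (if \<sigma> = id then 1 else 0))"
    unfolding quantum_minor_def fps_map_augmentation_sum
    by (intro sum.cong refl)
       (simp add: fps_map_augmentation_mult fps_map_augmentation_of_int map_prod_list o_def
          fps_map_augmentation_translate_T perm)
  also have "\<dots> = (\<Sum>\<sigma> | \<sigma> permutes {..<?m}. if \<sigma> = id then 1 else 0)"
    by (intro sum.cong) auto
  also have "\<dots> = 1"
    by (simp add: finite_permutations permutes_id)
  finally show ?thesis .
qed

lemma augmentation_rtt_relators: "x \<in> rtt_relators n \<Longrightarrow> augmentation x = 0"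
proof (induction rule: rtt_relators.induct)
  case (rtt i j k l r s)
  show ?case by (simp add: comm_def augmentation_simps augmentation_T_free)
next
  case (quantum_determinant k)
  have "fps_nth (fps_map augmentation (quantum_minor T_free [1..<n+1] [1..<n+1])) k = fps_nth 1 k"
    by (simp only: fps_map_augmentation_quantum_minor distinct_upt)
  then show ?case by (simp add: fps_map_def augmentation_simps)
qed simp

text \<open>The Yangian of \<open>sl_n\<close> where \<open>n\<close> is the cardinality of the type \<^typ>\<open>'n\<close>.\<close>

quotient_type 'n yangian = "rtt_generator free_algebra" / "ideal_cong (rtt_relators CARD('n))"
  by (rule equivp_ideal_cong)

lemma yangian_nontrivial: "\<not> ideal_cong (rtt_relators n) 0 1"
  by (rule presentation_nontrivial) (rule augmentation_rtt_relators)

instantiation yangian :: (type) complex_algebra_1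
begin

lift_definition zero_yangian :: "'a yangian" is 0 .
lift_definition one_yangian :: "'a yangian" is 1 .
lift_definition plus_yangian :: "'a yangian \<Rightarrow> 'a yangian \<Rightarrow> 'a yangian" is "(+)"
  by (rule ideal_cong_add)
lift_definition uminus_yangian :: "'a yangian \<Rightarrow> 'a yangian" is uminus
  by (rule ideal_cong_uminus)
lift_definition minus_yangian :: "'a yangian \<Rightarrow> 'a yangian \<Rightarrow> 'a yangian" is "(-)"
  by (rule ideal_cong_minus)
lift_definition times_yangian :: "'a yangian \<Rightarrow> 'a yangian \<Rightarrow> 'a yangian" is "(*)"
  by (rule ideal_cong_mult)
lift_definition scaleC_yangian :: "complex \<Rightarrow> 'a yangian \<Rightarrow> 'a yangian" is scaleC
  by (rule ideal_cong_scaleC)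

instance
proof
  show "(0 :: 'a yangian) \<noteq> 1"
    by transfer (rule yangian_nontrivial)
qed (transfer, rule ideal_cong_eqI,
      simp add: distrib_left distrib_right mult.assoc add.assoc add.commute scaleC_add_right
        scaleC_add_left scaleC_scaleC scaleC_one mult_scaleC_left mult_scaleC_right)+

end

lift_definition T_gen :: "nat \<Rightarrow> nat \<Rightarrow> nat \<Rightarrow> 'n yangian" is "\<lambda>i j k. gen (TGen i j k)" .

definition T_ser :: "nat \<Rightarrow> nat \<Rightarrow> 'n yangian fps" where
  "T_ser = T_series T_gen"

definition t_minor :: "nat list \<Rightarrow> nat list \<Rightarrow> 'n yangian fps" where
  "t_minor = quantum_minor T_ser"

definition is_comultiplication :: "('n yangian \<Rightarrow> ('n yangian, 'n yangian) tensor) \<Rightarrow> bool" where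
  "is_comultiplication \<Delta> \<longleftrightarrow> algebra_hom \<Delta> \<and>
     (\<forall>k\<in>{1..CARD('n)}. \<forall>l\<in>{1..CARD('n)}. fps_map \<Delta> (T_ser k l) = (\<Sum>r = 1..CARD('n). T_ser k r \<otimes> T_ser r l))"


section \<open>The Drinfel'd realisation\<close>

datatype drinfeld_generator = EGen nat nat | FGen nat nat | HGen nat nat

definition cartan :: "nat \<Rightarrow> nat \<Rightarrow> int" where
  "cartan i j = (if i = j then 2 else if i = Suc j \<or> j = Suc i then -1 else 0)"

abbreviation "e_free i k \<equiv> gen (EGen i k)"
abbreviation "f_free i k \<equiv> gen (FGen i k)"
abbreviation "h_free i k \<equiv> gen (HGen i k)"

text \<open>For \<open>ks = [k\<^sub>1, \<dots>, k\<^sub>N]\<close>, the symmetrised iterated bracket of \<open>x k\<^sub>1, \<dots>, x k\<^sub>N\<close> with \<open>y\<close>.\<close>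

definition serre :: "(nat \<Rightarrow> 'a :: ring) \<Rightarrow> nat list \<Rightarrow> 'a \<Rightarrow> 'a" where
  "serre x ks y =
     (\<Sum>\<sigma> | \<sigma> permutes {..<length ks}. foldr (\<lambda>r z. comm (x (ks ! \<sigma> r)) z) [0..<length ks] y)"

inductive_set drinfeld_relators :: "nat \<Rightarrow> drinfeld_generator free_algebra set" for n where
  e_out_of_range: "i \<notin> {1..<n} \<Longrightarrow> e_free i k \<in> drinfeld_relators n"
| f_out_of_range: "i \<notin> {1..<n} \<Longrightarrow> f_free i k \<in> drinfeld_relators n"
| h_out_of_range: "i \<notin> {1..<n} \<Longrightarrow> h_free i k \<in> drinfeld_relators n"
| hh: "i \<in> {1..<n} \<Longrightarrow> j \<in> {1..<n} \<Longrightarrow>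
    comm (h_free i k) (h_free j l) \<in> drinfeld_relators n"
| ef: "i \<in> {1..<n} \<Longrightarrow> j \<in> {1..<n} \<Longrightarrow>
    comm (e_free i k) (f_free j l) - (if i = j then h_free i (k + l) else 0) \<in> drinfeld_relators n"
| h0e: "i \<in> {1..<n} \<Longrightarrow> j \<in> {1..<n} \<Longrightarrow>
    comm (h_free i 0) (e_free j l) - of_int (cartan i j) *\<^sub>C e_free j l \<in> drinfeld_relators n"
| h0f: "i \<in> {1..<n} \<Longrightarrow> j \<in> {1..<n} \<Longrightarrow>
    comm (h_free i 0) (f_free j l) - (- of_int (cartan i j)) *\<^sub>C f_free j l \<in> drinfeld_relators n"
| he: "i \<in> {1..<n} \<Longrightarrow> j \<in> {1..<n} \<Longrightarrow>
    comm (h_free i (Suc k)) (e_free j l) - comm (h_free i k) (e_free j (Suc l))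
      - (of_int (cartan i j) / 2) *\<^sub>C (h_free i k * e_free j l + e_free j l * h_free i k)
    \<in> drinfeld_relators n"
| hf: "i \<in> {1..<n} \<Longrightarrow> j \<in> {1..<n} \<Longrightarrow>
    comm (h_free i (Suc k)) (f_free j l) - comm (h_free i k) (f_free j (Suc l))
      - (- of_int (cartan i j) / 2) *\<^sub>C (h_free i k * f_free j l + f_free j l * h_free i k)
    \<in> drinfeld_relators n"
| ee: "i \<in> {1..<n} \<Longrightarrow> j \<in> {1..<n} \<Longrightarrow>
    comm (e_free i (Suc k)) (e_free j l) - comm (e_free i k) (e_free j (Suc l))
      - (of_int (cartan i j) / 2) *\<^sub>C (e_free i k * e_free j l + e_free j l * e_free i k)
    \<in> drinfeld_relators n"
| ff: "i \<in> {1..<n} \<Longrightarrow> j \<in> {1..<n} \<Longrightarrow>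
    comm (f_free i (Suc k)) (f_free j l) - comm (f_free i k) (f_free j (Suc l))
      - (- of_int (cartan i j) / 2) *\<^sub>C (f_free i k * f_free j l + f_free j l * f_free i k)
    \<in> drinfeld_relators n"
| serre_e: "i \<in> {1..<n} \<Longrightarrow> j \<in> {1..<n} \<Longrightarrow> i \<noteq> j \<Longrightarrow> int (length ks) = 1 - cartan i j \<Longrightarrow>
    serre (e_free i) ks (e_free j l) \<in> drinfeld_relators n"
| serre_f: "i \<in> {1..<n} \<Longrightarrow> j \<in> {1..<n} \<Longrightarrow> i \<noteq> j \<Longrightarrow> int (length ks) = 1 - cartan i j \<Longrightarrow>
    serre (f_free i) ks (f_free j l) \<in> drinfeld_relators n"

lemma augmentation_serre: "augmentation y = 0 \<Longrightarrow> augmentation (serre x ks y) = 0"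
proof -
  assume y: "augmentation y = 0"
  have "augmentation (foldr (\<lambda>r z. comm (x (ks ! \<sigma> r)) z) rs y) = 0" for \<sigma> rs
    by (induction rs) (simp_all add: y comm_def augmentation_simps)
  from this[of _ "[0..<length ks]"] show ?thesis
    unfolding serre_def augmentation_sum by (intro sum.neutral ballI)
qed

lemma augmentation_drinfeld_relators: "x \<in> drinfeld_relators n \<Longrightarrow> augmentation x = 0"
  by (induction rule: drinfeld_relators.induct)
     (simp_all add: comm_def augmentation_simps augmentation_serre)

quotient_type 'n drinfeld_yangian =
    "drinfeld_generator free_algebra" / "ideal_cong (drinfeld_relators CARD('n))"
  by (rule equivp_ideal_cong)

lemma drinfeld_yangian_nontrivial: "\<not> ideal_cong (drinfeld_relators n) 0 1"
  by (rule presentation_nontrivial) (rule augmentation_drinfeld_relators)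

instantiation drinfeld_yangian :: (type) complex_algebra_1
begin

lift_definition zero_drinfeld_yangian :: "'a drinfeld_yangian" is 0 .
lift_definition one_drinfeld_yangian :: "'a drinfeld_yangian" is 1 .
lift_definition plus_drinfeld_yangian :: "'a drinfeld_yangian \<Rightarrow> 'a drinfeld_yangian \<Rightarrow> 'a drinfeld_yangian" is "(+)"
  by (rule ideal_cong_add)
lift_definition uminus_drinfeld_yangian :: "'a drinfeld_yangian \<Rightarrow> 'a drinfeld_yangian" is uminus
  by (rule ideal_cong_uminus)
lift_definition minus_drinfeld_yangian :: "'a drinfeld_yangian \<Rightarrow> 'a drinfeld_yangian \<Rightarrow> 'a drinfeld_yangian" is "(-)"
  by (rule ideal_cong_minus)
lift_definition times_drinfeld_yangian :: "'a drinfeld_yangian \<Rightarrow> 'a drinfeld_yangian \<Rightarrow> 'a drinfeld_yangian" is "(*)"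
  by (rule ideal_cong_mult)
lift_definition scaleC_drinfeld_yangian :: "complex \<Rightarrow> 'a drinfeld_yangian \<Rightarrow> 'a drinfeld_yangian" is scaleC
  by (rule ideal_cong_scaleC)

instance
proof
  show "(0 :: 'a drinfeld_yangian) \<noteq> 1"
    by transfer (rule drinfeld_yangian_nontrivial)
qed (transfer, rule ideal_cong_eqI,
      simp add: distrib_left distrib_right mult.assoc add.assoc add.commute scaleC_add_right
        scaleC_add_left scaleC_scaleC scaleC_one mult_scaleC_left mult_scaleC_right)+

end

lift_definition e_gen :: "nat \<Rightarrow> nat \<Rightarrow> 'n drinfeld_yangian" is "\<lambda>i k. e_free i k" .
lift_definition f_gen :: "nat \<Rightarrow> nat \<Rightarrow> 'n drinfeld_yangian" is "\<lambda>i k. f_free i k" .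
lift_definition h_gen :: "nat \<Rightarrow> nat \<Rightarrow> 'n drinfeld_yangian" is "\<lambda>i k. h_free i k" .

text \<open>The Drinfel'd generating series, transported to the RTT realisation by \<open>\<phi>\<close>.\<close>

definition e_ser :: "('n drinfeld_yangian \<Rightarrow> 'n yangian) \<Rightarrow> nat \<Rightarrow> 'n yangian fps" where
  "e_ser \<phi> i = fps_map \<phi> (Abs_fps (\<lambda>m. case m of 0 \<Rightarrow> 0 | Suc k \<Rightarrow> e_gen i k))"

definition f_ser :: "('n drinfeld_yangian \<Rightarrow> 'n yangian) \<Rightarrow> nat \<Rightarrow> 'n yangian fps" where
  "f_ser \<phi> i = fps_map \<phi> (Abs_fps (\<lambda>m. case m of 0 \<Rightarrow> 0 | Suc k \<Rightarrow> f_gen i k))"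

definition h_ser :: "('n drinfeld_yangian \<Rightarrow> 'n yangian) \<Rightarrow> nat \<Rightarrow> 'n yangian fps" where
  "h_ser \<phi> i = fps_map \<phi> (Abs_fps (\<lambda>m. case m of 0 \<Rightarrow> 1 | Suc k \<Rightarrow> h_gen i k))"

text \<open>The series inverted below have constant term \<open>1\<close>, hence are units whose inverse is the right
  inverse with constant term \<open>1\<close>.\<close>

definition is_drinfeld_iso :: "('n drinfeld_yangian \<Rightarrow> 'n yangian) \<Rightarrow> bool" where
  "is_drinfeld_iso \<phi> \<longleftrightarrow> algebra_iso \<phi> \<and> (\<forall>i\<in>{1..<CARD('n)}.
     let t = (\<lambda>j. t_minor [1..<j+1] [1..<j+1]);
         inv = (\<lambda>F. fps_right_inverse F 1);
         c = (of_nat i - 2) / 2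
     in translate c (e_ser \<phi> i) = inv (t i) * t_minor ([1..<i] @ [i]) ([1..<i] @ [i+1]) \<and>
        translate c (f_ser \<phi> i) = t_minor ([1..<i] @ [i+1]) ([1..<i] @ [i]) * inv (t i) \<and>
        translate c (h_ser \<phi> i) =
          inv (t i) * t (i - 1) * translate (-1) (t (i+1)) * inv (translate (-1) (t i)))"


section \<open>Generalised adjoint actions\<close>

text \<open>Since \<open>e\<^sub>i\<^sub>,\<^sub>j\<close> and \<open>f\<^sub>j\<^sub>,\<^sub>i\<close> of degree zero are the coefficients of \<open>u\<inverse>\<close> in \<open>T_ser i j\<close> and \<open>T_ser j i\<close>, the
  adjoint actions of both are instances of \<open>Ad_plus\<close> and \<open>Ad_minus\<close>.\<close>

definition Ad_plus :: "nat \<Rightarrow> nat \<Rightarrow> 'n yangian fps \<Rightarrow> 'n yangian fps" where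
  "Ad_plus a b X = (if a = b then X else comm (fps_const (T_gen a b 1)) X)"

definition Ad_minus :: "nat \<Rightarrow> nat \<Rightarrow> 'n yangian fps \<Rightarrow> 'n yangian fps" where
  "Ad_minus a b X = (if a = b then X else - comm (fps_const (T_gen a b 1)) X)"

text \<open>Below, the argument \<open>c\<close> means that the operator is taken at \<open>u + c\<close>. The suffix \<open>left\<close>
  marks the operators which multiply by the correction series from the left (superscript \<open>\<alpha>\<close>
  written in front), the suffix \<open>right\<close> those which multiply from the right.\<close>

definition e_corr :: "('n drinfeld_yangian \<Rightarrow> 'n yangian) \<Rightarrow> complex \<Rightarrow> nat \<Rightarrow> nat \<Rightarrow> nat \<Rightarrow> 'n yangian fps" where
  "e_corr \<phi> c \<alpha> i j =
     (if i \<le> \<alpha> \<and> \<alpha> < j then Ad_minus i \<alpha> (Ad_plus (\<alpha>+1) j (translate c (e_ser \<phi> \<alpha>))) else 0)"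

definition f_corr :: "('n drinfeld_yangian \<Rightarrow> 'n yangian) \<Rightarrow> complex \<Rightarrow> nat \<Rightarrow> nat \<Rightarrow> nat \<Rightarrow> 'n yangian fps" where
  "f_corr \<phi> c \<alpha> j i =
     (if i \<le> \<alpha> \<and> \<alpha> < j then Ad_plus \<alpha> i (Ad_minus j (\<alpha>+1) (translate c (f_ser \<phi> \<alpha>))) else 0)"

definition gen_E_left where
  "gen_E_left \<phi> c \<alpha> i j X = Ad_plus i j X + e_corr \<phi> c \<alpha> i j * X"

definition gen_E_right where
  "gen_E_right \<phi> c \<alpha> i j X = Ad_plus i j X + X * e_corr \<phi> c \<alpha> i j"

definition gen_F_left where
  "gen_F_left \<phi> c \<alpha> j i X = Ad_minus j i X + f_corr \<phi> c \<alpha> j i * X"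

definition gen_F_right where
  "gen_F_right \<phi> c \<alpha> j i X = Ad_minus j i X + X * f_corr \<phi> c \<alpha> j i"

text \<open>For \<open>ks = [k\<^sub>1, \<dots>, k\<^sub>m]\<close> this is \<open>g 1 k\<^sub>1 \<circ> \<dots> \<circ> g (m - 1) k\<^sub>m\<^sub>-\<^sub>1 \<circ> g (m + 1) k\<^sub>m\<close>.\<close>

definition iterated :: "(nat \<Rightarrow> nat \<Rightarrow> 'a \<Rightarrow> 'a) \<Rightarrow> nat list \<Rightarrow> 'a \<Rightarrow> 'a" where
  "iterated g ks =
     foldr (\<lambda>(r, k). g r k) (zip ([1..<length ks] @ [length ks + 1]) ks)"

definition E_left where "E_left \<phi> c \<alpha> = iterated (\<lambda>r k. gen_E_left \<phi> c \<alpha> r k)"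
definition E_right where "E_right \<phi> c \<alpha> = iterated (\<lambda>r k. gen_E_right \<phi> c \<alpha> r k)"
definition F_left where "F_left \<phi> c \<alpha> = iterated (\<lambda>r k. gen_F_left \<phi> c \<alpha> k r)"
definition F_right where "F_right \<phi> c \<alpha> = iterated (\<lambda>r k. gen_F_right \<phi> c \<alpha> k r)"

definition index_lists :: "nat \<Rightarrow> nat \<Rightarrow> nat list set" where
  "index_lists n m = {ks. length ks = m \<and> sorted_wrt (<) ks \<and> set ks \<subseteq> {1..n} \<and> last ks \<noteq> m}"

definition g_ser :: "('n drinfeld_yangian \<Rightarrow> 'n yangian) \<Rightarrow> nat \<Rightarrow> 'n yangian fps" where
  "g_ser \<phi> i = h_ser \<phi> i + f_ser \<phi> i * translate 1 (e_ser \<phi> i)"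

definition g_tilde_ser :: "('n drinfeld_yangian \<Rightarrow> 'n yangian) \<Rightarrow> nat \<Rightarrow> 'n yangian fps" where
  "g_tilde_ser \<phi> i = h_ser \<phi> i + translate 1 (f_ser \<phi> i) * e_ser \<phi> i"

end

theory Submission
  imports Defs
begin

text \<open>
  Fix the node \<open>i\<close> and put \<open>I = (1, \<dots>, i)\<close> and \<open>J = (1, \<dots>, i - 1, i + 1)\<close>. Write \<open>t A B\<close> for the
  quantum minor with rows \<open>A\<close> and columns \<open>B\<close>, and \<open>Q = t I I\<close>. Up to a common translation of \<open>u\<close>, the
  isomorphism \<open>\<phi>\<close> says \<open>e = Q\<inverse> t I J\<close> and \<open>f = t J I Q\<inverse>\<close>. Quantum minors satisfy the
  Cauchy--Binet formula \<open>\<Delta>(t A B) = \<Sum>C. t A C \<otimes> t C B\<close>, with \<open>C\<close> running over the increasing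
  lists (\<open>fps_map_quantum_minor_comultiplication\<close>). Isolating the term \<open>C = I\<close> gives
  \<open>(Q\<inverse> \<otimes> Q\<inverse>) \<Delta>(Q) = 1 + S\<close> with \<open>S = \<Sum>C \<noteq> I. Q\<inverse> t I C \<otimes> Q\<inverse> t C I\<close>, which is inverted by a
  geometric series because \<open>S\<close> has no constant term. Hence \<open>\<Delta>(e) = \<Delta>(Q)\<inverse> \<Delta>(t I J)\<close> is the
  geometric series in \<open>S\<close> times \<open>\<Sum>C. Q\<inverse> t I C \<otimes> Q\<inverse> t C J\<close>; the formulas for \<open>f\<close> and for
  \<open>h + f(u) e(u + 1)\<close> come from dividing by \<open>\<Delta>(Q)\<close> on the right. It remains to recognise the factors
  \<open>Q\<inverse> t I C\<close>, \<open>Q\<inverse> t C I\<close>, \<open>Q\<inverse> t C J\<close> and their mirror images.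

  \<^bold>\<open>The factors are iterated generalised adjoint actions.\<close> The commutator with \<open>T\<^sub>r\<^sub>k\<close> of level one
  replaces the column \<open>r\<close> of a minor by \<open>k\<close> and the row \<open>k\<close> by \<open>r\<close>. The correction series in the
  generalised adjoint action turns out to be \<open>Q\<inverse> [T\<^sub>r\<^sub>k, Q]\<close> (\<open>e_corr_eq\<close>), so the action is the plain
  commutator conjugated by multiplication with \<open>Q\<inverse>\<close> (\<open>gen_E_left_eq\<close> and its variants). Composing
  the actions changes the list \<open>J\<close> into any other increasing list, one entry after the other
  (\<open>iterated_actions\<close>).

  \<^bold>\<open>The starting points.\<close> The iterations start from \<open>e(u) = Q\<inverse> t I J\<close> and \<open>f(u) = t J I Q\<inverse>\<close>, but also from
  \<open>t I J Q\<inverse>\<close>, \<open>Q\<inverse> t J I\<close>, \<open>t J J Q\<inverse>\<close> and \<open>Q\<inverse> t J J\<close>. These are \<open>e(u + 1)\<close>, \<open>f(u + 1)\<close> and the two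
  series \<open>g\<close>. Instead of commuting quantum minors taken at different points, the proof reads this
  off the Drinfel'd relations. The element \<open>s = (h\<^sub>1 - h\<^sub>0\<^sup>2/2)/2\<close> satisfies \<open>[s, e\<^sub>l] = e\<^sub>l\<^sub>+\<^sub>1\<close>, so the
  equation \<open>[s, e(u)] = u e(u) - e\<^sub>0\<close> determines \<open>e(u)\<close> from \<open>e\<^sub>0\<close>. As \<open>Q\<close> commutes with \<open>s\<close> and
  \<open>[e\<^sub>0, Q] = t I J\<close>, the conjugate \<open>Q e(u) Q\<inverse> = t I J Q\<inverse>\<close> satisfies the same equation with \<open>u + 1\<close> in
  place of \<open>u\<close> and therefore equals \<open>e(u + 1)\<close> (\<open>conjugation_eq_translation\<close>). That \<open>Q\<close> commutes
  with \<open>s\<close> holds because the principal minors can be recovered from the series \<open>h\<close>: coefficient by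
  coefficient this means to invert the Cartan matrix (\<open>principal_centralizes\<close>). Finally the commutator
  of \<open>e\<^sub>0\<close> with \<open>t J I = f Q\<close> equals \<open>t J J - Q\<close> on the one hand and \<open>(h - 1) Q + f t I J\<close> on the other,
  which identifies \<open>t J J\<close> (\<open>g_ser_eq\<close>).
\<close>

section \<open>Complex algebras\<close>

lemma scaleC_zero_right [simp]: "c *\<^sub>C (0 :: 'a :: complex_algebra_1) = 0"
  using scaleC_add_right[of c 0 "0 :: 'a"] by simp

lemma scaleC_zero_left [simp]: "0 *\<^sub>C (x :: 'a :: complex_algebra_1) = 0"
  using scaleC_add_left[of 0 0 x] by simp

lemma scaleC_sum_right: "c *\<^sub>C sum f A = (\<Sum>x\<in>A. c *\<^sub>C (f x :: 'a :: complex_algebra_1))"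
  by (induction A rule: infinite_finite_induct) (simp_all add: scaleC_add_right)

lemma scaleC_sum_left: "sum f A *\<^sub>C (x :: 'a :: complex_algebra_1) = (\<Sum>a\<in>A. f a *\<^sub>C x)"
  by (induction A rule: infinite_finite_induct) (simp_all add: scaleC_add_left)

lemma scaleC_neg_one: "(- 1) *\<^sub>C (x :: 'a :: complex_algebra_1) = - x"
  using scaleC_add_left[of 1 "-1" x] by (simp add: scaleC_one eq_neg_iff_add_eq_0 add.commute)

lemma scaleC_uminus: "c *\<^sub>C (- x :: 'a :: complex_algebra_1) = - (c *\<^sub>C x)"
  using scaleC_add_right[of c x "- x"] by (simp add: eq_neg_iff_add_eq_0 add.commute)

lemma scaleC_minus_left: "(- c) *\<^sub>C (x :: 'a :: complex_algebra_1) = - (c *\<^sub>C x)"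
  using scaleC_add_left[of c "- c" x] by (simp add: eq_neg_iff_add_eq_0 add.commute)

lemma scaleC_diff: "c *\<^sub>C (x - y :: 'a :: complex_algebra_1) = c *\<^sub>C x - c *\<^sub>C y"
  using scaleC_add_right[of c x "- y"] by (simp add: scaleC_uminus)

lemma scaleC_cancel:
  assumes "a \<noteq> 0" "a *\<^sub>C x = a *\<^sub>C (y :: 'a :: complex_algebra_1)"
  shows "x = y"
proof -
  have "inverse a *\<^sub>C (a *\<^sub>C x) = inverse a *\<^sub>C (a *\<^sub>C y)" using assms(2) by simp
  then show ?thesis using assms(1) by (simp add: scaleC_scaleC scaleC_one)
qed

lemma of_nat_scaleC: "(of_nat k :: complex) *\<^sub>C x = of_nat k * (x :: 'a :: complex_algebra_1)"
  by (induction k) (simp_all add: scaleC_add_left scaleC_one distrib_right)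

text \<open>Antisymmetry makes minors with a repeated index vanish, because 2 is invertible.\<close>

lemma eq_neg_self_iff_zero:
  assumes "x = - (x :: 'a :: complex_algebra_1)"
  shows "x = 0"
proof (rule scaleC_cancel[of 2])
  have "(2 :: complex) *\<^sub>C x = x + x"
    using scaleC_add_left[of 1 1 x] by (simp add: scaleC_one)
  then show "2 *\<^sub>C x = 2 *\<^sub>C 0" using assms by simp (metis add.right_inverse)
qed simp

section \<open>Translation of power series\<close>

lemma fps_map_nth [simp]: "fps_nth (fps_map f F) k = f (fps_nth F k)"
  by (simp add: fps_map_def)

text \<open>The coefficient of \<open>x\<close> to the power \<open>k + r\<close> in \<open>(x / (1 + c
  x))\<close> to the power \<open>k\<close>, that is, of \<open>u\<close> to the power \<open>-k -
  r\<close> in \<open>(u + c)\<close> to the power \<open>-k\<close>.\<close>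

definition translation_coeff :: "complex \<Rightarrow> nat \<Rightarrow> nat \<Rightarrow> complex" where
  "translation_coeff c k r = ((- of_nat k) gchoose r) * c ^ r"

lemma translate_nth:
  "fps_nth (translate c F) m = (\<Sum>k\<le>m. translation_coeff c k (m - k) *\<^sub>C fps_nth F k)"
  by (simp add: translate_def translation_coeff_def)

lemma translation_coeff_0 [simp]: "translation_coeff c k 0 = 1"
  by (simp add: translation_coeff_def)

lemma translation_coeff_pole_0: "translation_coeff c 0 r = (if r = 0 then 1 else 0)"
  by (simp add: translation_coeff_def gbinomial_0_left)

text \<open>Multiplicativity of translation on the powers of \<open>u\<close>; this is Vandermonde's
  identity.\<close>

lemma translation_coeff_convolve:
  "(\<Sum>s\<le>r. translation_coeff c j s * translation_coeff c l (r - s)) = translation_coeff c (j + l) r"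
proof -
  have "(\<Sum>s\<le>r. translation_coeff c j s * translation_coeff c l (r - s))
      = (\<Sum>s\<le>r. ((- of_nat j gchoose s) * (- of_nat l gchoose (r - s))) * c ^ r)"
    by (intro sum.cong refl) (simp add: translation_coeff_def power_add[symmetric])
  also have "\<dots> = ((- of_nat j + - of_nat l) gchoose r) * c ^ r"
    by (simp only: sum_distrib_right[symmetric] atMost_atLeast0 gbinomial_Vandermonde)
  finally show ?thesis by (simp add: translation_coeff_def add.commute)
qed

text \<open>Translations by \<open>c\<close> and \<open>d\<close> compose on the powers of \<open>u\<close>;
  trinomial revision reduces this to the binomial theorem.\<close>

lemma translation_coeff_add:
  "(\<Sum>s\<le>r. translation_coeff c (j + s) (r - s) * translation_coeff d j s) = translation_coeff (c + d) j r"
proof -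
  have "translation_coeff c (j + s) (r - s) * translation_coeff d j s
      = (- of_nat j gchoose r) * (of_nat (r choose s) * d ^ s * c ^ (r - s))" if "s \<le> r" for s
    using gbinomial_trinomial_revision[OF that, of "- of_nat j :: complex"]
    by (simp add: translation_coeff_def binomial_gbinomial algebra_simps)
  then have "(\<Sum>s\<le>r. translation_coeff c (j + s) (r - s) * translation_coeff d j s)
      = (- of_nat j gchoose r) * (\<Sum>s\<le>r. of_nat (r choose s) * d ^ s * c ^ (r - s))"
    by (simp add: sum_distrib_left)
  then show ?thesis
    by (simp add: binomial_ring[symmetric] translation_coeff_def add.commute)
qed

lemma translate_add: "translate c (F + G) = translate c F + translate c G"
  by (rule fps_ext) (simp add: translate_nth scaleC_add_right sum.distrib)

lemma translate_0 [simp]: "translate c 0 = 0"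
  by (rule fps_ext) (simp add: translate_nth)

lemma translate_uminus: "translate c (- F) = - translate c F"
  using translate_add[of c F "- F"] by (simp add: eq_neg_iff_add_eq_0 add.commute)

lemma translate_diff: "translate c (F - G) = translate c F - translate c G"
  using translate_add[of c F "- G"] by (simp add: translate_uminus)

lemma translate_sum: "translate c (sum f A) = (\<Sum>x\<in>A. translate c (f x))"
  by (induction A rule: infinite_finite_induct) (simp_all add: translate_add)

lemma translate_const [simp]: "translate c (fps_const x) = fps_const x"
proof (rule fps_ext)
  fix m
  have "(\<Sum>k\<le>m. translation_coeff c k (m - k) *\<^sub>C (if k = 0 then x else 0))
      = (\<Sum>k\<le>m. if k = 0 then (if m = 0 then x else 0) else 0)"
    by (intro sum.cong) (auto simp: translation_coeff_pole_0 scaleC_one)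
  then show "fps_nth (translate c (fps_const x)) m = fps_nth (fps_const x) m"
    by (simp add: translate_nth)
qed

lemma translate_1 [simp]: "translate c 1 = 1"
  using translate_const[of c 1] by simp

lemma translate_by_0 [simp]: "translate 0 F = F"
proof (rule fps_ext)
  fix m
  have "(\<Sum>k\<le>m. translation_coeff 0 k (m - k) *\<^sub>C fps_nth F k)
      = (\<Sum>k\<le>m. if k = m then fps_nth F k else 0)"
    by (intro sum.cong) (auto simp: translation_coeff_def scaleC_one power_0_left)
  then show "fps_nth (translate 0 F) m = fps_nth F m"
    by (simp add: translate_nth)
qed

lemma translate_nth_0 [simp]: "fps_nth (translate c F) 0 = fps_nth F 0"
  by (simp add: translate_nth scaleC_one)

lemma translate_nth_1 [simp]: "fps_nth (translate c F) 1 = fps_nth F 1"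
  by (simp add: translate_nth translation_coeff_pole_0 scaleC_one)

text \<open>Translation is a ring homomorphism although the coefficients do not commute, since
  \<open>u\<close> is central.\<close>

lemma translate_mult: "translate c (F * G) = translate c F * translate c G"
proof (rule fps_ext)
  fix m
  let ?F = "fps_nth F" and ?G = "fps_nth G" and ?t = "translation_coeff c"
  have "fps_nth (translate c (F * G)) m
      = (\<Sum>k\<le>m. \<Sum>j\<le>k. \<Sum>s\<le>m-k. (?t j s * ?t (k - j) (m - k - s)) *\<^sub>C (?F j * ?G (k - j)))"
    unfolding translate_nth fps_mult_nth atMost_atLeast0[symmetric] scaleC_sum_right
    by (intro sum.cong refl)
       (simp add: translation_coeff_convolve del: diff_diff_left flip: scaleC_sum_left)
  also have "\<dots> = (\<Sum>(k, j, s)\<in>(SIGMA k:{..m}. {..k} \<times> {..m-k}).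
      (?t j s * ?t (k - j) (m - k - s)) *\<^sub>C (?F j * ?G (k - j)))"
    by (simp add: sum.Sigma[symmetric] sum.cartesian_product[symmetric])
  also have "\<dots> = (\<Sum>(a, j, l)\<in>(SIGMA a:{..m}. {..a} \<times> {..m-a}).
      (?t j (a - j) *\<^sub>C ?F j) * (?t l (m - a - l) *\<^sub>C ?G l))"
    by (rule sum.reindex_bij_witness[where i = "\<lambda>(a, j, l). (j + l, j, a - j)"
          and j = "\<lambda>(k, j, s). (j + s, j, k - j)"])
       (auto simp: mult_scaleC_left mult_scaleC_right scaleC_scaleC add.commute mult.commute diff_diff_eq)
  also have "\<dots> = fps_nth (translate c F * translate c G) m"
    by (simp add: sum.Sigma[symmetric] sum.cartesian_product[symmetric] translate_nth fps_mult_nth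
        sum_product flip: atMost_atLeast0)
  finally show "fps_nth (translate c (F * G)) m = fps_nth (translate c F * translate c G) m" .
qed

lemma translate_translate: "translate c (translate d F) = translate (c + d) F"
proof (rule fps_ext)
  fix m
  let ?F = "fps_nth F"
  have "fps_nth (translate c (translate d F)) m
      = (\<Sum>k\<le>m. \<Sum>j\<le>k. (translation_coeff c k (m - k) * translation_coeff d j (k - j)) *\<^sub>C ?F j)"
    by (simp add: translate_nth scaleC_sum_right scaleC_scaleC)
  also have "\<dots> = (\<Sum>(k, j)\<in>(SIGMA k:{..m}. {..k}).
      (translation_coeff c k (m - k) * translation_coeff d j (k - j)) *\<^sub>C ?F j)"
    by (simp add: sum.Sigma[symmetric])
  also have "\<dots> = (\<Sum>(j, s)\<in>(SIGMA j:{..m}. {..m-j}).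
      (translation_coeff c (j + s) (m - j - s) * translation_coeff d j s) *\<^sub>C ?F j)"
    by (rule sum.reindex_bij_witness[where i = "\<lambda>(j, s). (j + s, j)" and j = "\<lambda>(k, j). (j, k - j)"])
       (auto simp: diff_diff_eq)
  also have "\<dots> = (\<Sum>j\<le>m. translation_coeff (c + d) j (m - j) *\<^sub>C ?F j)"
    by (simp add: sum.Sigma[symmetric] translation_coeff_add del: diff_diff_left flip: scaleC_sum_left)
  finally show "fps_nth (translate c (translate d F)) m = fps_nth (translate (c + d) F) m"
    by (simp add: translate_nth)
qed

section \<open>Algebra homomorphisms and tensor products of series\<close>

context
  fixes f :: "'a :: complex_algebra_1 \<Rightarrow> 'b :: complex_algebra_1"
  assumes f: "algebra_hom f"
begin

lemma algebra_hom_add: "f (x + y) = f x + f y"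
  and algebra_hom_scaleC: "f (c *\<^sub>C x) = c *\<^sub>C f x"
  and algebra_hom_mult: "f (x * y) = f x * f y"
  and algebra_hom_1: "f 1 = 1"
proof -
  from f interpret Vector_Spaces.linear scaleC scaleC f by (simp add: algebra_hom_def)
  show "f (x + y) = f x + f y" "f (c *\<^sub>C x) = c *\<^sub>C f x"
    by (rule add scale)+
  show "f (x * y) = f x * f y" "f 1 = 1" using f by (simp_all add: algebra_hom_def)
qed

lemma algebra_hom_0: "f 0 = 0"
  using algebra_hom_add[of 0 0] by simp

lemma algebra_hom_uminus: "f (- x) = - f x"
  using algebra_hom_add[of x "- x"] by (simp add: eq_neg_iff_add_eq_0 add.commute algebra_hom_0)

lemma algebra_hom_diff: "f (x - y) = f x - f y"
  using algebra_hom_add[of x "- y"] by (simp add: algebra_hom_uminus)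

lemma algebra_hom_sum: "f (sum g A) = (\<Sum>x\<in>A. f (g x))"
  by (induction A rule: infinite_finite_induct) (simp_all add: algebra_hom_0 algebra_hom_add)

lemma algebra_hom_comm: "f (comm x y) = comm (f x) (f y)"
  by (simp add: comm_def algebra_hom_diff algebra_hom_mult)

lemma fps_map_add: "fps_map f (F + G) = fps_map f F + fps_map f G"
  by (rule fps_ext) (simp add: algebra_hom_add)

lemma fps_map_0: "fps_map f 0 = 0"
  by (rule fps_ext) (simp add: algebra_hom_0)

lemma fps_map_1: "fps_map f 1 = 1"
  by (rule fps_ext) (simp add: algebra_hom_0 algebra_hom_1)

lemma fps_map_uminus: "fps_map f (- F) = - fps_map f F"
  by (rule fps_ext) (simp add: algebra_hom_uminus)

lemma fps_map_sum: "fps_map f (sum F A) = (\<Sum>x\<in>A. fps_map f (F x))"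
  by (induction A rule: infinite_finite_induct) (simp_all add: fps_map_0 fps_map_add)

lemma fps_map_mult: "fps_map f (F * G) = fps_map f F * fps_map f G"
  by (rule fps_ext) (simp add: fps_mult_nth algebra_hom_sum algebra_hom_mult)

lemma fps_map_prod_list: "fps_map f (prod_list Fs) = prod_list (map (fps_map f) Fs)"
  by (induction Fs) (simp_all add: fps_map_1 fps_map_mult)

lemma fps_map_of_int: "fps_map f (of_int z) = of_int z"
proof -
  have "fps_map f (of_nat k) = of_nat k" for k
    by (induction k) (simp_all add: fps_map_0 fps_map_1 fps_map_add)
  then show ?thesis by (cases z) (simp_all add: fps_map_uminus fps_map_add fps_map_1
      del: of_nat_Suc)
qed

lemma translate_fps_map: "translate c (fps_map f F) = fps_map f (translate c F)"
  by (rule fps_ext) (simp add: translate_nth algebra_hom_sum algebra_hom_scaleC)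

end

lemma ideal_cong_relator: "a - b \<in> R \<Longrightarrow> ideal_cong R a b"
  using ideal_generated.generator[of "a - b" R 1 1] by (simp add: ideal_cong_def)

lemma tensor_elem_add_left: "tensor_elem (a + a') b = tensor_elem a b + tensor_elem a' b"
  by transfer (rule ideal_cong_relator, rule tensor_relators.intros)

lemma tensor_elem_add_right: "tensor_elem a (b + b') = tensor_elem a b + tensor_elem a b'"
  by transfer (rule ideal_cong_relator, rule tensor_relators.intros)

lemma scaleC_single: "c *\<^sub>C Poly_Mapping.single k v = Poly_Mapping.single k (c * v)"
  by (simp add: scaleC_poly_mapping_def mult_single scaleC_complex_def)

lemma tensor_elem_scaleC_left: "tensor_elem (c *\<^sub>C a) b = c *\<^sub>C tensor_elem a b"
  by transfer (rule ideal_cong_relator, simp only: scaleC_single mult_1_right,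
      rule tensor_relators.intros)

lemma tensor_elem_scaleC_right: "tensor_elem a (c *\<^sub>C b) = c *\<^sub>C tensor_elem a b"
  by transfer (rule ideal_cong_relator, simp only: scaleC_single mult_1_right,
      rule tensor_relators.intros)

lemma tensor_elem_mult: "tensor_elem a b * tensor_elem a' b' = tensor_elem (a * a') (b * b')"
  by transfer (simp add: mult_single ideal_cong_refl)

lemma tensor_elem_1: "tensor_elem 1 1 = 1"
  by transfer (simp add: ideal_cong_refl zero_pure_tensor_def[symmetric])

text \<open>The two embeddings of the factors commute with each other and generate the tensor product, so
  every property of the tensor product of two series reduces to homomorphisms and one commutation.\<close>

definition tensor_left :: "'a \<Rightarrow> ('a :: complex_algebra_1, 'b :: complex_algebra_1) tensor" where
  "tensor_left a = tensor_elem a 1"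

definition tensor_right :: "'b \<Rightarrow> ('a :: complex_algebra_1, 'b :: complex_algebra_1) tensor" where
  "tensor_right b = tensor_elem 1 b"

lemma algebra_homI:
  assumes "\<And>x y. f (x + y) = f x + f y" "\<And>c x. f (c *\<^sub>C x) = c *\<^sub>C f x"
    and "\<And>x y. f (x * y) = f x * f y" "f 1 = 1"
  shows "algebra_hom f"
  unfolding algebra_hom_def Vector_Spaces.linear_iff by (simp add: assms vector_space_scaleC)

lemma algebra_hom_tensor_left: "algebra_hom tensor_left"
  by (rule algebra_homI)
     (simp_all add: tensor_left_def tensor_elem_add_left tensor_elem_scaleC_left tensor_elem_mult
        tensor_elem_1)

lemma algebra_hom_tensor_right: "algebra_hom tensor_right"
  by (rule algebra_homI)
     (simp_all add: tensor_right_def tensor_elem_add_right tensor_elem_scaleC_right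
        tensor_elem_mult tensor_elem_1)

lemma tensor_fps_factor: "F \<otimes> G = fps_map tensor_left F * fps_map tensor_right G"
  by (rule fps_ext)
     (simp add: tensor_fps_def fps_mult_nth atMost_atLeast0 tensor_left_def tensor_right_def
        tensor_elem_mult)

lemma tensor_left_right_commute:
  "fps_map tensor_right G * fps_map tensor_left F = fps_map tensor_left F * fps_map tensor_right G"
proof (rule fps_ext)
  fix m
  show "fps_nth (fps_map tensor_right G * fps_map tensor_left F) m
      = fps_nth (fps_map tensor_left F * fps_map tensor_right G) m"
    unfolding fps_mult_nth
    by (rule sum.reindex_bij_witness[where i = "\<lambda>k. m - k" and j = "\<lambda>k. m - k"])
       (auto simp: tensor_left_def tensor_right_def tensor_elem_mult)
qed

lemma tensor_fps_mult: "(F \<otimes> G) * (F' \<otimes> G') = (F * F') \<otimes> (G * G')"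
proof -
  let ?l = "fps_map tensor_left" and ?r = "fps_map tensor_right"
  have "(F \<otimes> G) * (F' \<otimes> G') = ?l F * (?r G * ?l F') * ?r G'"
    by (simp add: tensor_fps_factor mult.assoc)
  also have "\<dots> = (?l F * ?l F') * (?r G * ?r G')"
    by (simp add: tensor_left_right_commute mult.assoc)
  finally show ?thesis
    by (simp add: tensor_fps_factor fps_map_mult algebra_hom_tensor_left algebra_hom_tensor_right)
qed

lemma tensor_fps_1: "1 \<otimes> 1 = 1"
  by (simp add: tensor_fps_factor fps_map_1 algebra_hom_tensor_left algebra_hom_tensor_right)

lemma tensor_fps_sum_left: "sum f A \<otimes> G = (\<Sum>x\<in>A. f x \<otimes> G)"
  by (simp add: tensor_fps_factor fps_map_sum algebra_hom_tensor_left sum_distrib_right)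

lemma tensor_fps_of_int_left: "(of_int z * F) \<otimes> G = of_int z * (F \<otimes> G)"
  by (simp add: tensor_fps_factor fps_map_mult fps_map_of_int algebra_hom_tensor_left mult.assoc)

lemma tensor_fps_of_int_right: "F \<otimes> (of_int z * G) = of_int z * (F \<otimes> G)"
  using tensor_fps_mult[of F 1 1 "of_int z * G"]
  by (simp add: tensor_fps_factor fps_map_mult fps_map_of_int fps_map_1 algebra_hom_tensor_left
      algebra_hom_tensor_right) (metis Ints_of_int mult.assoc mult_of_int_commute)

lemma tensor_fps_sum_right: "F \<otimes> sum g A = (\<Sum>x\<in>A. F \<otimes> g x)"
  by (simp add: tensor_fps_factor fps_map_sum algebra_hom_tensor_right sum_distrib_left)

lemma translate_tensor_fps: "translate c (F \<otimes> G) = translate c F \<otimes> translate c G"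
  by (simp add: tensor_fps_factor translate_mult translate_fps_map algebra_hom_tensor_left
      algebra_hom_tensor_right)

lemma prod_list_tensor_fps:
  "prod_list (map (\<lambda>r. F r \<otimes> G r) rs) = prod_list (map F rs) \<otimes> prod_list (map G rs)"
  by (induction rs) (simp_all add: tensor_fps_mult tensor_fps_1)

lemma tensor_fps_nth_0: "fps_nth (F \<otimes> G) 0 = tensor_elem (fps_nth F 0) (fps_nth G 0)"
  by (simp add: tensor_fps_def)

section \<open>Inverses and geometric series\<close>

lemma fps_right_inverse_both:
  assumes "fps_nth (F :: 'a :: ring_1 fps) 0 = 1"
  shows "F * fps_right_inverse F 1 = 1" "fps_right_inverse F 1 * F = 1"
  using fps_right_inverse[of F 1] fps_left_inverse'[of 1 F 1] assms by simp_all

text \<open>The powers of \<open>S\<close> tend to zero in the topology of \<open>fps\<close>, so the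
  partial sums, which equal \<open>J - (-S)^N J\<close> for the inverse \<open>J\<close> of
  \<open>1 + S\<close>, converge to \<open>J\<close>.\<close>

lemma geometric_series_inverse:
  fixes S :: "'a :: ring_1 fps"
  assumes "fps_nth S 0 = 0"
  shows "suminf (\<lambda>m. (- 1) ^ m * S ^ m) * (1 + S) = 1"
    and "(1 + S) * suminf (\<lambda>m. (- 1) ^ m * S ^ m) = 1"
proof -
  define J where "J = fps_right_inverse (1 + S) 1"
  have J: "(1 + S) * J = 1" "J * (1 + S) = 1"
    using fps_right_inverse_both[of "1 + S"] assms by (simp_all add: J_def)
  have order: "fps_nth ((- S) ^ m * F) k = 0" if "k < m" for m k F
    using that
  proof (induction m arbitrary: k)
    case (Suc m)
    have "fps_nth (- S * ((- S) ^ m * F)) k = 0"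
    proof (subst fps_mult_nth, intro sum.neutral ballI)
      fix j assume "j \<in> {0..k}"
      then show "fps_nth (- S) j * fps_nth ((- S) ^ m * F) (k - j) = 0"
        using Suc assms by (cases "j = 0") auto
    qed
    then show ?case by (simp add: mult.assoc)
  qed simp
  have signed_power: "(- 1) ^ m * S ^ m = (- S) ^ m" for m
    by (simp add: power_minus[of S])
  have partial: "(\<Sum>m<N. (- S) ^ m) = J - (- S) ^ N * J" for N
  proof -
    have "(\<Sum>m<N. (- S) ^ m) * (1 + S) = 1 - (- S) ^ N"
    proof (induction N)
      case (Suc N)
      have "(\<Sum>m<Suc N. (- S) ^ m) * (1 + S)
          = (\<Sum>m<N. (- S) ^ m) * (1 + S) + (- S) ^ N - (- S) ^ N * (- S)"
        by (simp add: algebra_simps)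
      then show ?case unfolding Suc.IH by (simp only: power_Suc2 diff_add_cancel)
    qed simp
    then have "(\<Sum>m<N. (- S) ^ m) * ((1 + S) * J) = (1 - (- S) ^ N) * J"
      by (simp add: mult.assoc[symmetric])
    then show ?thesis by (simp add: J left_diff_distrib)
  qed
  have "(\<lambda>m. (- S) ^ m) sums J"
    unfolding sums_def partial
  proof (rule tendsto_fpsI)
    fix k
    show "\<forall>\<^sub>F N in sequentially. fps_nth (J - (- S) ^ N * J) k = fps_nth J k"
      by (rule eventually_sequentiallyI[of "Suc k"]) (simp add: order)
  qed
  then have "suminf (\<lambda>m. (- 1) ^ m * S ^ m) = J"
    unfolding signed_power by (rule sums_unique[symmetric])
  with J show "suminf (\<lambda>m. (- 1) ^ m * S ^ m) * (1 + S) = 1"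
    "(1 + S) * suminf (\<lambda>m. (- 1) ^ m * S ^ m) = 1" by simp_all
qed

section \<open>Antisymmetry of quantum minors\<close>

lemma fps_eq_neg_self_iff_zero: "F = - F \<Longrightarrow> F = (0 :: 'a :: complex_algebra_1 fps)"
  by (rule fps_ext) (metis eq_neg_self_iff_zero fps_neg_nth fps_zero_nth)

text \<open>Indexing rows and columns by functions makes permutations of the indices act by composition.\<close>

definition minor_term ::
  "nat \<Rightarrow> (nat \<Rightarrow> nat \<Rightarrow> 'a :: complex_algebra_1 fps) \<Rightarrow> (nat \<Rightarrow> nat) \<Rightarrow> (nat \<Rightarrow> nat) \<Rightarrow> 'a fps" where
  "minor_term m T a b = prod_list (map (\<lambda>r. translate (of_nat r) (T (a r) (b r))) [0..<m])"

definition minor_fun ::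
  "nat \<Rightarrow> (nat \<Rightarrow> nat \<Rightarrow> 'a :: complex_algebra_1 fps) \<Rightarrow> (nat \<Rightarrow> nat) \<Rightarrow> (nat \<Rightarrow> nat) \<Rightarrow> 'a fps" where
  "minor_fun m T a b = (\<Sum>\<sigma> | \<sigma> permutes {..<m}. of_int (sign \<sigma>) * minor_term m T (a \<circ> \<sigma>) b)"

lemma quantum_minor_conv_fun:
  "quantum_minor T as bs = minor_fun (length as) T (nth as) (nth bs)"
  by (simp add: quantum_minor_def minor_fun_def minor_term_def)

lemma minor_term_cong:
  assumes "\<And>r. r < m \<Longrightarrow> T (a r) (b r) = T' (a' r) (b' r)"
  shows "minor_term m T a b = minor_term m T' a' b'"
  unfolding minor_term_def using assms by (intro arg_cong[of _ _ prod_list] map_cong) auto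

lemma permutes_lessThan_less: "\<sigma> permutes {..<m} \<Longrightarrow> r < m \<Longrightarrow> \<sigma> r < (m :: nat)"
  using permutes_in_image[of \<sigma> "{..<m}" r] by simp

lemma minor_fun_cong:
  assumes "\<And>r s. r < m \<Longrightarrow> s < m \<Longrightarrow> T (a r) (b s) = T' (a' r) (b' s)"
  shows "minor_fun m T a b = minor_fun m T' a' b'"
  unfolding minor_fun_def
  by (intro sum.cong refl arg_cong2[of _ _ _ _ "(*)"] minor_term_cong)
     (simp add: assms permutes_lessThan_less)

lemma quantum_minor_cong:
  assumes "length as = length bs" "\<And>a b. a \<in> set as \<Longrightarrow> b \<in> set bs \<Longrightarrow> T a b = T' a b"
  shows "quantum_minor T as bs = quantum_minor T' as bs"
  unfolding quantum_minor_conv_fun by (rule minor_fun_cong) (simp add: assms)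

lemma sign_compose_permutes:
  "p permutes {..<m} \<Longrightarrow> q permutes {..<m} \<Longrightarrow> sign (p \<circ> q) = sign p * sign q" for m :: nat
  using permutation_permutes[of p] permutation_permutes[of q] by (intro sign_compose) auto

text \<open>The definition sums over permutations of the rows, so that permuting the rows only reindexes the
  sum. For columns the exchange relation below is required.\<close>

lemma minor_fun_permute_rows:
  assumes \<tau>: "\<tau> permutes {..<m}"
  shows "minor_fun m T (a \<circ> \<tau>) b = of_int (sign \<tau>) * minor_fun m T a b"
proof -
  have "minor_fun m T a b
      = (\<Sum>\<sigma> | \<sigma> permutes {..<m}. of_int (sign (\<tau> \<circ> \<sigma>)) * minor_term m T (a \<circ> (\<tau> \<circ> \<sigma>)) b)"
    unfolding minor_fun_def by (rule setum_permutations_compose_left[OF \<tau>])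
  also have "\<dots> = of_int (sign \<tau>) * minor_fun m T (a \<circ> \<tau>) b"
    unfolding minor_fun_def sum_distrib_left
    by (intro sum.cong refl) (simp add: sign_compose_permutes[OF \<tau>] mult.assoc o_assoc)
  finally have "of_int (sign \<tau>) * minor_fun m T a b
      = (of_int (sign \<tau>) * of_int (sign \<tau>)) * minor_fun m T (a \<circ> \<tau>) b"
    by (simp add: mult.assoc)
  moreover have "of_int (sign \<tau>) * of_int (sign \<tau>) = (1 :: 'a fps)"
    by (simp flip: of_int_mult)
  ultimately show ?thesis by simp
qed

text \<open>The minors of size two change sign when their columns are swapped. In other words,
  \<open>T(u)\<close> times the shift operator is a Manin matrix.\<close>

definition exchange_relation :: "(nat \<Rightarrow> nat \<Rightarrow> 'a :: complex_algebra_1 fps) \<Rightarrow> bool" where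
  "exchange_relation T \<longleftrightarrow> (\<forall>i j k l.
     T i j * translate 1 (T k l) - T k j * translate 1 (T i l) =
     T k l * translate 1 (T i j) - T i l * translate 1 (T k j))"

lemma upt_split: "p < m \<Longrightarrow> [0..<m] = [0..<p] @ p # [Suc p..<m]"
  using upt_add_eq_append[of 0 p "m - p"] by (simp add: upt_conv_Cons)

text \<open>The permutations \<open>\<sigma>\<close> and \<open>\<sigma> \<circ> (r r+1)\<close> together
  contribute a minor of size two in the neighbouring factors \<open>r\<close> and \<open>r +
  1\<close>, to which the exchange relation applies.\<close>

lemma minor_fun_swap_adjacent_columns:
  assumes T: "exchange_relation T" and r: "Suc r < m"
  shows "minor_fun m T a (b \<circ> transpose r (Suc r)) = - minor_fun m T a b"
proof -
  let ?s = "transpose r (Suc r)"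
  define D where "D b = minor_fun m T a b" for b
  define P where "P \<sigma> b = minor_term m T (a \<circ> \<sigma>) b" for \<sigma> b
  have s: "?s permutes {..<m}" using r by (intro permutes_swap_id) auto
  \<comment> \<open>the same sum, written once over \<open>\<sigma>\<close> and once over \<open>\<sigma> \<circ> (r r+1)\<close>\<close>
  have twice: "D b + D b = (\<Sum>\<sigma> | \<sigma> permutes {..<m}. of_int (sign \<sigma>) * (P \<sigma> b - P (\<sigma> \<circ> ?s) b))" for b
  proof -
    have "D b = (\<Sum>\<sigma> | \<sigma> permutes {..<m}. of_int (sign (\<sigma> \<circ> ?s)) * P (\<sigma> \<circ> ?s) b)"
      unfolding D_def minor_fun_def P_def by (rule sum_permutations_compose_right[OF s])
    also have "\<dots> = (\<Sum>\<sigma> | \<sigma> permutes {..<m}. - (of_int (sign \<sigma>) * P (\<sigma> \<circ> ?s) b))"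
      by (intro sum.cong refl) (simp add: sign_compose_permutes[OF _ s] sign_swap_id)
    finally have "D b + D b = (\<Sum>\<sigma> | \<sigma> permutes {..<m}. of_int (sign \<sigma>) * P \<sigma> b)
        + (\<Sum>\<sigma> | \<sigma> permutes {..<m}. - (of_int (sign \<sigma>) * P (\<sigma> \<circ> ?s) b))"
      by (simp add: D_def minor_fun_def P_def)
    then show ?thesis by (simp add: sum.distrib[symmetric] right_diff_distrib)
  qed
  have flip: "P \<sigma> (b \<circ> ?s) - P (\<sigma> \<circ> ?s) (b \<circ> ?s) = - (P \<sigma> b - P (\<sigma> \<circ> ?s) b)" for \<sigma> b
  proof -
    have split: "[0..<m] = [0..<r] @ r # Suc r # [Suc (Suc r)..<m]"
      using r upt_split[of r m] by (simp add: upt_conv_Cons)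
    define f where "f r' = translate (of_nat r') (T (a (\<sigma> r')) (b r'))" for r'
    define x where "x i j = translate (of_nat r) (T (a (\<sigma> i)) (b j))" for i j
    define y where "y i j = translate (of_nat (Suc r)) (T (a (\<sigma> i)) (b j))" for i j
    define before after where
      "before = prod_list (map f [0..<r])" and "after = prod_list (map f [Suc (Suc r)..<m])"
    have outer: "prod_list (map (\<lambda>r'. translate (of_nat r') (T (a (\<sigma> (p r'))) (b (q r')))) [0..<m])
        = before * (x (p r) (q r) * y (p (Suc r)) (q (Suc r))) * after"
      if "\<And>r'. r' \<noteq> r \<Longrightarrow> r' \<noteq> Suc r \<Longrightarrow> p r' = r' \<and> q r' = r'" for p q
    proof -
      have "map (\<lambda>r'. translate (of_nat r') (T (a (\<sigma> (p r'))) (b (q r')))) [0..<r] = map f [0..<r]"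
        "map (\<lambda>r'. translate (of_nat r') (T (a (\<sigma> (p r'))) (b (q r')))) [Suc (Suc r)..<m]
          = map f [Suc (Suc r)..<m]"
        by (simp_all add: that f_def)
      then show ?thesis
        unfolding split before_def after_def x_def y_def
        by (simp only: map_append list.map prod_list.append prod_list.Cons mult.assoc)
    qed
    have P: "P \<sigma> b = before * (x r r * y (Suc r) (Suc r)) * after"
      "P (\<sigma> \<circ> ?s) b = before * (x (Suc r) r * y r (Suc r)) * after"
      "P \<sigma> (b \<circ> ?s) = before * (x r (Suc r) * y (Suc r) r) * after"
      "P (\<sigma> \<circ> ?s) (b \<circ> ?s) = before * (x (Suc r) (Suc r) * y r r) * after"
      unfolding P_def minor_term_def
      using outer[of id id] outer[of ?s id] outer[of id ?s] outer[of ?s ?s] by simp_all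
    have xy: "x i j * y k l = translate (of_nat r) (T (a (\<sigma> i)) (b j) * translate 1 (T (a (\<sigma> k)) (b l)))"
      for i j k l
      by (simp add: x_def y_def translate_mult translate_translate add.commute)
    have "x r (Suc r) * y (Suc r) r - x (Suc r) (Suc r) * y r r
        = - (x r r * y (Suc r) (Suc r) - x (Suc r) r * y r (Suc r))"
      unfolding xy translate_diff[symmetric] translate_uminus[symmetric]
      using T[unfolded exchange_relation_def, rule_format,
          of "a (\<sigma> r)" "b (Suc r)" "a (\<sigma> (Suc r))" "b r"]
      by (simp only: minus_diff_eq)
    then have "before * (x r (Suc r) * y (Suc r) r - x (Suc r) (Suc r) * y r r) * after
        = before * (- (x r r * y (Suc r) (Suc r) - x (Suc r) r * y r (Suc r))) * after"
      by simp
    then show ?thesis unfolding P by (simp add: algebra_simps)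
  qed
  have "D (b \<circ> ?s) + D (b \<circ> ?s) = - (D b + D b)"
    unfolding twice flip by (simp only: mult_minus_right sum_negf)
  then have "D (b \<circ> ?s) + D b = - (D (b \<circ> ?s) + D b)"
    by (simp add: algebra_simps)
  then have "D (b \<circ> ?s) + D b = 0" by (rule fps_eq_neg_self_iff_zero)
  then show ?thesis unfolding D_def by (simp add: eq_neg_iff_add_eq_0)
qed

text \<open>Transpositions of neighbours generate all permutations.\<close>

lemma minor_fun_permute_columns:
  assumes T: "exchange_relation T" and \<tau>: "\<tau> permutes {..<m}"
  shows "minor_fun m T a (b \<circ> \<tau>) = of_int (sign \<tau>) * minor_fun m T a b"
proof -
  have less: "minor_fun m T a (b \<circ> transpose j k) = - minor_fun m T a b" if "j < k" "k < m" for j k b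
    using that
  proof (induction k arbitrary: b)
    case (Suc k)
    let ?s = "transpose k (Suc k)"
    show ?case
    proof (cases "j = k")
      case True
      with Suc.prems show ?thesis using minor_fun_swap_adjacent_columns[OF T] by blast
    next
      case False
      \<comment> \<open>conjugating by the neighbours \<open>k\<close>, \<open>k + 1\<close> shortens the distance\<close>
      have "transpose j (Suc k) = ?s \<circ> transpose j k \<circ> ?s"
        using False Suc.prems by (auto simp: fun_eq_iff transpose_def)
      then have "b \<circ> transpose j (Suc k) = ((b \<circ> ?s) \<circ> transpose j k) \<circ> ?s"
        by (simp add: o_assoc)
      then show ?thesis
        using False Suc by (simp add: minor_fun_swap_adjacent_columns[OF T] del: o_apply comp_apply)
      
    qed
  qed simp
  have transposition: "minor_fun m T a (b \<circ> transpose j k) = - minor_fun m T a b"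
    if "j \<noteq> k" "j < m" "k < m" for j k b
    using less[of j k b] less[of k j b] that by (cases "j < k") (auto simp: transpose_commute)
  show ?thesis
    using \<tau> finite_lessThan
  proof (induction arbitrary: b rule: permutes_induct)
    case (swap j k p)
    have "minor_fun m T a (b \<circ> (transpose j k \<circ> p)) = minor_fun m T a ((b \<circ> transpose j k) \<circ> p)"
      by (simp add: o_assoc)
    also have "\<dots> = - (of_int (sign p) * minor_fun m T a b)"
      unfolding swap.IH using swap.hyps by (simp add: transposition del: o_apply)
    finally have *: "minor_fun m T a (b \<circ> (transpose j k \<circ> p)) = - (of_int (sign p) * minor_fun m T a b)" .
    have flip: "sign (transpose j k \<circ> p) = - sign p"
      using swap.hyps by (subst sign_compose_permutes[of _ m]) (simp_all add: permutes_swap_id sign_swap_id)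
    show ?case unfolding * flip by simp
  qed simp
qed

lemma minor_fun_repeated_row:
  assumes "p < m" "q < m" "p \<noteq> q" "a p = a q"
  shows "minor_fun m T a b = 0"
proof (rule fps_eq_neg_self_iff_zero)
  have "a \<circ> transpose p q = a" using assms by (auto simp: fun_eq_iff transpose_def)
  then show "minor_fun m T a b = - minor_fun m T a b"
    using minor_fun_permute_rows[of "transpose p q" m T a b] assms
    by (simp add: permutes_swap_id sign_swap_id)
qed

lemma minor_fun_repeated_column:
  assumes "exchange_relation T" "p < m" "q < m" "p \<noteq> q" "b p = b q"
  shows "minor_fun m T a b = 0"
proof (rule fps_eq_neg_self_iff_zero)
  have "b \<circ> transpose p q = b" using assms by (auto simp: fun_eq_iff transpose_def)
  then show "minor_fun m T a b = - minor_fun m T a b"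
    using minor_fun_permute_columns[of T "transpose p q" m a b] assms
    by (simp add: permutes_swap_id sign_swap_id)
qed

section \<open>Inner derivations of quantum minors\<close>

lemma comm_0 [simp]: "comm x 0 = 0" "comm 0 x = 0"
  by (simp_all add: comm_def)

lemma comm_add: "comm x (y + z) = comm x y + comm x z"
  by (simp add: comm_def algebra_simps)

lemma comm_diff: "comm x (y - z) = comm x y - comm x z"
  by (simp add: comm_def algebra_simps)

lemma comm_mult: "comm x (y * z) = comm x y * z + y * comm x z"
  by (simp add: comm_def algebra_simps)

lemma comm_diff_left: "comm (x - y) z = comm x z - comm y z" for x :: "'a :: ring"
  by (simp add: comm_def algebra_simps)

lemma comm_uminus_left: "comm (- x) z = - comm x z" for x :: "'a :: ring"
  by (simp add: comm_def)

lemma comm_mult_left: "comm (x * y) z = x * comm y z + comm x z * y" for x :: "'a :: ring"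
  by (simp add: comm_def algebra_simps)

lemma comm_scaleC_left: "comm (c *\<^sub>C x) y = c *\<^sub>C comm x (y :: 'a :: complex_algebra_1)"
  by (simp add: comm_def mult_scaleC_left mult_scaleC_right scaleC_diff)

lemma comm_const_nth: "fps_nth (comm (fps_const s) F) k = comm s (fps_nth F k)"
  by (simp add: comm_def)

lemma comm_1 [simp]: "comm x 1 = 0" for x :: "'a :: ring_1"
  by (simp add: comm_def)

lemma comm_of_int [simp]: "comm x (of_int z) = 0" for x :: "'a :: ring_1"
  by (simp add: comm_def mult_of_int_commute)

lemma comm_sum: "comm x (sum f A) = (\<Sum>y\<in>A. comm x (f y))"
  by (induction A rule: infinite_finite_induct) (simp_all add: comm_add)

lemma translate_comm_const: "translate c (comm (fps_const x) F) = comm (fps_const x) (translate c F)"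
  by (simp add: comm_def translate_diff translate_mult)

text \<open>The Leibniz rule.\<close>

lemma comm_prod_list:
  fixes x :: "'a :: ring_1"
  shows "comm x (prod_list (map f [0..<m])) = (\<Sum>p<m. prod_list (map (f(p := comm x (f p))) [0..<m]))"
proof (induction m)
  case (Suc m)
  have earlier: "prod_list (map (f(p := comm x (f p))) [0..<Suc m])
      = prod_list (map (f(p := comm x (f p))) [0..<m]) * f m" if "p < m" for p
    using that by simp
  have last: "prod_list (map (f(m := comm x (f m))) [0..<Suc m])
      = prod_list (map f [0..<m]) * comm x (f m)"
  proof -
    have "map (f(m := comm x (f m))) [0..<m] = map f [0..<m]" by simp
    then show ?thesis by (simp del: map_eq_conv fun_upd_apply add: fun_upd_same)
  qed
  have "(\<Sum>p<Suc m. prod_list (map (f(p := comm x (f p))) [0..<Suc m]))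
      = (\<Sum>p<m. prod_list (map (f(p := comm x (f p))) [0..<m])) * f m
        + prod_list (map f [0..<m]) * comm x (f m)"
    unfolding sum.lessThan_Suc last sum_distrib_right
    by (intro arg_cong2[of _ _ _ _ plus] sum.cong refl) (simp only: earlier lessThan_iff)
  moreover have "comm x (prod_list (map f [0..<Suc m]))
      = comm x (prod_list (map f [0..<m])) * f m + prod_list (map f [0..<m]) * comm x (f m)"
    by (simp add: comm_mult)
  ultimately show ?case by (simp only: Suc.IH)
qed simp

lemma prod_list_update_diff:
  assumes "p < m"
  shows "prod_list (map (f(p := u - v)) [0..<m])
       = prod_list (map (f(p := u)) [0..<m]) - prod_list (map (f(p := v :: 'a :: ring_1)) [0..<m])"
  unfolding upt_split[OF assms] by (simp add: algebra_simps)

lemma prod_list_update_0: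
  assumes "p < m"
  shows "prod_list (map (f(p := 0 :: 'a :: ring_1)) [0..<m]) = 0"
  unfolding upt_split[OF assms] by simp

text \<open>The assumption is the commutator with the generator \<open>T\<^sub>s\<^sub>t\<close> of level
  one: it acts as the elementary matrix \<open>E\<^sub>s\<^sub>t\<close> on the column index and
  dually on the row index. By the Leibniz rule it acts on minors by replacing one column or one
  row at a time.\<close>

lemma minor_fun_comm:
  assumes x: "\<And>k l. comm (fps_const x) (T k l) = (if l = s then T k t else 0) - (if k = t then T s l else 0)"
  shows "comm (fps_const x) (minor_fun m T a b)
       = (\<Sum>p<m. if b p = s then minor_fun m T a (b(p := t)) else 0)
       - (\<Sum>p<m. if a p = t then minor_fun m T (a(p := s)) b else 0)"
proof -
  let ?x = "fps_const x"
  have step: "comm ?x (minor_term m T (a \<circ> \<sigma>) b)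
      = (\<Sum>p<m. if b p = s then minor_term m T (a \<circ> \<sigma>) (b(p := t)) else 0)
      - (\<Sum>p<m. if a p = t then minor_term m T (a(p := s) \<circ> \<sigma>) b else 0)"
    if \<sigma>: "\<sigma> permutes {..<m}" for \<sigma>
  proof -
    define f where "f r = translate (of_nat r) (T (a (\<sigma> r)) (b r))" for r
    have fp: "comm ?x (f p) = (if b p = s then translate (of_nat p) (T (a (\<sigma> p)) t) else 0)
        - (if a (\<sigma> p) = t then translate (of_nat p) (T s (b p)) else 0)" for p
      by (simp add: f_def x translate_diff flip: translate_comm_const)
    have "comm ?x (minor_term m T (a \<circ> \<sigma>) b)
        = (\<Sum>p<m. prod_list (map (f(p := comm ?x (f p))) [0..<m]))"
      unfolding comm_prod_list[symmetric] by (simp add: minor_term_def f_def[abs_def])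
    also have "\<dots> = (\<Sum>p<m. (if b p = s then minor_term m T (a \<circ> \<sigma>) (b(p := t)) else 0)
        - (if a (\<sigma> p) = t then minor_term m T (a(\<sigma> p := s) \<circ> \<sigma>) b else 0))"
    proof (intro sum.cong refl)
      fix p assume "p \<in> {..<m}"
      then have p: "p < m" by simp
      have "prod_list (map (f(p := translate (of_nat p) (T (a (\<sigma> p)) t))) [0..<m])
          = minor_term m T (a \<circ> \<sigma>) (b(p := t))"
        unfolding minor_term_def f_def by (intro arg_cong[of _ _ prod_list] map_cong) auto
      moreover have "prod_list (map (f(p := translate (of_nat p) (T s (b p)))) [0..<m])
          = minor_term m T (a(\<sigma> p := s) \<circ> \<sigma>) b"
        unfolding minor_term_def f_def using permutes_inj[OF \<sigma>]
        by (intro arg_cong[of _ _ prod_list] map_cong) (auto simp: inj_eq)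
      ultimately show "prod_list (map (f(p := comm ?x (f p))) [0..<m])
          = (if b p = s then minor_term m T (a \<circ> \<sigma>) (b(p := t)) else 0)
          - (if a (\<sigma> p) = t then minor_term m T (a(\<sigma> p := s) \<circ> \<sigma>) b else 0)"
        by (simp add: fp prod_list_update_diff[OF p] prod_list_update_0[OF p])
    qed
    also have "(\<Sum>p<m. (if b p = s then minor_term m T (a \<circ> \<sigma>) (b(p := t)) else 0)
        - (if a (\<sigma> p) = t then minor_term m T (a(\<sigma> p := s) \<circ> \<sigma>) b else 0))
      = (\<Sum>p<m. if b p = s then minor_term m T (a \<circ> \<sigma>) (b(p := t)) else 0)
        - (\<Sum>p<m. if a p = t then minor_term m T (a(p := s) \<circ> \<sigma>) b else 0)"
      unfolding sum_subtractf
      using sum.permute[OF \<sigma>, of "\<lambda>p. if a p = t then minor_term m T (a(p := s) \<circ> \<sigma>) b else 0"]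
      by (simp add: o_def)
    finally show ?thesis .
  qed
  have swap: "(\<Sum>p<m. if C p then minor_fun m T (A p) (B p) else 0)
      = (\<Sum>\<sigma> | \<sigma> permutes {..<m}. of_int (sign \<sigma>) *
          (\<Sum>p<m. if C p then minor_term m T (A p \<circ> \<sigma>) (B p) else 0))" for C A B
    unfolding sum_distrib_left by (subst sum.swap, intro sum.cong refl) (simp add: minor_fun_def)
  have "comm ?x (minor_fun m T a b)
      = (\<Sum>\<sigma> | \<sigma> permutes {..<m}. of_int (sign \<sigma>) * comm ?x (minor_term m T (a \<circ> \<sigma>) b))"
    by (simp add: minor_fun_def comm_sum comm_mult)
  also have "\<dots> = (\<Sum>\<sigma> | \<sigma> permutes {..<m}. of_int (sign \<sigma>) *
      ((\<Sum>p<m. if b p = s then minor_term m T (a \<circ> \<sigma>) (b(p := t)) else 0)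
      - (\<Sum>p<m. if a p = t then minor_term m T (a(p := s) \<circ> \<sigma>) b else 0)))"
    by (intro sum.cong refl) (simp add: step)
  finally show ?thesis
    by (simp add: swap right_diff_distrib sum_subtractf)
qed

definition replace_columns where
  "replace_columns T as bs s t = (\<Sum>p<length bs. if bs ! p = s then quantum_minor T as (bs[p := t]) else 0)"

definition replace_rows where
  "replace_rows T as bs s t = (\<Sum>p<length as. if as ! p = t then quantum_minor T (as[p := s]) bs else 0)"

lemma quantum_minor_comm:
  assumes "\<And>k l. comm (fps_const x) (T k l) = (if l = s then T k t else 0) - (if k = t then T s l else 0)"
    and len: "length as = length bs"
  shows "comm (fps_const x) (quantum_minor T as bs) = replace_columns T as bs s t - replace_rows T as bs s t"
proof -
  have "minor_fun (length as) T ((!) as) (((!) bs)(p := t)) = quantum_minor T as (bs[p := t])"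
    "minor_fun (length as) T (((!) as)(p := s)) ((!) bs) = quantum_minor T (as[p := s]) bs"
    if "p < length bs" for p
    unfolding quantum_minor_conv_fun length_list_update using that len
    by (auto intro!: minor_fun_cong simp: nth_list_update)
  then show ?thesis
    unfolding replace_columns_def replace_rows_def quantum_minor_conv_fun[of T as bs]
      minor_fun_comm[OF assms(1)] using len
    by (intro arg_cong2[of _ _ _ _ minus] sum.cong if_cong refl) auto
qed

lemma sum_single_position:
  fixes p m :: nat
  assumes "p < m" "P p" "\<And>q. q < m \<Longrightarrow> q \<noteq> p \<Longrightarrow> \<not> P q"
  shows "(\<Sum>q<m. if P q then f q else 0) = (f p :: 'a :: comm_monoid_add)"
proof -
  have "(\<Sum>q<m. if P q then f q else 0) = (\<Sum>q<m. if q = p then f q else 0)"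
    using assms by (intro sum.cong) auto
  then show ?thesis using assms(1) by (simp add: sum.delta)
qed

lemma replace_columns_single:
  "p < length bs \<Longrightarrow> bs ! p = s \<Longrightarrow> (\<And>q. q < length bs \<Longrightarrow> q \<noteq> p \<Longrightarrow> bs ! q \<noteq> s) \<Longrightarrow>
     replace_columns T as bs s t = quantum_minor T as (bs[p := t])"
  unfolding replace_columns_def by (rule sum_single_position)

lemma replace_rows_single:
  "p < length as \<Longrightarrow> as ! p = t \<Longrightarrow> (\<And>q. q < length as \<Longrightarrow> q \<noteq> p \<Longrightarrow> as ! q \<noteq> t) \<Longrightarrow>
     replace_rows T as bs s t = quantum_minor T (as[p := s]) bs"
  unfolding replace_rows_def by (rule sum_single_position)

text \<open>If the new column already occurs in the minor, the result has a repeated column.\<close>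

lemma replace_columns_eq_0:
  assumes "exchange_relation T" "length as = length bs" "s \<noteq> t" "s \<in> set bs \<Longrightarrow> t \<in> set bs"
  shows "replace_columns T as bs s t = 0"
  unfolding replace_columns_def
proof (intro sum.neutral ballI)
  fix p assume "p \<in> {..<length bs}"
  then have p: "p < length bs" by simp
  show "(if bs ! p = s then quantum_minor T as (bs[p := t]) else 0) = 0"
  proof (cases "bs ! p = s")
    case True
    with p assms(4) obtain q where q: "q < length bs" "bs ! q = t"
      by (metis in_set_conv_nth)
    then have "q \<noteq> p" using True assms(3) by auto
    then show ?thesis
      unfolding quantum_minor_conv_fun using p q assms
      by (simp add: minor_fun_repeated_column[of T p "length bs" q])
  qed simp
qed

lemma replace_rows_eq_0:
  assumes "s \<noteq> t" "t \<in> set as \<Longrightarrow> s \<in> set as"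
  shows "replace_rows T as bs s t = 0"
  unfolding replace_rows_def
proof (intro sum.neutral ballI)
  fix p assume "p \<in> {..<length as}"
  then have p: "p < length as" by simp
  show "(if as ! p = t then quantum_minor T (as[p := s]) bs else 0) = 0"
  proof (cases "as ! p = t")
    case True
    with p assms(2) obtain q where q: "q < length as" "as ! q = s"
      by (metis in_set_conv_nth)
    then have "q \<noteq> p" using True assms(1) by auto
    then show ?thesis
      unfolding quantum_minor_conv_fun using p q assms
      by (simp add: minor_fun_repeated_row[of p "length as" q])
  qed simp
qed

section \<open>The Cauchy--Binet formula\<close>

text \<open>Distributivity for noncommuting factors.\<close>

lemma prod_list_sum:
  fixes g :: "nat \<Rightarrow> 'k \<Rightarrow> 'a :: ring_1"
  assumes "finite R"
  shows "prod_list (map (\<lambda>r. \<Sum>k\<in>R. g r k) [0..<m])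
       = (\<Sum>cs | set cs \<subseteq> R \<and> length cs = m. prod_list (map (\<lambda>r. g r (cs ! r)) [0..<m]))"
proof (induction m)
  case 0
  have "{cs. set cs \<subseteq> R \<and> cs = []} = {[]}" by auto
  then show ?case by simp
next
  case (Suc m)
  have "prod_list (map (\<lambda>r. \<Sum>k\<in>R. g r k) [0..<Suc m])
      = (\<Sum>(cs, k)\<in>{cs. set cs \<subseteq> R \<and> length cs = m} \<times> R.
          prod_list (map (\<lambda>r. g r (cs ! r)) [0..<m]) * g m k)"
    by (simp add: Suc sum_product sum.cartesian_product)
  also have "\<dots> = (\<Sum>cs | set cs \<subseteq> R \<and> length cs = Suc m. prod_list (map (\<lambda>r. g r (cs ! r)) [0..<Suc m]))"
  proof (rule sum.reindex_bij_witness[where i = "\<lambda>cs. (butlast cs, last cs)" and j = "\<lambda>(cs, k). cs @ [k]"],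
      goal_cases)
    case (3 x)
    then show ?case by (cases x rule: rev_cases) auto
  next
    case (4 x)
    then show ?case by (cases x rule: rev_cases) auto
  next
    case (5 x)
    obtain cs k where x: "x = (cs, k)" by (cases x)
    have "map (\<lambda>r. g r ((cs @ [k]) ! r)) [0..<m] = map (\<lambda>r. g r (cs ! r)) [0..<m]"
      using 5 x by (auto simp: nth_append)
    with 5 show ?case unfolding x by (simp del: map_eq_conv) (simp add: nth_append)
  qed auto
  finally show ?case .
qed

definition increasing_lists :: "nat set \<Rightarrow> nat \<Rightarrow> nat list set" where
  "increasing_lists R m = {cs. length cs = m \<and> sorted_wrt (<) cs \<and> set cs \<subseteq> R}"

text \<open>A list without repetitions is uniquely a permutation of an increasing list.\<close>

lemma sum_distinct_lists:
  assumes R: "finite R"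
    and F: "\<And>cs. set cs \<subseteq> R \<Longrightarrow> length cs = m \<Longrightarrow> \<not> distinct cs \<Longrightarrow> F cs = 0"
  shows "(\<Sum>cs | set cs \<subseteq> R \<and> length cs = m. F cs)
       = (\<Sum>cs\<in>increasing_lists R m. \<Sum>\<tau> | \<tau> permutes {..<m}. F (permute_list \<tau> cs) :: 'a :: comm_monoid_add)"
proof -
  have "(\<Sum>cs | set cs \<subseteq> R \<and> length cs = m. F cs)
      = (\<Sum>cs | set cs \<subseteq> R \<and> length cs = m \<and> distinct cs. F cs)"
    using finite_lists_length_eq[OF R, of m] F by (intro sum.mono_neutral_right) auto
  also have "\<dots> = (\<Sum>(cs, \<tau>)\<in>increasing_lists R m \<times> {\<tau>. \<tau> permutes {..<m}}. F (permute_list \<tau> cs))"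
  proof (unfold case_prod_unfold, rule sum.reindex_bij_betw[symmetric])
    show "bij_betw (\<lambda>p. permute_list (snd p) (fst p)) (increasing_lists R m \<times> {\<tau>. \<tau> permutes {..<m}})
      {cs. set cs \<subseteq> R \<and> length cs = m \<and> distinct cs}"
      unfolding bij_betw_def
    proof (intro conjI inj_onI subset_antisym subsetI)
      fix x y
      assume x: "x \<in> increasing_lists R m \<times> {\<tau>. \<tau> permutes {..<m}}"
        and y: "y \<in> increasing_lists R m \<times> {\<tau>. \<tau> permutes {..<m}}"
        and eq: "permute_list (snd x) (fst x) = permute_list (snd y) (fst y)"
      obtain cs \<tau> ds \<rho> where xy: "x = (cs, \<tau>)" "y = (ds, \<rho>)" by (cases x; cases y)
      have cs: "length cs = m" "sorted_wrt (<) cs" "\<tau> permutes {..<length cs}"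
        and ds: "length ds = m" "sorted_wrt (<) ds" "\<rho> permutes {..<length ds}"
        using x y xy by (auto simp: increasing_lists_def)
      have "set cs = set ds"
        using eq xy cs(3) ds(3) by (metis fst_conv snd_conv set_permute_list)
      with cs ds have "cs = ds" by (simp add: strict_sorted_equal)
      moreover have "\<tau> = \<rho>"
      proof
        fix r
        show "\<tau> r = \<rho> r"
        proof (cases "r < m")
          case True
          then have "cs ! \<tau> r = cs ! \<rho> r"
            using eq xy cs ds \<open>cs = ds\<close> by (metis fst_conv snd_conv permute_list_nth)
          moreover have "distinct cs" using cs(2) by (simp add: strict_sorted_iff)
          ultimately show ?thesis
            using True cs(1,3) ds(3) \<open>cs = ds\<close> by (simp add: nth_eq_iff_index_eq permutes_lessThan_less)
        next
          case False
          with cs ds show ?thesis by (simp add: permutes_not_in)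
        qed
      qed
      ultimately show "x = y" by (simp add: xy)
    next
      fix cs assume "cs \<in> (\<lambda>p. permute_list (snd p) (fst p)) ` (increasing_lists R m \<times> {\<tau>. \<tau> permutes {..<m}})"
      then show "cs \<in> {cs. set cs \<subseteq> R \<and> length cs = m \<and> distinct cs}"
        by (auto simp: increasing_lists_def strict_sorted_iff)
    next
      fix cs assume "cs \<in> {cs. set cs \<subseteq> R \<and> length cs = m \<and> distinct cs}"
      then have cs: "set cs \<subseteq> R" "length cs = m" "distinct cs" by auto
      obtain \<tau> where "\<tau> permutes {..<length (sort cs)}" "permute_list \<tau> (sort cs) = cs"
        by (metis mset_eq_permutation mset_sort)
      with cs show "cs \<in> (\<lambda>p. permute_list (snd p) (fst p)) ` (increasing_lists R m \<times> {\<tau>. \<tau> permutes {..<m}})"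
        by (intro image_eqI[of _ _ "(sort cs, \<tau>)"]) (auto simp: increasing_lists_def strict_sorted_iff)
    qed
  qed
  finally show ?thesis by (simp add: sum.cartesian_product)
qed

text \<open>Expanding the product of the sums \<open>\<Delta>(T k l)\<close> leaves a sum over all lists
  \<open>cs\<close> of intermediate indices, whose left tensor factor is the minor with columns
  \<open>cs\<close>. Its antisymmetry discards the lists with repetitions and, after collecting
  the lists with the same entries, antisymmetrises the right tensor factor into a minor.\<close>

lemma fps_map_quantum_minor_comultiplication:
  assumes T: "exchange_relation T" and R: "finite R" and \<Delta>: "algebra_hom \<Delta>"
    and \<Delta>T: "\<And>k l. fps_map \<Delta> (T k l) = (\<Sum>r\<in>R. T k r \<otimes> T r l)"
    and len: "length as = m" "length bs = m"
  shows "fps_map \<Delta> (quantum_minor T as bs)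
       = (\<Sum>cs\<in>increasing_lists R m. quantum_minor T as cs \<otimes> quantum_minor T cs bs)"
proof -
  define L where "L = {cs. set cs \<subseteq> R \<and> length cs = m}"
  define P where "P cs = minor_term m T (nth cs) (nth bs)" for cs
  have factor: "fps_map \<Delta> (minor_term m T (nth as \<circ> \<sigma>) (nth bs))
      = (\<Sum>cs\<in>L. minor_term m T (nth as \<circ> \<sigma>) (nth cs) \<otimes> P cs)" for \<sigma>
  proof -
    have "fps_map \<Delta> (minor_term m T (nth as \<circ> \<sigma>) (nth bs))
        = prod_list (map (\<lambda>r. \<Sum>k\<in>R. translate (of_nat r) (T (as ! \<sigma> r) k) \<otimes>
            translate (of_nat r) (T k (bs ! r))) [0..<m])"
      by (simp add: minor_term_def fps_map_prod_list[OF \<Delta>] o_def \<Delta>T translate_sum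
          translate_tensor_fps flip: translate_fps_map[OF \<Delta>])
    then show ?thesis
      by (simp add: prod_list_sum[OF R] L_def P_def minor_term_def prod_list_tensor_fps)
  qed
  have "fps_map \<Delta> (quantum_minor T as bs)
      = (\<Sum>\<sigma> | \<sigma> permutes {..<m}. \<Sum>cs\<in>L. (of_int (sign \<sigma>) * minor_term m T (nth as \<circ> \<sigma>) (nth cs)) \<otimes> P cs)"
    unfolding quantum_minor_conv_fun minor_fun_def fps_map_sum[OF \<Delta>] fps_map_mult[OF \<Delta>]
      fps_map_of_int[OF \<Delta>] len factor sum_distrib_left tensor_fps_of_int_left ..
  also have "\<dots> = (\<Sum>cs\<in>L. quantum_minor T as cs \<otimes> P cs)"
    by (subst sum.swap) (simp add: tensor_fps_sum_left quantum_minor_conv_fun minor_fun_def len)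
  also have "\<dots> = (\<Sum>cs\<in>increasing_lists R m. \<Sum>\<tau> | \<tau> permutes {..<m}.
      quantum_minor T as (permute_list \<tau> cs) \<otimes> P (permute_list \<tau> cs))"
    unfolding L_def
  proof (rule sum_distinct_lists[OF R])
    fix cs :: "nat list" assume "length cs = m" "\<not> distinct cs"
    then obtain p q where "p < m" "q < m" "p \<noteq> q" "cs ! p = cs ! q"
      by (auto simp: distinct_conv_nth)
    then have "quantum_minor T as cs = 0"
      by (simp add: quantum_minor_conv_fun len minor_fun_repeated_column[OF T])
    then show "quantum_minor T as cs \<otimes> P cs = 0"
      using tensor_fps_sum_left[of "\<lambda>_. 0" "{}" "P cs"] by simp
  qed
  also have "\<dots> = (\<Sum>cs\<in>increasing_lists R m. quantum_minor T as cs \<otimes> quantum_minor T cs bs)"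
  proof (intro sum.cong refl)
    fix cs assume "cs \<in> increasing_lists R m"
    then have cs: "length cs = m" by (simp add: increasing_lists_def)
    have "quantum_minor T as (permute_list \<tau> cs) \<otimes> P (permute_list \<tau> cs)
        = quantum_minor T as cs \<otimes> (of_int (sign \<tau>) * minor_term m T (nth cs \<circ> \<tau>) (nth bs))"
      if \<tau>: "\<tau> permutes {..<m}" for \<tau>
    proof -
      have nth: "permute_list \<tau> cs ! r = cs ! \<tau> r" if "r < m" for r
        using \<tau> cs that by (simp add: permute_list_nth)
      have "minor_fun m T (nth as) (nth (permute_list \<tau> cs)) = minor_fun m T (nth as) (nth cs \<circ> \<tau>)"
        by (rule minor_fun_cong) (simp add: nth)
      moreover have "P (permute_list \<tau> cs) = minor_term m T (nth cs \<circ> \<tau>) (nth bs)"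
        unfolding P_def by (rule minor_term_cong) (simp add: nth)
      ultimately show ?thesis
        by (simp add: quantum_minor_conv_fun len minor_fun_permute_columns[OF T \<tau>]
            tensor_fps_of_int_left tensor_fps_of_int_right)
    qed
    then show "(\<Sum>\<tau> | \<tau> permutes {..<m}. quantum_minor T as (permute_list \<tau> cs) \<otimes> P (permute_list \<tau> cs))
        = quantum_minor T as cs \<otimes> quantum_minor T cs bs"
      by (simp add: quantum_minor_conv_fun cs minor_fun_def tensor_fps_sum_right)
  qed
  finally show ?thesis .
qed

section \<open>The RTT relation at neighbouring points\<close>

lemma mult_translate_nth:
  "fps_nth (F * translate c G) m
     = (\<Sum>r\<le>m. \<Sum>s\<le>m - r. translation_coeff c s (m - r - s) *\<^sub>C (fps_nth F r * fps_nth G s))"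
  by (simp add: fps_mult_nth translate_nth sum_distrib_left mult_scaleC_right atMost_atLeast0
      del: diff_diff_left)

lemma translate_mult_nth:
  "fps_nth (translate c G * F) m
     = (\<Sum>r\<le>m. \<Sum>s\<le>m - r. translation_coeff c s (m - r - s) *\<^sub>C (fps_nth G s * fps_nth F r))"
proof -
  have "fps_nth (translate c G * F) m = (\<Sum>r\<le>m. fps_nth (translate c G) (m - r) * fps_nth F r)"
    unfolding fps_mult_nth atMost_atLeast0[symmetric]
    by (rule sum.reindex_bij_witness[where i = "\<lambda>k. m - k" and j = "\<lambda>k. m - k"]) auto
  then show ?thesis
    by (simp add: translate_nth sum_distrib_right mult_scaleC_left del: diff_diff_left)
qed

text \<open>Since \<open>u + 1 = (1 + x) / x\<close> for \<open>x = 1/u\<close>, translation by one maps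
  \<open>x\<close> to \<open>x / (1 + x)\<close>.\<close>

lemma translate_1_X: "(1 + fps_X) * translate 1 fps_X = (fps_X :: 'a :: complex_algebra_1 fps)"
proof (rule fps_ext)
  fix m
  have tX: "fps_nth (translate 1 (fps_X :: 'a fps)) m = (if m = 0 then 0 else (- 1) ^ (m - 1))" for m
  proof -
    have "(- 1 gchoose r) = ((- 1) ^ r :: complex)" for r
      using gbinomial_minus[of 1 r] by (simp flip: binomial_gbinomial)
    then have "(\<Sum>k\<le>m. translation_coeff 1 k (m - k) *\<^sub>C (if k = 1 then 1 else 0 :: 'a))
        = (\<Sum>k\<le>m. if k = 1 then (- 1) ^ (m - 1) else 0)"
      by (intro sum.cong)
         (auto simp: translation_coeff_def minus_one_power_iff scaleC_one scaleC_neg_one)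
    then show ?thesis by (simp add: translate_nth fps_X_nth)
  qed
  show "fps_nth ((1 + fps_X) * translate 1 fps_X) m = fps_nth (fps_X :: 'a fps) m"
    by (cases m) (auto simp: distrib_right tX fps_X_nth power_eq_if)
qed

lemma fps_X_mult_cancel:
  assumes "fps_X * F = fps_X * (G :: 'a :: ring_1 fps)"
  shows "F = G"
proof (rule fps_ext)
  fix k
  have "fps_nth (fps_X * F) (Suc k) = fps_nth (fps_X * G) (Suc k)" by (simp only: assms)
  then show "fps_nth F k = fps_nth G k" by simp
qed

lemma fps_X_mult_shift: "fps_X * fps_shift 1 F = F - fps_const (fps_nth F 0)" for F :: "'a :: ring_1 fps"
  by (rule fps_ext) (auto simp: fps_eq_iff)

lemma comm_fps_X_left: "comm (fps_X * F) G = fps_X * comm F (G :: 'a :: ring_1 fps)"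
  by (simp add: comm_def right_diff_distrib mult.assoc) (metis fps_mult_fps_X_commute mult.assoc)

lemma comm_fps_X_right: "comm F (fps_X * G) = fps_X * comm F (G :: 'a :: ring_1 fps)"
  by (simp add: comm_def right_diff_distrib mult.assoc) (metis fps_mult_fps_X_commute mult.assoc)

text \<open>The RTT relation in the variables \<open>u\<close> and \<open>v\<close> is given by its
  coefficients. Setting \<open>v = u + 1\<close> amounts to summing them against the expansions of
  the powers of \<open>u\<close> and \<open>u + 1\<close>, and turns the factor \<open>-(u -
  v)\<close> into \<open>1\<close>.\<close>

lemma comm_translate_of_coefficients:
  fixes A B C D :: "'a :: complex_algebra_1 fps"
  assumes rel: "\<And>r s. - (comm (fps_nth A (Suc r)) (fps_nth B s) - comm (fps_nth A r) (fps_nth B (Suc s)))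
                = fps_nth C r * fps_nth D s - fps_nth C s * fps_nth D r"
    and A: "\<And>F. comm (fps_const (fps_nth A 0)) F = 0" and B: "\<And>F. comm F (fps_const (fps_nth B 0)) = 0"
  shows "comm A (translate 1 B) = C * translate 1 D - translate 1 C * D"
proof (rule fps_X_mult_cancel)
  let ?t = "translate (1 :: complex) :: 'a fps \<Rightarrow> 'a fps"
  have "- (comm (fps_shift 1 A) (?t B) - comm A (?t (fps_shift 1 B))) = C * ?t D - ?t C * D"
  proof (rule fps_ext)
    fix m
    let ?c = "\<lambda>r s. translation_coeff 1 s (m - r - s)"
    have "fps_nth (- (comm (fps_shift 1 A) (?t B) - comm A (?t (fps_shift 1 B)))) m
        = (\<Sum>r\<le>m. \<Sum>s\<le>m - r. ?c r s *\<^sub>C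
            (- (comm (fps_nth A (Suc r)) (fps_nth B s) - comm (fps_nth A r) (fps_nth B (Suc s)))))"
      unfolding comm_def fps_neg_nth fps_sub_nth mult_translate_nth translate_mult_nth
      by (simp add: scaleC_diff scaleC_uminus scaleC_add_right sum.distrib sum_subtractf sum_negf algebra_simps)
    also have "\<dots> = fps_nth (C * ?t D - ?t C * D) m"
      unfolding rel fps_sub_nth mult_translate_nth translate_mult_nth
      by (simp add: scaleC_diff sum_subtractf)
    finally show "fps_nth (- (comm (fps_shift 1 A) (?t B) - comm A (?t (fps_shift 1 B)))) m
        = fps_nth (C * ?t D - ?t C * D) m" .
  qed
  then have "fps_X * (C * ?t D - ?t C * D)
      = - (fps_X * comm (fps_shift 1 A) (?t B) - fps_X * comm A (?t (fps_shift 1 B)))"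
    by (metis mult_minus_right right_diff_distrib)
  \<comment> \<open>shifting the coefficients of \<open>A\<close> is multiplication by \<open>u\<close>, shifting those of \<open>B\<close> by \<open>u + 1\<close>\<close>
  moreover have "fps_X * comm (fps_shift 1 A) (?t B) = comm A (?t B)"
    unfolding comm_fps_X_left[symmetric] fps_X_mult_shift
    using A[of "?t B"] by (simp add: comm_def algebra_simps)
  moreover have "fps_X * comm A (?t (fps_shift 1 B)) = comm A (?t B) + fps_X * comm A (?t B)"
  proof -
    let ?b = "fps_const (fps_nth B 0)"
    have "?t B = ?b + ?t (fps_X * fps_shift 1 B)"
      unfolding fps_X_mult_shift translate_diff by simp
    then have "(1 + fps_X) * (?t B - ?b) = fps_X * ?t (fps_shift 1 B)"
      by (simp add: translate_mult mult.assoc[symmetric] translate_1_X)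
    then have "fps_X * comm A (?t (fps_shift 1 B)) = comm A ((1 + fps_X) * (?t B - ?b))"
      by (simp add: comm_fps_X_right)
    also have "\<dots> = comm A (?t B) + fps_X * comm A (?t B)"
      by (simp add: distrib_right comm_add comm_diff comm_fps_X_right B)
    finally show ?thesis .
  qed
  ultimately show "fps_X * comm A (?t B) = fps_X * (C * ?t D - ?t C * D)"
    by simp
qed

section \<open>Relations of the Yangian\<close>

definition yangian_class :: "rtt_generator free_algebra \<Rightarrow> 'n yangian" where
  "yangian_class = abs_yangian"

lemma algebra_hom_yangian_class: "algebra_hom (yangian_class :: _ \<Rightarrow> 'n yangian)"
  by (rule algebra_homI)
     (simp_all add: yangian_class_def plus_yangian.abs_eq times_yangian.abs_eq
        scaleC_yangian.abs_eq one_yangian_def)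

lemma yangian_class_relator: "r \<in> rtt_relators CARD('n) \<Longrightarrow> yangian_class r = (0 :: 'n yangian)"
  unfolding yangian_class_def zero_yangian_def yangian.abs_eq_iff
  by (rule ideal_cong_relator) simp

lemma yangian_class_gen: "yangian_class (gen (TGen i j k)) = T_gen i j k"
  by (simp add: yangian_class_def T_gen_def)

lemma fps_map_yangian_class_T: "fps_map yangian_class (T_free i j) = T_ser i j"
  by (rule fps_ext)
     (simp add: T_ser_def T_series_def yangian_class_gen algebra_hom_0[OF algebra_hom_yangian_class]
        algebra_hom_1[OF algebra_hom_yangian_class])

lemma fps_map_quantum_minor:
  assumes f: "algebra_hom f"
  shows "fps_map f (quantum_minor T as bs) = quantum_minor (\<lambda>i j. fps_map f (T i j)) as bs"
  by (simp add: quantum_minor_def fps_map_sum[OF f] fps_map_mult[OF f] fps_map_of_int[OF f]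
      fps_map_prod_list[OF f] o_def translate_fps_map[OF f])

lemma quantum_determinant_1:
  "quantum_minor T_ser [1..<CARD('n)+1] [1..<CARD('n)+1] = (1 :: 'n yangian fps)"
proof -
  note hom = algebra_hom_yangian_class[where 'n = 'n]
  have "yangian_class (fps_nth (quantum_minor T_free [1..<CARD('n)+1] [1..<CARD('n)+1] - 1) k) = (0 :: 'n yangian)" for k
    by (intro yangian_class_relator rtt_relators.quantum_determinant)
  then have "fps_map yangian_class (quantum_minor T_free [1..<CARD('n)+1] [1..<CARD('n)+1] - 1) = (0 :: 'n yangian fps)"
    by (intro fps_ext) (simp del: upt_Suc)
  then show ?thesis
    using fps_map_add[OF hom, of "quantum_minor T_free [1..<CARD('n)+1] [1..<CARD('n)+1] - 1" 1]
    by (simp add: fps_map_quantum_minor[OF hom] fps_map_1[OF hom] fps_map_yangian_class_T del: upt_Suc)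
qed

text \<open>Unlike \<open>T_ser\<close>, whose diagonal entries outside the range are \<open>1\<close>, the
  truncation satisfies the RTT relation for all indices, so that lemmas on minors need no range
  conditions.\<close>

definition T_cut :: "nat \<Rightarrow> nat \<Rightarrow> 'n yangian fps" where
  "T_cut i j = (if i \<in> {1..CARD('n)} \<and> j \<in> {1..CARD('n)} then T_ser i j else 0)"

lemma T_ser_nth_0: "fps_nth (T_ser i j) 0 = (if i = j then 1 else 0)"
  by (simp add: T_ser_def T_series_def)

lemma T_cut_coefficient_relation:
  "- (comm (fps_nth (T_cut i j) (Suc r)) (fps_nth (T_cut k l) s)
      - comm (fps_nth (T_cut i j) r) (fps_nth (T_cut k l) (Suc s)))
   = fps_nth (T_cut k j) r * fps_nth (T_cut i l) s
      - fps_nth (T_cut k j) s * fps_nth (T_cut i l :: 'n yangian fps) r"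
proof (cases "i \<in> {1..CARD('n)} \<and> j \<in> {1..CARD('n)} \<and> k \<in> {1..CARD('n)} \<and> l \<in> {1..CARD('n)}")
  case True
  note hom = algebra_hom_yangian_class[where 'n = 'n]
  have T: "yangian_class (fps_nth (T_free i j) r) = fps_nth (T_ser i j :: 'n yangian fps) r" for i j r
    by (metis fps_map_nth fps_map_yangian_class_T)
  have "yangian_class (- (comm (fps_nth (T_free i j) (Suc r)) (fps_nth (T_free k l) s)
          - comm (fps_nth (T_free i j) r) (fps_nth (T_free k l) (Suc s)))
     - (fps_nth (T_free k j) r * fps_nth (T_free i l) s
          - fps_nth (T_free k j) s * fps_nth (T_free i l) r)) = (0 :: 'n yangian)"
    using True by (intro yangian_class_relator rtt_relators.rtt) auto
  then show ?thesis
    unfolding algebra_hom_diff[OF hom] algebra_hom_uminus[OF hom] algebra_hom_comm[OF hom]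
      algebra_hom_mult[OF hom] T
    using True by (simp add: T_cut_def)
next
  case False
  then show ?thesis by (auto simp: T_cut_def)
qed

lemma T_cut_nth_0_central:
  "comm (fps_const (fps_nth (T_cut i j) 0)) F = 0" "comm F (fps_const (fps_nth (T_cut i j) 0)) = 0"
  by (auto simp: T_cut_def T_ser_nth_0 comm_def)

text \<open>The RTT relation at \<open>v = u + 1\<close> expresses a minor of size two by products in the
  opposite order. Doing this for both orders of the columns and adding gives zero.\<close>

lemma exchange_relation_T_cut: "exchange_relation (T_cut :: nat \<Rightarrow> nat \<Rightarrow> 'n yangian fps)"
  unfolding exchange_relation_def
proof (intro allI)
  fix i j k l
  let ?T = "T_cut :: nat \<Rightarrow> nat \<Rightarrow> 'n yangian fps" and ?t = "translate 1 :: 'n yangian fps \<Rightarrow> _"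
  have "comm (?T i j) (?t (?T k l)) = ?T k j * ?t (?T i l) - ?t (?T k j) * ?T i l" for i j k l
    by (rule comm_translate_of_coefficients)
       (rule T_cut_coefficient_relation T_cut_nth_0_central)+
  from this[of i j k l] this[of i l k j]
  show "?T i j * ?t (?T k l) - ?T k j * ?t (?T i l) = ?T k l * ?t (?T i j) - ?T i l * ?t (?T k j)"
    unfolding comm_def by (simp only: diff_eq_eq) (simp add: algebra_simps)
qed

text \<open>This is the part of the RTT relation of highest order in \<open>u\<close>.\<close>

lemma T_cut_comm:
  assumes "s \<in> {1..CARD('n)}" "t \<in> {1..CARD('n)}"
  shows "comm (fps_const (T_gen s t 1)) (T_cut k l :: 'n yangian fps)
       = (if l = s then T_cut k t else 0) - (if k = t then T_cut s l else 0)"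
proof (rule fps_ext)
  fix m
  have "fps_nth (T_cut s t) (Suc 0) = (T_gen s t 1 :: 'n yangian)"
    using assms by (simp add: T_cut_def T_ser_def T_series_def)
  moreover have "comm (fps_nth (T_cut s t) 0) x = 0" for x :: "'n yangian"
    by (simp add: T_cut_def T_ser_nth_0 comm_def)
  ultimately have "- comm (T_gen s t 1) (fps_nth (T_cut k l) m)
      = fps_nth (T_cut k t) 0 * fps_nth (T_cut s l) m - fps_nth (T_cut k t) m * fps_nth (T_cut s l :: 'n yangian fps) 0"
    using T_cut_coefficient_relation[of s t 0 k l m, where 'n = 'n] by simp
  moreover have "fps_nth (T_cut k t :: 'n yangian fps) 0 = (if k = t then 1 else 0)"
    "fps_nth (T_cut s l :: 'n yangian fps) 0 = (if l = s then 1 else 0)"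
    using assms by (auto simp: T_cut_def T_ser_nth_0)
  ultimately have "- comm (T_gen s t 1) (fps_nth (T_cut k l) m)
      = (if k = t then fps_nth (T_cut s l :: 'n yangian fps) m else 0) - (if l = s then fps_nth (T_cut k t) m else 0)"
    by auto
  then have "comm (T_gen s t 1) (fps_nth (T_cut k l) m)
      = (if l = s then fps_nth (T_cut k t) m else 0) - (if k = t then fps_nth (T_cut s l :: 'n yangian fps) m else 0)"
    by (metis minus_diff_eq minus_minus)
  then show "fps_nth (comm (fps_const (T_gen s t 1)) (T_cut k l)) m
      = fps_nth ((if l = s then T_cut k t else 0) - (if k = t then T_cut s l else 0 :: 'n yangian fps)) m"
    by (auto simp: comm_def)
qed

lemma t_minor_conv_T_cut:
  assumes "set as \<subseteq> {1..CARD('n)}" "set bs \<subseteq> {1..CARD('n)}" "length as = length bs"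
  shows "t_minor as bs = (quantum_minor T_cut as bs :: 'n yangian fps)"
  unfolding t_minor_def using assms by (intro quantum_minor_cong) (auto simp: T_cut_def)

lemma comultiplication_T_cut:
  fixes \<Delta> :: "'n yangian \<Rightarrow> ('n yangian, 'n yangian) tensor"
  assumes "is_comultiplication \<Delta>"
  shows "fps_map \<Delta> (T_cut k l) = (\<Sum>r\<in>{1..CARD('n)}. T_cut k r \<otimes> T_cut r l)"
proof (cases "k \<in> {1..CARD('n)} \<and> l \<in> {1..CARD('n)}")
  case True
  then have "fps_map \<Delta> (T_cut k l) = (\<Sum>r\<in>{1..CARD('n)}. T_ser k r \<otimes> T_ser r l)"
    using assms by (simp add: is_comultiplication_def T_cut_def)
  also have "\<dots> = (\<Sum>r\<in>{1..CARD('n)}. T_cut k r \<otimes> T_cut r l)"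
    using True by (intro sum.cong) (auto simp: T_cut_def)
  finally show ?thesis .
next
  case False
  have "0 \<otimes> F = (0 :: ('n yangian, 'n yangian) tensor fps)" "F \<otimes> 0 = (0 :: ('n yangian, 'n yangian) tensor fps)" for F
    using tensor_fps_sum_left[of "\<lambda>_. 0" "{}" F] tensor_fps_sum_right[of F "\<lambda>_. 0" "{}"] by simp_all
  then show ?thesis
    using False assms fps_map_0[of \<Delta>] by (auto simp: T_cut_def is_comultiplication_def)
qed

definition drinfeld_class :: "drinfeld_generator free_algebra \<Rightarrow> 'n drinfeld_yangian" where
  "drinfeld_class = abs_drinfeld_yangian"

lemma algebra_hom_drinfeld_class: "algebra_hom (drinfeld_class :: _ \<Rightarrow> 'n drinfeld_yangian)"
  by (rule algebra_homI)
     (simp_all add: drinfeld_class_def plus_drinfeld_yangian.abs_eq times_drinfeld_yangian.abs_eq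
        scaleC_drinfeld_yangian.abs_eq one_drinfeld_yangian_def)

lemma drinfeld_class_relator: "r \<in> drinfeld_relators CARD('n) \<Longrightarrow> drinfeld_class r = (0 :: 'n drinfeld_yangian)"
  unfolding drinfeld_class_def zero_drinfeld_yangian_def drinfeld_yangian.abs_eq_iff
  by (rule ideal_cong_relator) simp

lemma drinfeld_class_gen:
  "drinfeld_class (e_free i k) = e_gen i k"
  "drinfeld_class (f_free i k) = f_gen i k"
  "drinfeld_class (h_free i k) = h_gen i k"
  by (simp_all add: drinfeld_class_def e_gen_def f_gen_def h_gen_def)

lemmas drinfeld_class_simps =
  algebra_hom_diff[OF algebra_hom_drinfeld_class] algebra_hom_add[OF algebra_hom_drinfeld_class]
  algebra_hom_uminus[OF algebra_hom_drinfeld_class]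
  algebra_hom_comm[OF algebra_hom_drinfeld_class] algebra_hom_mult[OF algebra_hom_drinfeld_class]
  algebra_hom_scaleC[OF algebra_hom_drinfeld_class] drinfeld_class_gen

lemma cartan_same [simp]: "cartan i i = 2"
  by (simp add: cartan_def)

lemma drinfeld_relations:
  assumes i: "i \<in> {1..<CARD('n)}"
  shows "j \<in> {1..<CARD('n)} \<Longrightarrow> comm (h_gen i k) (h_gen j l) = (0 :: 'n drinfeld_yangian)"
    and "comm (e_gen i k) (f_gen i l) = (h_gen i (k + l) :: 'n drinfeld_yangian)"
    and "comm (h_gen i 0) (e_gen i l) = 2 *\<^sub>C (e_gen i l :: 'n drinfeld_yangian)"
    and "comm (h_gen i 0) (f_gen i l) = - (2 *\<^sub>C (f_gen i l :: 'n drinfeld_yangian))"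
    and "comm (h_gen i 1) (e_gen i l) - comm (h_gen i 0) (e_gen i (Suc l))
       = h_gen i 0 * e_gen i l + e_gen i l * (h_gen i 0 :: 'n drinfeld_yangian)"
    and "comm (h_gen i 1) (f_gen i l) - comm (h_gen i 0) (f_gen i (Suc l))
       = - (h_gen i 0 * f_gen i l + f_gen i l * (h_gen i 0 :: 'n drinfeld_yangian))"
proof -
  show "comm (h_gen i k) (h_gen j l) = (0 :: 'n drinfeld_yangian)" if "j \<in> {1..<CARD('n)}"
    using drinfeld_class_relator[OF drinfeld_relators.hh[OF i that, of k l]]
    by (simp add: drinfeld_class_simps)
  show "comm (e_gen i k) (f_gen i l) = (h_gen i (k + l) :: 'n drinfeld_yangian)"
    using drinfeld_class_relator[OF drinfeld_relators.ef[OF i i, of k l]]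
    by (simp add: drinfeld_class_simps)
  show "comm (h_gen i 0) (e_gen i l) = 2 *\<^sub>C (e_gen i l :: 'n drinfeld_yangian)"
    using drinfeld_class_relator[OF drinfeld_relators.h0e[OF i i, of l]]
    by (simp add: drinfeld_class_simps)
  show "comm (h_gen i 0) (f_gen i l) = - (2 *\<^sub>C (f_gen i l :: 'n drinfeld_yangian))"
    using drinfeld_class_relator[OF drinfeld_relators.h0f[OF i i, of l]]
    by (simp add: drinfeld_class_simps scaleC_minus_left eq_neg_iff_add_eq_0)
  show "comm (h_gen i 1) (e_gen i l) - comm (h_gen i 0) (e_gen i (Suc l))
       = h_gen i 0 * e_gen i l + e_gen i l * (h_gen i 0 :: 'n drinfeld_yangian)"
    using drinfeld_class_relator[OF drinfeld_relators.he[OF i i, of 0 l]]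
    by (simp add: drinfeld_class_simps scaleC_one)
  show "comm (h_gen i 1) (f_gen i l) - comm (h_gen i 0) (f_gen i (Suc l))
       = - (h_gen i 0 * f_gen i l + f_gen i l * (h_gen i 0 :: 'n drinfeld_yangian))"
    using drinfeld_class_relator[OF drinfeld_relators.hf[OF i i, of 0 l]]
    by (simp add: drinfeld_class_simps scaleC_neg_one)
qed

section \<open>Low order coefficients of quantum minors\<close>

lemma minor_term_nth_0:
  assumes "\<And>k l. fps_nth (T k l) 0 = (if k = l then 1 else 0)"
  shows "fps_nth (minor_term m T a b) 0 = (if \<forall>r<m. a r = b r then 1 else 0)"
proof (induction m)
  case (Suc m)
  have "minor_term (Suc m) T a b = minor_term m T a b * translate (of_nat m) (T (a m) (b m))"
    by (simp add: minor_term_def)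
  with Suc show ?case by (auto simp: assms less_Suc_eq)
qed (simp add: minor_term_def)

text \<open>At most one factor can contribute its coefficient of \<open>1/u\<close>, and the others
  contribute their constant terms.\<close>

lemma minor_term_nth_1:
  assumes T: "\<And>k l. fps_nth (T k l) 0 = (if k = l then 1 else 0)"
  shows "fps_nth (minor_term m T a b) 1
       = (\<Sum>p<m. if \<forall>r<m. r \<noteq> p \<longrightarrow> a r = b r then fps_nth (T (a p) (b p)) 1 else 0)"
proof (induction m)
  case (Suc m)
  have "minor_term (Suc m) T a b = minor_term m T a b * translate (of_nat m) (T (a m) (b m))"
    by (simp add: minor_term_def)
  then have "fps_nth (minor_term (Suc m) T a b) 1
      = (if \<forall>r<m. a r = b r then fps_nth (T (a m) (b m)) 1 else 0)
      + (if a m = b m then fps_nth (minor_term m T a b) 1 else 0)"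
    using translate_nth_1[of "of_nat m" "T (a m) (b m)"]
    by (cases "\<forall>r<m. a r = b r") (auto simp: fps_mult_nth minor_term_nth_0[where T = T, OF T] T)
  moreover have "(\<Sum>p<m. if \<forall>r<Suc m. r \<noteq> p \<longrightarrow> a r = b r then fps_nth (T (a p) (b p)) 1 else 0)
      = (\<Sum>p<m. if a m = b m \<and> (\<forall>r<m. r \<noteq> p \<longrightarrow> a r = b r) then fps_nth (T (a p) (b p)) 1 else 0)"
    by (intro sum.cong refl if_cong) (auto simp: less_Suc_eq)
  moreover have "(\<forall>r<Suc m. r \<noteq> m \<longrightarrow> a r = b r) \<longleftrightarrow> (\<forall>r<m. a r = b r)"
    by (auto simp: less_Suc_eq)
  ultimately show ?case
    unfolding Suc.IH sum.lessThan_Suc by (cases "a m = b m") (simp_all add: add.commute)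
qed (simp add: minor_term_def)

lemma quantum_minor_nth_0:
  assumes T: "\<And>k l. fps_nth (T k l) 0 = (if k = l then 1 else 0)" and as: "distinct as"
  shows "fps_nth (quantum_minor T as as) 0 = 1"
proof -
  have "fps_nth (quantum_minor T as as) 0
      = (\<Sum>\<sigma> | \<sigma> permutes {..<length as}. if \<sigma> = id then 1 else 0)"
    unfolding quantum_minor_conv_fun minor_fun_def fps_sum_nth
  proof (intro sum.cong refl)
    fix \<sigma> assume "\<sigma> \<in> {\<sigma>. \<sigma> permutes {..<length as}}"
    then have \<sigma>: "\<sigma> permutes {..<length as}" by simp
    have "(\<forall>r<length as. as ! \<sigma> r = as ! r) \<longleftrightarrow> \<sigma> = id"
      using as permutes_lessThan_less[OF \<sigma>] permutes_not_in[OF \<sigma>]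
      by (auto simp: nth_eq_iff_index_eq fun_eq_iff)
    then show "fps_nth (of_int (sign \<sigma>) * minor_term (length as) T ((!) as \<circ> \<sigma>) ((!) as)) 0
        = (if \<sigma> = id then 1 else 0)"
      by (simp add: minor_term_nth_0[where T = T, OF T])
  qed
  also have "\<dots> = 1" by (simp add: permutes_id finite_permutations)
  finally show ?thesis .
qed

text \<open>The column \<open>b\<close> has constant term zero in all rows, so it must supply the
  coefficient of \<open>1/u\<close>, while the other columns force the identity permutation.\<close>

lemma quantum_minor_nth_1:
  assumes T: "\<And>k l. fps_nth (T k l) 0 = (if k = l then 1 else 0)"
    and J: "distinct (J @ [a])" "b \<notin> set (J @ [a])"
  shows "fps_nth (quantum_minor T (J @ [a]) (J @ [b])) 1 = fps_nth (T a b) 1"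
proof -
  let ?m = "Suc (length J)"
  have "fps_nth (quantum_minor T (J @ [a]) (J @ [b])) 1
      = (\<Sum>\<sigma> | \<sigma> permutes {..<?m}. if \<sigma> = id then fps_nth (T a b) 1 else 0)"
    unfolding quantum_minor_conv_fun minor_fun_def fps_sum_nth length_append_singleton
  proof (intro sum.cong refl)
    fix \<sigma> assume "\<sigma> \<in> {\<sigma>. \<sigma> permutes {..<?m}}"
    then have \<sigma>: "\<sigma> permutes {..<?m}" by simp
    have other: "\<not> (\<forall>r<?m. r \<noteq> p \<longrightarrow> (J @ [a]) ! \<sigma> r = (J @ [b]) ! r)" if "p < length J" for p
    proof -
      have "(J @ [a]) ! \<sigma> (length J) \<in> set (J @ [a])"
        using permutes_lessThan_less[OF \<sigma>, of "length J"] by (intro nth_mem) simp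
      with that J(2) show ?thesis by (auto intro!: exI[of _ "length J"])
    qed
    have last: "(\<forall>r<?m. r \<noteq> length J \<longrightarrow> (J @ [a]) ! \<sigma> r = (J @ [b]) ! r) \<longleftrightarrow> \<sigma> = id"
    proof
      assume *: "\<forall>r<?m. r \<noteq> length J \<longrightarrow> (J @ [a]) ! \<sigma> r = (J @ [b]) ! r"
      have fixed: "\<sigma> r = r" if "r \<noteq> length J" for r
      proof (cases "r < ?m")
        case True
        with that * have "(J @ [a]) ! \<sigma> r = (J @ [a]) ! r" by (simp add: nth_append)
        then show ?thesis
          using True J(1) permutes_lessThan_less[OF \<sigma> True] nth_eq_iff_index_eq[OF J(1)]
          by (simp del: distinct_append)
      next
        case False
        then show ?thesis using permutes_not_in[OF \<sigma>] by simp
      qed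
      then have "\<sigma> (length J) = length J"
        using permutes_inj[OF \<sigma>] by (metis inj_eq)
      with fixed show "\<sigma> = id" by (metis eq_id_iff)
    qed (simp add: nth_append)
    have "(\<Sum>p<length J. if \<forall>r<?m. r \<noteq> p \<longrightarrow> ((!) (J @ [a]) \<circ> \<sigma>) r = (J @ [b]) ! r
        then fps_nth (T (((!) (J @ [a]) \<circ> \<sigma>) p) ((J @ [b]) ! p)) 1 else 0) = 0"
      using other by (intro sum.neutral ballI) (simp only: o_apply lessThan_iff if_False)
    then have "fps_nth (minor_term ?m T ((!) (J @ [a]) \<circ> \<sigma>) ((!) (J @ [b]))) 1
        = (if \<sigma> = id then fps_nth (T a b) 1 else 0)"
      unfolding minor_term_nth_1[where T = T, OF T] sum.lessThan_Suc
      unfolding o_apply last by simp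
    moreover have "fps_nth (of_int z * F) 1 = of_int z * fps_nth F 1" for z and F :: "'a fps"
      unfolding fps_of_int[symmetric] by simp
    ultimately show "fps_nth (of_int (sign \<sigma>) * minor_term ?m T ((!) (J @ [a]) \<circ> \<sigma>) ((!) (J @ [b]))) 1
        = (if \<sigma> = id then fps_nth (T a b) 1 else 0)"
      by simp
  qed
  also have "\<dots> = fps_nth (T a b) 1" by (simp add: permutes_id finite_permutations)
  finally show ?thesis .
qed

section \<open>Conjugation as translation\<close>

text \<open>The assumption \<open>ladder\<close> reads \<open>[s, e(u)] = u e(u) - x\<close>. Conjugation
  with \<open>P\<close> fixes \<open>s\<close> and adds one to the factor \<open>u\<close>,
  because of what it does to \<open>x\<close>; translation adds one to \<open>u\<close> as well.
  The difference \<open>Z\<close> of both sides solves the homogeneous equation \<open>[s, Z] = (u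
  + 1) Z\<close>, which forces its coefficients to vanish one after the other.\<close>

lemma conjugation_eq_translation:
  fixes e e\<^sub>0 P P' :: "'a :: complex_algebra_1 fps"
  assumes P: "P * P' = 1" "P' * P = 1"
    and sP: "comm (fps_const s) P = 0"
    and ladder: "fps_X * comm (fps_const s) e = e - fps_X * fps_const x"
    and x: "P * fps_const x * P' = fps_const x - P * e * P'"
  shows "P * e * P' = translate 1 e"
proof -
  define Z where "Z = P * e * P' - translate 1 e"
  let ?s = "fps_const s"
  have "comm ?s P' = P' * (P * comm ?s P')" by (simp add: mult.assoc[symmetric] P)
  also have "P * comm ?s P' = comm ?s (P * P')" by (simp add: comm_mult sP)
  finally have sP': "comm ?s P' = 0" by (simp add: P)
  have X: "P * (fps_X * F) = fps_X * (P * F)" for F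
    by (metis fps_mult_fps_X_commute mult.assoc)
  have "fps_X * comm ?s (P * e * P') = P * (fps_X * comm ?s e) * P'"
    by (simp add: comm_mult sP sP' X mult.assoc)
  also have "\<dots> = P * e * P' - fps_X * (P * fps_const x * P')"
    unfolding ladder right_diff_distrib left_diff_distrib by (simp add: X mult.assoc)
  finally have conj: "fps_X * comm ?s (P * e * P') = (1 + fps_X) * (P * e * P') - fps_X * fps_const x"
    unfolding x by (simp add: algebra_simps)
  have "translate 1 (fps_X * comm ?s e) = translate 1 (e - fps_X * fps_const x)"
    by (simp only: ladder)
  then have "translate 1 fps_X * comm ?s (translate 1 e) = translate 1 e - translate 1 fps_X * fps_const x"
    by (simp only: translate_mult translate_diff translate_comm_const translate_const)
  then have "(1 + fps_X) * translate 1 fps_X * comm ?s (translate 1 e)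
      = (1 + fps_X) * translate 1 e - (1 + fps_X) * translate 1 fps_X * fps_const x"
    by (simp only: mult.assoc right_diff_distrib)
  then have "fps_X * comm ?s Z = (1 + fps_X) * Z"
    using conj by (simp add: translate_1_X Z_def comm_diff right_diff_distrib)
  then have eq: "fps_nth (fps_X * comm ?s Z) k = fps_nth (Z + fps_X * Z) k" for k
    by (simp add: distrib_right)
  have "fps_nth Z k = 0" for k
  proof (induction k)
    case 0
    show ?case using eq[of 0] by simp
  next
    case (Suc k)
    then show ?case using eq[of "Suc k"] by (simp add: comm_const_nth)
  qed
  then have "Z = 0" by (intro fps_ext) simp
  then show ?thesis by (simp add: Z_def)
qed

section \<open>Series with coefficients in a subalgebra\<close>

locale complex_subalgebra =
  fixes S :: "'a :: complex_algebra_1 set"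
  assumes S_1: "1 \<in> S"
    and S_add: "x \<in> S \<Longrightarrow> y \<in> S \<Longrightarrow> x + y \<in> S"
    and S_mult: "x \<in> S \<Longrightarrow> y \<in> S \<Longrightarrow> x * y \<in> S"
    and S_scaleC: "x \<in> S \<Longrightarrow> c *\<^sub>C x \<in> S"
begin

lemma S_0: "0 \<in> S"
  using S_scaleC[OF S_1, of 0] by simp

lemma S_uminus: "x \<in> S \<Longrightarrow> - x \<in> S"
  using S_scaleC[of x "-1"] by (simp add: scaleC_neg_one)

lemma S_diff: "x \<in> S \<Longrightarrow> y \<in> S \<Longrightarrow> x - y \<in> S"
  using S_add[OF _ S_uminus, of x y] by simp

lemma S_sum: "(\<And>x. x \<in> A \<Longrightarrow> f x \<in> S) \<Longrightarrow> sum f A \<in> S"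
  by (induction A rule: infinite_finite_induct) (auto intro: S_0 S_add)

text \<open>For series of this kind the coefficient of order \<open>k\<close> is additive under
  multiplication and invariant under translation, modulo \<open>S\<close>.\<close>

definition coefficients_below :: "nat \<Rightarrow> 'a fps \<Rightarrow> bool" where
  "coefficients_below k F \<longleftrightarrow> fps_nth F 0 = 1 \<and> (\<forall>m<k. fps_nth F m \<in> S)"

lemma coefficients_below_mult:
  assumes F: "coefficients_below k F" and G: "coefficients_below k G"
  shows "coefficients_below k (F * G)"
    and "0 < k \<Longrightarrow> fps_nth (F * G) k - (fps_nth F k + fps_nth G k) \<in> S"
proof -
  show "coefficients_below k (F * G)"
    using F G unfolding coefficients_below_def fps_mult_nth
    by (auto intro!: S_sum S_mult simp: atLeast0AtMost)
  assume "0 < k"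
  then obtain j where k: "k = Suc j" by (cases k) auto
  have "fps_nth (F * G) k = fps_nth F k + fps_nth G k + (\<Sum>m=1..j. fps_nth F m * fps_nth G (k - m))"
    using F G by (simp add: fps_mult_nth k sum.atLeast_Suc_atMost coefficients_below_def add_ac)
  moreover have "(\<Sum>m=1..j. fps_nth F m * fps_nth G (k - m)) \<in> S"
    using F G by (intro S_sum S_mult) (auto simp: coefficients_below_def k)
  ultimately show "fps_nth (F * G) k - (fps_nth F k + fps_nth G k) \<in> S" by simp
qed

lemma coefficients_below_translate:
  assumes F: "coefficients_below k F"
  shows "coefficients_below k (translate c F)"
    and "fps_nth (translate c F) k - fps_nth F k \<in> S"
proof -
  show "coefficients_below k (translate c F)"
    using F by (auto simp: coefficients_below_def translate_nth[of c F] simp del: translate_nth_0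
        intro!: S_sum S_scaleC) (simp add: scaleC_one)
  have "{..k} = insert k {..<k}" by auto
  then have "fps_nth (translate c F) k - fps_nth F k
      = (\<Sum>m<k. translation_coeff c m (k - m) *\<^sub>C fps_nth F m)"
    by (simp add: translate_nth scaleC_one)
  also have "\<dots> \<in> S"
    using F by (intro S_sum S_scaleC) (auto simp: coefficients_below_def)
  finally show "fps_nth (translate c F) k - fps_nth F k \<in> S" .
qed

text \<open>Modulo \<open>S\<close> the sequence \<open>X\<close> is an arithmetic progression starting at
  zero, and \<open>n X 1\<close> is zero, where \<open>n\<close> is invertible. This is the
  invertibility of the Cartan matrix.\<close>

lemma second_difference_vanishing:
  fixes X :: "nat \<Rightarrow> 'a"
  assumes d: "\<And>j. 1 \<le> j \<Longrightarrow> j < n \<Longrightarrow> X (j + 1) - X j - X j + X (j - 1) \<in> S"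
    and X: "X 0 \<in> S" "X n \<in> S" and n: "0 < n" and j: "j \<le> n"
  shows "X j \<in> S"
proof -
  have linear: "X j - of_nat j * X 1 \<in> S" if "j \<le> n" for j
    using that
  proof (induction j rule: less_induct)
    case (less j)
    consider "j = 0" | "j = 1" | k where "j = Suc (Suc k)"
      by (metis One_nat_def not0_implies_Suc)
    then show ?case
    proof cases
      case 3
      let ?a = "X (Suc k) - of_nat (Suc k) * X 1" and ?b = "X k - of_nat k * X 1"
      have "X j - of_nat j * X 1 = (X (Suc k + 1) - X (Suc k) - X (Suc k) + X (Suc k - 1)) + ?a + ?a - ?b"
        by (simp add: 3 algebra_simps)
      also have "\<dots> \<in> S"
        using less.prems by (intro S_add S_diff d less.IH) (auto simp: 3)
      finally show ?thesis .
    qed (use X S_0 in simp_all)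
  qed
  have "of_nat n * X 1 \<in> S"
    using S_diff[OF X(2) linear[of n]] by simp
  then have "inverse (of_nat n) *\<^sub>C (of_nat n *\<^sub>C X 1) \<in> S"
    unfolding of_nat_scaleC by (rule S_scaleC)
  then have "X 1 \<in> S"
    using n by (simp add: scaleC_scaleC scaleC_one)
  then have "of_nat j * X 1 \<in> S"
    unfolding of_nat_scaleC[symmetric] by (rule S_scaleC)
  from S_add[OF linear[OF j] this] show ?thesis by simp
qed

end

lemma complex_subalgebra_centralizer: "complex_subalgebra {x. \<forall>y\<in>Y. comm x y = 0}"
proof
  fix x x' assume "x \<in> {x. \<forall>y\<in>Y. comm x y = 0}" "x' \<in> {x. \<forall>y\<in>Y. comm x y = 0}"
  then show "x * x' \<in> {x. \<forall>y\<in>Y. comm x y = 0}" "x + x' \<in> {x. \<forall>y\<in>Y. comm x y = 0}"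
    by (auto simp: comm_def distrib_left distrib_right) (metis mult.assoc)
qed (auto simp: comm_scaleC_left, simp add: comm_def)

section \<open>The Drinfel'd series at one node\<close>

locale drinfeld_node =
  fixes \<phi> :: "'n drinfeld_yangian \<Rightarrow> 'n yangian" and i :: nat
  assumes \<phi>: "is_drinfeld_iso \<phi>" and i: "1 \<le> i" "i < CARD('n)"
begin

lemma algebra_hom_\<phi>: "algebra_hom \<phi>"
  using \<phi> by (simp add: is_drinfeld_iso_def algebra_iso_def)

lemma node_in_range: "i \<in> {1..<CARD('n)}"
  using i by simp

definition principal :: "nat \<Rightarrow> 'n yangian fps" where
  "principal j = t_minor [1..<j+1] [1..<j+1]"

text \<open>Translating all minors by \<open>- shift\<close> once and for all lets them be compared with the
  Drinfel'd series directly.\<close>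

definition shift :: complex where
  "shift = (of_nat i - 2) / 2"

definition lead :: "nat list" where
  "lead = [1..<i] @ [i]"

text \<open>The columns of the minor in the numerator of \<open>e\<close>, and the starting point of the
  iterated actions.\<close>

definition bump :: "nat list" where
  "bump = [1..<i] @ [Suc i]"

definition minor :: "nat list \<Rightarrow> nat list \<Rightarrow> 'n yangian fps" where
  "minor as bs = translate (- shift) (quantum_minor T_cut as bs)"

definition Q :: "'n yangian fps" where
  "Q = minor lead lead"

definition Q_inv :: "'n yangian fps" where
  "Q_inv = translate (- shift) (fps_right_inverse (principal i) 1)"

definition level_one :: "nat \<Rightarrow> nat \<Rightarrow> 'n yangian fps" where
  "level_one s t = fps_const (T_gen s t 1)"

lemma principal_nth_0: "fps_nth (principal j) 0 = 1"
  unfolding principal_def t_minor_def by (rule quantum_minor_nth_0) (simp_all add: T_ser_nth_0)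

lemma principal_inverse:
  "principal j * fps_right_inverse (principal j) 1 = 1"
  "fps_right_inverse (principal j) 1 * principal j = 1"
  by (rule fps_right_inverse_both, rule principal_nth_0)+

lemma lead_eq: "[1..<i + 1] = lead"
  using i by (simp add: lead_def)

lemma length_lead [simp]: "length lead = i" "length bump = i"
  using i by (simp_all add: lead_def bump_def)

lemma lead_nth: "p < i \<Longrightarrow> lead ! p = Suc p"
  and bump_nth: "p < i \<Longrightarrow> bump ! p = (if p = i - 1 then Suc i else Suc p)"
  by (auto simp: lead_def bump_def nth_append)

lemma set_lead: "set lead = {1..i}" and set_bump: "set bump = insert (Suc i) {1..<i}"
  using i by (auto simp: lead_def bump_def)

lemma lead_in_range: "set lead \<subseteq> {1..CARD('n)}" "set bump \<subseteq> {1..CARD('n)}"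
  using i by (auto simp: set_lead set_bump)

lemma lead_update: "lead[i - 1 := k] = [1..<i] @ [k]" "bump[i - 1 := k] = [1..<i] @ [k]"
  using i by (simp_all add: lead_def bump_def list_update_append)

lemma lead_update_bump: "lead[i - 1 := Suc i] = bump" "bump[i - 1 := i] = lead"
  unfolding lead_update by (simp_all add: lead_def bump_def)

lemma minor_conv_t_minor:
  assumes "set as \<subseteq> {1..CARD('n)}" "set bs \<subseteq> {1..CARD('n)}" "length as = length bs"
  shows "minor as bs = translate (- shift) (t_minor as bs)"
  by (simp add: minor_def t_minor_conv_T_cut[OF assms])

lemma Q_conv_principal: "Q = translate (- shift) (principal i)"
  unfolding Q_def principal_def lead_eq
  by (rule minor_conv_t_minor) (use lead_in_range in simp_all)

lemma Q_inverse: "Q * Q_inv = 1" "Q_inv * Q = 1"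
  unfolding Q_conv_principal Q_inv_def translate_mult[symmetric] by (simp_all add: principal_inverse)

lemma Q_nth_0: "fps_nth Q 0 = 1" "fps_nth Q_inv 0 = 1"
  unfolding Q_conv_principal Q_inv_def by (simp_all add: principal_nth_0)

lemma Q_cancel: "Q * (Q_inv * F) = F" "Q_inv * (Q * F) = F"
  by (simp_all add: Q_inverse mult.assoc[symmetric])

lemma drinfeld_series:
  assumes "j \<in> {1..<CARD('n)}"
  shows "translate ((of_nat j - 2) / 2) (e_ser \<phi> j)
       = fps_right_inverse (principal j) 1 * t_minor ([1..<j] @ [j]) ([1..<j] @ [j+1])"
    and "translate ((of_nat j - 2) / 2) (f_ser \<phi> j)
       = t_minor ([1..<j] @ [j+1]) ([1..<j] @ [j]) * fps_right_inverse (principal j) 1"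
    and "translate ((of_nat j - 2) / 2) (h_ser \<phi> j)
       = fps_right_inverse (principal j) 1 * principal (j - 1) * translate (- 1) (principal (j + 1))
         * fps_right_inverse (translate (- 1) (principal j)) 1"
  using \<phi> assms unfolding is_drinfeld_iso_def principal_def Let_def by blast+

lemma translate_shift_cancel: "translate (- shift) (translate shift F) = F"
  by (simp add: translate_translate)

lemma e_ser_eq: "e_ser \<phi> i = Q_inv * minor lead bump"
proof -
  have "e_ser \<phi> i = translate (- shift) (translate shift (e_ser \<phi> i))"
    by (rule translate_shift_cancel[symmetric])
  then show ?thesis
    unfolding shift_def drinfeld_series(1)[OF node_in_range]
    unfolding translate_mult Q_inv_def shift_def[symmetric]
    by (simp only: minor_conv_t_minor lead_in_range length_lead lead_def[symmetric]
        bump_def[symmetric] Suc_eq_plus1[symmetric])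
qed

lemma f_ser_eq: "f_ser \<phi> i = minor bump lead * Q_inv"
proof -
  have "f_ser \<phi> i = translate (- shift) (translate shift (f_ser \<phi> i))"
    by (rule translate_shift_cancel[symmetric])
  then show ?thesis
    unfolding shift_def drinfeld_series(2)[OF node_in_range]
    unfolding translate_mult Q_inv_def shift_def[symmetric]
    by (simp only: minor_conv_t_minor lead_in_range length_lead lead_def[symmetric]
        bump_def[symmetric] Suc_eq_plus1[symmetric])
qed

lemma e_ser_nth: "fps_nth (e_ser \<phi> i) 0 = 0" "fps_nth (e_ser \<phi> i) (Suc k) = \<phi> (e_gen i k)"
  and f_ser_nth: "fps_nth (f_ser \<phi> i) 0 = 0" "fps_nth (f_ser \<phi> i) (Suc k) = \<phi> (f_gen i k)"
  and h_ser_nth: "fps_nth (h_ser \<phi> j) 0 = 1" "fps_nth (h_ser \<phi> j) (Suc k) = \<phi> (h_gen j k)"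
  by (simp_all add: e_ser_def f_ser_def h_ser_def algebra_hom_0[OF algebra_hom_\<phi>]
      algebra_hom_1[OF algebra_hom_\<phi>])

text \<open>Compare the coefficients of \<open>1/u\<close> in \<open>t I J = Q e\<close> and \<open>t J I =
  f Q\<close>, with \<open>I = lead\<close> and \<open>J = bump\<close>.\<close>

lemma e_gen_0: "\<phi> (e_gen i 0) = T_gen i (Suc i) 1"
  and f_gen_0: "\<phi> (f_gen i 0) = T_gen (Suc i) i 1"
proof -
  have e: "minor lead bump = Q * e_ser \<phi> i" and f: "minor bump lead = f_ser \<phi> i * Q"
    by (simp_all add: e_ser_eq f_ser_eq Q_cancel mult.assoc Q_inverse)
  have "\<phi> (e_gen i 0) = fps_nth (minor lead bump) 1" "\<phi> (f_gen i 0) = fps_nth (minor bump lead) 1"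
    unfolding e f by (simp_all add: fps_mult_nth Q_nth_0 e_ser_nth f_ser_nth)
  moreover have "fps_nth (minor lead bump) 1 = fps_nth (T_ser i (Suc i)) 1"
    "fps_nth (minor bump lead) 1 = fps_nth (T_ser (Suc i) i) 1"
    unfolding minor_conv_t_minor[OF lead_in_range, simplified length_lead, OF refl]
      minor_conv_t_minor[OF lead_in_range(2,1), simplified length_lead, OF refl]
      translate_nth_1 t_minor_def
    unfolding lead_def bump_def by (intro quantum_minor_nth_1; auto simp: T_ser_nth_0)+
  ultimately show "\<phi> (e_gen i 0) = T_gen i (Suc i) 1" "\<phi> (f_gen i 0) = T_gen (Suc i) i 1"
    by (simp_all add: T_ser_def T_series_def)
qed

section \<open>Principal minors commute with the Cartan series\<close>

definition cartan_centralizer :: "'n yangian set" where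
  "cartan_centralizer = {x. \<forall>y\<in>{\<phi> (h_gen j k) | j k. j \<in> {1..<CARD('n)}}. comm x y = 0}"

text \<open>The formula for \<open>h\<^sub>j\<close> expresses, up to a translation of
  \<open>h\<^sub>j\<close>, the product \<open>t\<^sub>j(u) h\<^sub>j(u) t\<^sub>j(u - 1)\<close>
  as \<open>t\<^sub>j\<^sub>-\<^sub>1(u) t\<^sub>j\<^sub>+\<^sub>1(u - 1)\<close>, where
  \<open>t\<^sub>j\<close> is the principal minor. If the coefficients below order
  \<open>k\<close> centralise the series \<open>h\<close>, then, modulo the centraliser, the
  coefficients of order \<open>k\<close> have second difference zero in \<open>j\<close>. For
  \<open>k > 0\<close> they vanish at \<open>j = 0\<close> and, by the quantum determinant
  relation, at \<open>j = n\<close>.\<close>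

lemma principal_centralizes: "j \<le> CARD('n) \<Longrightarrow> fps_nth (principal j) k \<in> cartan_centralizer"
proof (induction k arbitrary: j rule: less_induct)
  case (less k)
  interpret S: complex_subalgebra cartan_centralizer
    unfolding cartan_centralizer_def by (rule complex_subalgebra_centralizer)
  show ?case
  proof (cases "k = 0")
    case True
    then show ?thesis by (simp add: principal_nth_0 S.S_1)
  next
    case False
    have below: "S.coefficients_below k (principal j)" if "j \<le> CARD('n)" for j
      using less.IH that by (simp add: S.coefficients_below_def principal_nth_0)
    have h: "fps_nth (h_ser \<phi> j) m \<in> cartan_centralizer" if j: "j \<in> {1..<CARD('n)}" for j m
    proof (cases m)
      case (Suc l)
      have "comm (\<phi> (h_gen j l)) (\<phi> (h_gen j' l')) = 0" if "j' \<in> {1..<CARD('n)}" for j' l'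
        using drinfeld_relations(1)[OF j that]
        by (simp add: algebra_hom_0[OF algebra_hom_\<phi>] flip: algebra_hom_comm[OF algebra_hom_\<phi>])
      then show ?thesis by (auto simp: Suc h_ser_nth cartan_centralizer_def)
    qed (simp add: h_ser_nth S.S_1)
    have difference: "fps_nth (principal (j + 1)) k - fps_nth (principal j) k - fps_nth (principal j) k
        + fps_nth (principal (j - 1)) k \<in> cartan_centralizer" if j: "1 \<le> j" "j < CARD('n)" for j
    proof -
      let ?P = "principal j" and ?P' = "translate (- 1) (principal j)"
        and ?N = "translate (- 1) (principal (j + 1))"
      define H where "H = translate ((of_nat j - 2) / 2) (h_ser \<phi> j)"
      have "fps_nth ?P' 0 = 1" by (simp add: principal_nth_0)
      then have "?P * H * ?P' = principal (j - 1) * ?N"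
        unfolding H_def using j
        by (subst drinfeld_series(3)) (simp_all add: mult.assoc fps_right_inverse_both
            principal_inverse flip: mult.assoc[of ?P])
      then have eq: "fps_nth (?P * H * ?P') k = fps_nth (principal (j - 1) * ?N) k" by simp
      have bH: "S.coefficients_below k (h_ser \<phi> j)"
        using h j by (simp add: S.coefficients_below_def h_ser_nth)
      note bH' = S.coefficients_below_translate[OF bH, of "(of_nat j - 2) / 2", folded H_def]
      have Hk: "fps_nth H k \<in> cartan_centralizer"
        using S.S_add[OF bH'(2) h[of j k]] j by simp
      have b: "S.coefficients_below k ?P" "S.coefficients_below k (principal (j - 1))"
        "S.coefficients_below k (principal (j + 1))"
        using j by (auto intro!: below)
      note bP' = S.coefficients_below_translate[OF b(1), of "- 1"]
      note bN = S.coefficients_below_translate[OF b(3), of "- 1"]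
      have k: "0 < k" using False by simp
      note PH = S.coefficients_below_mult[OF b(1) bH'(1)]
      have "fps_nth (?P * H * ?P') k - (fps_nth (?P * H) k + fps_nth ?P' k) \<in> cartan_centralizer"
        by (rule S.coefficients_below_mult(2)[OF PH(1) bP'(1) k])
      moreover have "fps_nth (principal (j - 1) * ?N) k - (fps_nth (principal (j - 1)) k + fps_nth ?N k)
          \<in> cartan_centralizer"
        by (rule S.coefficients_below_mult(2)[OF b(2) bN(1) k])
      moreover have "fps_nth (principal (j + 1)) k - fps_nth ?P k - fps_nth ?P k + fps_nth (principal (j - 1)) k
        = (fps_nth (?P * H * ?P') k - (fps_nth (?P * H) k + fps_nth ?P' k))
        - (fps_nth (principal (j - 1) * ?N) k - (fps_nth (principal (j - 1)) k + fps_nth ?N k))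
        + (fps_nth (?P * H) k - (fps_nth ?P k + fps_nth H k)) + fps_nth H k
        + (fps_nth ?P' k - fps_nth ?P k) - (fps_nth ?N k - fps_nth (principal (j + 1)) k)"
        unfolding eq by simp
      ultimately show ?thesis
        using PH(2)[OF k] Hk bP'(2) bN(2) by (simp only: S.S_add S.S_diff)
    qed
    have ends: "principal 0 = 1" "principal CARD('n) = 1"
      using quantum_determinant_1[where 'n = 'n]
      by (simp_all add: principal_def t_minor_def del: upt_Suc) (simp add: quantum_minor_def)
    show ?thesis
      by (rule S.second_difference_vanishing[where X = "\<lambda>j. fps_nth (principal j) k" and n = "CARD('n)"])
         (use difference ends False less.prems S.S_0 i in \<open>simp_all\<close>)
  qed
qed

text \<open>The commutator of \<open>h\<^sub>1\<close> with \<open>e\<^sub>l\<close> is twice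
  \<open>e\<^sub>l\<^sub>+\<^sub>1\<close> plus the anticommutator of \<open>h\<^sub>0\<close> and
  \<open>e\<^sub>l\<close>; half the square of \<open>h\<^sub>0\<close> produces the same
  anticommutator.\<close>

definition ladder_gen :: "'n drinfeld_yangian" where
  "ladder_gen = (1/2) *\<^sub>C (h_gen i 1 - (1/2) *\<^sub>C (h_gen i 0 * h_gen i 0))"

lemma ladder_e: "comm ladder_gen (e_gen i l) = e_gen i (Suc l)"
  and ladder_f: "comm ladder_gen (f_gen i l) = - f_gen i (Suc l)"
proof -
  note rel = drinfeld_relations[OF node_in_range]
  have h1: "comm (h_gen i 1) (e_gen i l) = 2 *\<^sub>C (e_gen i (Suc l) :: 'n drinfeld_yangian)
      + (h_gen i 0 * e_gen i l + e_gen i l * h_gen i 0)"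
    using rel(5)[of l] unfolding rel(3) by (simp add: diff_eq_eq add.commute)
  have h1f: "comm (h_gen i 1) (f_gen i l) = - (2 *\<^sub>C (f_gen i (Suc l) :: 'n drinfeld_yangian))
      - (h_gen i 0 * f_gen i l + f_gen i l * h_gen i 0)"
    using rel(6)[of l] unfolding rel(4) diff_eq_eq by simp
  have half: "(1/2) *\<^sub>C (2 *\<^sub>C x) = x" for x :: "'n drinfeld_yangian"
    by (simp add: scaleC_scaleC scaleC_one)
  show "comm ladder_gen (e_gen i l) = e_gen i (Suc l)"
    unfolding ladder_gen_def comm_scaleC_left comm_diff_left comm_mult_left h1 rel(3)
    by (simp add: mult_scaleC_left mult_scaleC_right scaleC_add_right[symmetric] half)
  show "comm ladder_gen (f_gen i l) = - f_gen i (Suc l)"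
    unfolding ladder_gen_def comm_scaleC_left comm_diff_left comm_mult_left h1f rel(4)
    by (simp add: mult_scaleC_left mult_scaleC_right scaleC_add_right[symmetric] half scaleC_uminus
        scaleC_diff)
qed

lemma Q_commutes_ladder: "comm (fps_const (\<phi> ladder_gen)) Q = 0" "comm (fps_const (\<phi> ladder_gen)) Q_inv = 0"
proof -
  have "comm (fps_const (\<phi> ladder_gen)) (principal i) = 0"
  proof (rule fps_ext)
    fix k
    have "comm (fps_nth (principal i) k) (\<phi> (h_gen i l)) = 0" for l
      using principal_centralizes[of i k] i by (auto simp: cartan_centralizer_def)
    then have "comm (\<phi> (h_gen i l)) (fps_nth (principal i) k) = 0" for l
      by (simp add: comm_def)
    then have "comm (\<phi> ladder_gen) (fps_nth (principal i) k) = 0"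
      by (simp add: ladder_gen_def algebra_hom_scaleC[OF algebra_hom_\<phi>]
          algebra_hom_diff[OF algebra_hom_\<phi>] algebra_hom_mult[OF algebra_hom_\<phi>]
          comm_scaleC_left comm_diff_left comm_mult_left)
    then show "fps_nth (comm (fps_const (\<phi> ladder_gen)) (principal i)) k = fps_nth 0 k"
      by (simp add: comm_const_nth)
  qed
  then show *: "comm (fps_const (\<phi> ladder_gen)) Q = 0"
    by (simp add: Q_conv_principal flip: translate_comm_const)
  have "comm (fps_const (\<phi> ladder_gen)) Q_inv
      = Q_inv * (comm (fps_const (\<phi> ladder_gen)) (Q * Q_inv))"
    unfolding comm_mult * by (simp add: Q_cancel)
  then show "comm (fps_const (\<phi> ladder_gen)) Q_inv = 0" by (simp add: Q_inverse)
qed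

section \<open>Minors and Drinfel'd series at \<open>u\<close> and \<open>u + 1\<close>\<close>

lemma minor_comm:
  assumes "s \<in> {1..CARD('n)}" "t \<in> {1..CARD('n)}" "length as = length bs"
  shows "comm (level_one s t) (minor as bs)
       = translate (- shift) (replace_columns T_cut as bs s t) - translate (- shift) (replace_rows T_cut as bs s t)"
  unfolding level_one_def minor_def translate_comm_const[symmetric] translate_diff[symmetric]
    quantum_minor_comm[OF T_cut_comm[OF assms(1,2)] assms(3)] ..

lemma minor_comm_column:
  assumes "s \<in> {1..CARD('n)}" "t \<in> {1..CARD('n)}" "length as = length bs" "s \<noteq> t"
    and "t \<in> set as \<Longrightarrow> s \<in> set as"
    and "p < length bs" "bs ! p = s" "\<And>q. q < length bs \<Longrightarrow> q \<noteq> p \<Longrightarrow> bs ! q \<noteq> s"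
  shows "comm (level_one s t) (minor as bs) = minor as (bs[p := t])"
proof -
  let ?T = "T_cut :: nat \<Rightarrow> nat \<Rightarrow> 'n yangian fps"
  have "replace_rows ?T as bs s t = 0"
    by (rule replace_rows_eq_0) (fact assms(4), rule assms(5))
  moreover have "replace_columns ?T as bs s t = quantum_minor ?T as (bs[p := t])"
    by (rule replace_columns_single) (fact assms(6-8))+
  ultimately show ?thesis
    unfolding minor_comm[OF assms(1-3)] by (simp add: minor_def)
qed

lemma minor_comm_row:
  assumes "s \<in> {1..CARD('n)}" "t \<in> {1..CARD('n)}" "length as = length bs" "s \<noteq> t"
    and "s \<in> set bs \<Longrightarrow> t \<in> set bs"
    and "p < length as" "as ! p = t" "\<And>q. q < length as \<Longrightarrow> q \<noteq> p \<Longrightarrow> as ! q \<noteq> t"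
  shows "comm (level_one s t) (minor as bs) = - minor (as[p := s]) bs"
proof -
  let ?T = "T_cut :: nat \<Rightarrow> nat \<Rightarrow> 'n yangian fps"
  have "replace_columns ?T as bs s t = 0"
    by (rule replace_columns_eq_0[OF exchange_relation_T_cut]) (fact assms(3,4) | rule assms(5))+
  moreover have "replace_rows ?T as bs s t = quantum_minor ?T (as[p := s]) bs"
    by (rule replace_rows_single) (fact assms(6-8))+
  ultimately show ?thesis
    unfolding minor_comm[OF assms(1-3)] by (simp add: minor_def)
qed

lemma minor_comm_0:
  assumes "s \<in> {1..CARD('n)}" "t \<in> {1..CARD('n)}" "length as = length bs" "s \<noteq> t"
    and "s \<in> set bs \<Longrightarrow> t \<in> set bs" "t \<in> set as \<Longrightarrow> s \<in> set as"
  shows "comm (level_one s t) (minor as bs) = 0"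
proof -
  let ?T = "T_cut :: nat \<Rightarrow> nat \<Rightarrow> 'n yangian fps"
  have "replace_columns ?T as bs s t = 0"
    by (rule replace_columns_eq_0[OF exchange_relation_T_cut]) (fact assms(3,4) | rule assms(5))+
  moreover have "replace_rows ?T as bs s t = 0"
    by (rule replace_rows_eq_0) (fact assms(4), rule assms(6))
  ultimately show ?thesis
    unfolding minor_comm[OF assms(1-3)] by simp
qed

text \<open>The index \<open>i + 1\<close> occurs neither in the rows nor in the columns of
  \<open>Q\<close>, so exactly one of the two kinds of replacement takes place.\<close>

lemma raise_Q: "comm (level_one i (Suc i)) Q = minor lead bump"
  and lower_Q: "comm (level_one (Suc i) i) Q = - minor bump lead"
proof -
  show "comm (level_one i (Suc i)) Q = minor lead bump"
    unfolding Q_def lead_update_bump(1)[symmetric] using i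
    by (intro minor_comm_column) (auto simp: lead_nth set_lead)
  show "comm (level_one (Suc i) i) Q = - minor bump lead"
    unfolding Q_def lead_update_bump(1)[symmetric] using i
    by (intro minor_comm_row) (auto simp: lead_nth set_lead)
qed

lemma level_one_e_gen: "level_one i (Suc i) = fps_const (\<phi> (e_gen i 0))"
  and level_one_f_gen: "level_one (Suc i) i = fps_const (\<phi> (f_gen i 0))"
  unfolding level_one_def e_gen_0 f_gen_0 by (rule refl)+

text \<open>The left hand side is \<open>e(u + 1)\<close> and the right hand side is \<open>Q e(u)
  Q\<inverse>\<close>.\<close>

lemma translate_e_ser: "translate 1 (e_ser \<phi> i) = minor lead bump * Q_inv"
proof -
  let ?s = "fps_const (\<phi> ladder_gen)"
  have "Q * e_ser \<phi> i * Q_inv = translate 1 (e_ser \<phi> i)"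
  proof (rule conjugation_eq_translation[OF Q_inverse Q_commutes_ladder(1)])
    show "fps_X * comm ?s (e_ser \<phi> i) = e_ser \<phi> i - fps_X * fps_const (\<phi> (e_gen i 0))"
    proof (rule fps_ext)
      fix k
      show "fps_nth (fps_X * comm ?s (e_ser \<phi> i)) k
          = fps_nth (e_ser \<phi> i - fps_X * fps_const (\<phi> (e_gen i 0))) k"
      proof (cases k)
        case (Suc l)
        then show ?thesis
          by (cases l) (simp_all add: comm_const_nth e_ser_nth ladder_e
              flip: algebra_hom_comm[OF algebra_hom_\<phi>])
      qed (simp add: e_ser_nth)
    qed
    have "Q * level_one i (Suc i) = level_one i (Suc i) * Q - minor lead bump"
      using raise_Q by (simp add: comm_def algebra_simps)
    then show "Q * fps_const (\<phi> (e_gen i 0)) * Q_inv = fps_const (\<phi> (e_gen i 0)) - Q * e_ser \<phi> i * Q_inv"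
      unfolding level_one_e_gen e_ser_eq Q_cancel
      by (simp add: left_diff_distrib mult.assoc Q_inverse)
  qed
  then show ?thesis by (simp add: e_ser_eq Q_cancel)
qed

text \<open>The sign of the ladder element and the direction of the conjugation are opposite to those for
  \<open>e\<close>.\<close>

lemma translate_f_ser: "translate 1 (f_ser \<phi> i) = Q_inv * minor bump lead"
proof -
  let ?s = "fps_const (\<phi> (- ladder_gen))"
  have s: "?s = - fps_const (\<phi> ladder_gen)"
    by (simp add: algebra_hom_uminus[OF algebra_hom_\<phi>])
  have "Q_inv * f_ser \<phi> i * Q = translate 1 (f_ser \<phi> i)"
  proof (rule conjugation_eq_translation[OF Q_inverse(2,1), of "\<phi> (- ladder_gen)"])
    show "comm ?s Q_inv = 0"
      using Q_commutes_ladder(2) unfolding s comm_def by (simp del: fps_const_neg)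
    show "fps_X * comm ?s (f_ser \<phi> i) = f_ser \<phi> i - fps_X * fps_const (\<phi> (f_gen i 0))"
    proof (rule fps_ext)
      fix k
      have "comm (- ladder_gen) (f_gen i l) = f_gen i (Suc l)" for l
        by (simp add: comm_uminus_left ladder_f)
      then show "fps_nth (fps_X * comm ?s (f_ser \<phi> i)) k
          = fps_nth (f_ser \<phi> i - fps_X * fps_const (\<phi> (f_gen i 0))) k"
      proof (cases k)
        case (Suc l)
        then show ?thesis
          using \<open>\<And>l. comm (- ladder_gen) (f_gen i l) = f_gen i (Suc l)\<close>
          by (cases l) (simp_all add: comm_const_nth f_ser_nth
              flip: algebra_hom_comm[OF algebra_hom_\<phi>])
      qed (simp add: f_ser_nth)
    qed
    have "level_one (Suc i) i * Q = Q * level_one (Suc i) i - minor bump lead"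
      using lower_Q by (simp add: comm_def algebra_simps)
    then have "Q_inv * (level_one (Suc i) i * Q) = Q_inv * (Q * level_one (Suc i) i - minor bump lead)"
      by simp
    then show "Q_inv * fps_const (\<phi> (f_gen i 0)) * Q = fps_const (\<phi> (f_gen i 0)) - Q_inv * f_ser \<phi> i * Q"
      unfolding level_one_f_gen f_ser_eq
      by (simp add: right_diff_distrib mult.assoc Q_inverse Q_cancel)
  qed
  then show ?thesis by (simp add: f_ser_eq mult.assoc Q_inverse)
qed

lemma raise_minor: "comm (level_one i (Suc i)) (minor bump lead) = minor bump bump - Q"
  and lower_minor: "comm (level_one (Suc i) i) (minor lead bump) = Q - minor bump bump"
proof -
  have col: "replace_columns T_cut bump lead i (Suc i) = quantum_minor T_cut bump bump"
    by (rule replace_columns_single[of "i - 1" lead i T_cut bump "Suc i", unfolded lead_update_bump])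
       (use i in \<open>auto simp: lead_nth\<close>)
  have row: "replace_rows T_cut bump lead i (Suc i) = quantum_minor T_cut lead lead"
    by (rule replace_rows_single[of "i - 1" bump "Suc i" T_cut lead i, unfolded lead_update_bump])
       (use i in \<open>auto simp: bump_nth\<close>)
  show "comm (level_one i (Suc i)) (minor bump lead) = minor bump bump - Q"
    using i by (subst minor_comm) (simp_all add: col row minor_def Q_def)
  have col: "replace_columns T_cut lead bump (Suc i) i = quantum_minor T_cut lead lead"
    by (rule replace_columns_single[of "i - 1" bump "Suc i" T_cut lead i, unfolded lead_update_bump])
       (use i in \<open>auto simp: bump_nth\<close>)
  have row: "replace_rows T_cut lead bump (Suc i) i = quantum_minor T_cut bump bump"
    by (rule replace_rows_single[of "i - 1" lead i T_cut bump "Suc i", unfolded lead_update_bump])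
       (use i in \<open>auto simp: lead_nth\<close>)
  show "comm (level_one (Suc i) i) (minor lead bump) = Q - minor bump bump"
    using i by (subst minor_comm) (simp_all add: col row minor_def Q_def)
qed

lemma raise_f_ser: "comm (level_one i (Suc i)) (f_ser \<phi> i) = h_ser \<phi> i - 1"
  and lower_e_ser: "comm (level_one (Suc i) i) (e_ser \<phi> i) = 1 - h_ser \<phi> i"
proof -
  note ef = drinfeld_relations(2)[OF node_in_range]
  have fe: "comm (f_gen i 0) (e_gen i l) = - (h_gen i l :: 'n drinfeld_yangian)" for l
    using ef[of l 0] by (simp add: comm_def) (metis minus_diff_eq)
  show "comm (level_one i (Suc i)) (f_ser \<phi> i) = h_ser \<phi> i - 1"
    unfolding level_one_e_gen
  proof (rule fps_ext)
    fix k
    show "fps_nth (comm (fps_const (\<phi> (e_gen i 0))) (f_ser \<phi> i)) k = fps_nth (h_ser \<phi> i - 1) k"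
      by (cases k) (simp_all add: comm_const_nth f_ser_nth h_ser_nth ef
          flip: algebra_hom_comm[OF algebra_hom_\<phi>])
  qed
  show "comm (level_one (Suc i) i) (e_ser \<phi> i) = 1 - h_ser \<phi> i"
    unfolding level_one_f_gen
  proof (rule fps_ext)
    fix k
    show "fps_nth (comm (fps_const (\<phi> (f_gen i 0))) (e_ser \<phi> i)) k = fps_nth (1 - h_ser \<phi> i) k"
      by (cases k) (simp_all add: comm_const_nth e_ser_nth h_ser_nth fe algebra_hom_uminus[OF algebra_hom_\<phi>]
          flip: algebra_hom_comm[OF algebra_hom_\<phi>])
  qed
qed

text \<open>Compute the commutator of \<open>e\<^sub>0\<close> with the minor \<open>t J I = f Q\<close> in
  two ways: by replacing indices, and by the Leibniz rule with \<open>[e\<^sub>0, f] = h -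
  1\<close>.\<close>

lemma g_ser_eq: "g_ser \<phi> i = minor bump bump * Q_inv"
proof -
  have "minor bump bump - Q = comm (level_one i (Suc i)) (f_ser \<phi> i * Q)"
    unfolding raise_minor[symmetric] f_ser_eq by (simp add: mult.assoc Q_inverse)
  also have "\<dots> = (h_ser \<phi> i - 1) * Q + f_ser \<phi> i * minor lead bump"
    by (simp add: comm_mult raise_f_ser raise_Q)
  finally have "minor bump bump = h_ser \<phi> i * Q + f_ser \<phi> i * minor lead bump"
    by (simp add: algebra_simps)
  then show ?thesis
    unfolding g_ser_def translate_e_ser by (simp add: distrib_right mult.assoc Q_inverse)
qed

text \<open>The same with the commutator of \<open>f\<^sub>0\<close> and \<open>t I J = Q e\<close>.\<close>

lemma g_tilde_ser_eq: "g_tilde_ser \<phi> i = Q_inv * minor bump bump"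
proof -
  have "Q - minor bump bump = comm (level_one (Suc i) i) (Q * e_ser \<phi> i)"
    unfolding lower_minor[symmetric] e_ser_eq by (simp add: Q_cancel)
  also have "\<dots> = - minor bump lead * e_ser \<phi> i + Q * (1 - h_ser \<phi> i)"
    by (simp add: comm_mult lower_e_ser lower_Q)
  finally have "minor bump bump = Q * h_ser \<phi> i + minor bump lead * e_ser \<phi> i"
    by (simp add: algebra_simps)
  then show ?thesis
    unfolding g_tilde_ser_def translate_f_ser by (simp add: distrib_left Q_cancel mult.assoc)
qed

end

section \<open>Replacing an index list entry by entry\<close>

lemma increasing_nth_diff:
  assumes "sorted_wrt (<) cs" "p \<le> q" "q < length cs"
  shows "cs ! p + (q - p) \<le> (cs ! q :: nat)"
  using assms(2,3)
proof (induction q rule: dec_induct)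
  case (step q)
  then have "cs ! q < cs ! Suc q" using assms(1) by (simp add: sorted_wrt_nth_less)
  with step show ?case by simp
qed simp

lemma increasing_nth_ge:
  assumes "sorted_wrt (<) cs" "set cs \<subseteq> {1..n}" "p < length cs"
  shows "Suc p \<le> cs ! p"
proof -
  have "cs ! 0 \<in> set cs" using assms(3) by (intro nth_mem) auto
  then have "1 \<le> cs ! 0" using assms(2) by auto
  with increasing_nth_diff[OF assms(1), of 0 p] assms(3) show ?thesis by simp
qed

text \<open>The rightmost map acts first, so after the maps for the positions from \<open>p\<close> on the
  list consists of the first \<open>p\<close> entries of \<open>rs\<close> and the remaining
  entries of \<open>ks\<close>. The hypothesis \<open>later\<close> keeps the entry to be replaced
  next from occurring twice.\<close>

lemma foldr_zip_replaces:
  assumes len: "length ks = length rs" and rs: "distinct rs"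
    and later: "\<And>p q. p < q \<Longrightarrow> q < length rs \<Longrightarrow> ks ! q \<noteq> rs ! p"
    and step: "\<And>p B. p < length rs \<Longrightarrow> length B = length rs \<Longrightarrow> B ! p = rs ! p \<Longrightarrow>
      (\<And>q. q < length rs \<Longrightarrow> q \<noteq> p \<Longrightarrow> B ! q \<noteq> rs ! p) \<Longrightarrow>
      g (rs ! p) (ks ! p) (V B) = V (B[p := ks ! p])"
  shows "foldr (\<lambda>(r, k). g r k) (zip rs ks) (V rs) = V ks"
proof -
  have "foldr (\<lambda>(r, k). g r k) (drop p (zip rs ks)) (V rs) = V (take p rs @ drop p ks)"
    if "p \<le> length rs" for p
    using that
  proof (induction p rule: inc_induct)
    case base
    then show ?case by (simp add: len)
  next
    case (step p)
    let ?B = "take (Suc p) rs @ drop (Suc p) ks"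
    have p: "p < length rs" by fact
    have B: "length ?B = length rs" "?B ! p = rs ! p"
      using p len by (simp_all add: nth_append)
    have other: "?B ! q \<noteq> rs ! p" if "q < length rs" "q \<noteq> p" for q
    proof (cases "q < p")
      case True
      with p rs show ?thesis by (simp add: nth_append nth_eq_iff_index_eq)
    next
      case False
      with that p len later[of p q] show ?thesis by (simp add: nth_append min_def)
    qed
    have "drop p (zip rs ks) = (rs ! p, ks ! p) # drop (Suc p) (zip rs ks)"
      using p len by (simp add: Cons_nth_drop_Suc[symmetric])
    then have "foldr (\<lambda>(r, k). g r k) (drop p (zip rs ks)) (V rs) = g (rs ! p) (ks ! p) (V ?B)"
      using step.IH by simp
    also have "\<dots> = V (?B[p := ks ! p])"
      by (rule assms(4)[OF p B other])
    also have "?B[p := ks ! p] = take p rs @ drop p ks"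
      using p len
      by (simp add: take_Suc_conv_app_nth list_update_append Cons_nth_drop_Suc)
    finally show ?case .
  qed
  from this[of 0] show ?thesis by simp
qed

context drinfeld_node
begin

text \<open>An increasing list of \<open>i\<close> positive integers ends in \<open>i\<close> only if it is
  \<open>1, \<dots>, i\<close>.\<close>

lemma increasing_lists_eq:
  "increasing_lists {1..CARD('n)} i = insert lead (index_lists CARD('n) i)" "lead \<notin> index_lists CARD('n) i"
proof -
  have last: "last lead = i" by (simp add: lead_def)
  then show "lead \<notin> index_lists CARD('n) i" by (simp add: index_lists_def)
  have "sorted_wrt (<) lead"
    unfolding sorted_wrt_iff_nth_less by (simp add: lead_nth)
  moreover have "cs = lead"
    if cs: "length cs = i" "sorted_wrt (<) cs" "set cs \<subseteq> {1..CARD('n)}" "last cs = i" for cs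
  proof (rule nth_equalityI)
    fix p assume p: "p < length cs"
    have "cs \<noteq> []" using cs(1) i by auto
    then have "cs ! (i - 1) = i" using cs(1,4) by (simp add: last_conv_nth)
    with p have "cs ! p + (i - 1 - p) \<le> i"
      using increasing_nth_diff[OF cs(2), of p "i - 1"] cs(1) by simp
    with increasing_nth_ge[OF cs(2,3) p] p cs(1) show "cs ! p = lead ! p"
      by (simp add: lead_nth)
  qed (simp add: cs)
  ultimately show "increasing_lists {1..CARD('n)} i = insert lead (index_lists CARD('n) i)"
    using lead_in_range last by (auto simp: increasing_lists_def index_lists_def)
qed

lemma index_list_nth:
  assumes "ks \<in> index_lists CARD('n) i" "p < i"
  shows "bump ! p \<le> ks ! p" "ks ! p \<in> {1..CARD('n)}" "q < p \<Longrightarrow> bump ! q < ks ! p"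
proof -
  have ks: "length ks = i" "sorted_wrt (<) ks" "set ks \<subseteq> {1..CARD('n)}" "last ks \<noteq> i"
    using assms(1) by (simp_all add: index_lists_def)
  have le: "bump ! p \<le> ks ! p" if "p < i" for p
  proof (cases "p = i - 1")
    case True
    have "ks ! (i - 1) \<noteq> i" using ks i by (metis last_conv_nth length_0_conv not_one_le_zero)
    with True that increasing_nth_ge[OF ks(2,3), of p] ks(1) show ?thesis
      by (simp add: bump_nth)
  next
    case False
    with that increasing_nth_ge[OF ks(2,3), of p] ks(1) show ?thesis by (simp add: bump_nth)
  qed
  then show "bump ! p \<le> ks ! p" using assms(2) by blast
  show "ks ! p \<in> {1..CARD('n)}" using ks(1,3) assms(2) by (metis nth_mem subsetD)
  assume q: "q < p"
  then have "ks ! q < ks ! p" using ks(1,2) assms(2) by (simp add: sorted_wrt_nth_less)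
  with le[of q] q assms(2) show "bump ! q < ks ! p" by simp
qed

text \<open>The first indices of the maps composed in \<open>iterated\<close> are exactly the entries of
  \<open>bump\<close>.\<close>

lemma iterated_replaces:
  assumes ks: "ks \<in> index_lists CARD('n) i"
    and same: "\<And>r X. g r r X = X"
    and step: "\<And>p B r k. p < i \<Longrightarrow> length B = i \<Longrightarrow> B ! p = r \<Longrightarrow> (\<And>q. q < i \<Longrightarrow> q \<noteq> p \<Longrightarrow> B ! q \<noteq> r) \<Longrightarrow>
       r \<in> set bump \<Longrightarrow> r < k \<Longrightarrow> k \<le> CARD('n) \<Longrightarrow> g r k (V B) = V (B[p := k])"
  shows "iterated g ks (V bump) = V ks"
proof -
  have len: "length ks = i" using ks by (simp add: index_lists_def)
  have "foldr (\<lambda>(r, k). g r k) (zip bump ks) (V bump) = V ks"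
  proof (rule foldr_zip_replaces)
    show "distinct bump"
      by (simp add: distinct_conv_nth bump_nth)
    show "ks ! q \<noteq> bump ! p" if "p < q" "q < length bump" for p q
      using index_list_nth(3)[OF ks, of q p] that by simp
    fix p B
    assume p: "p < length bump" and B: "length B = length bump" "B ! p = bump ! p"
      and other: "\<And>q. q < length bump \<Longrightarrow> q \<noteq> p \<Longrightarrow> B ! q \<noteq> bump ! p"
    show "g (bump ! p) (ks ! p) (V B) = V (B[p := ks ! p])"
    proof (cases "bump ! p = ks ! p")
      case True
      with B have "B[p := ks ! p] = B" by (metis list_update_id)
      with True show ?thesis by (simp add: same)
    next
      case False
      with index_list_nth(1,2)[OF ks, of p] p have k: "bump ! p < ks ! p" "ks ! p \<le> CARD('n)" by auto
      show ?thesis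
        by (rule step) (use p B other k nth_mem[OF p] in \<open>simp_all\<close>)
    qed
  qed (simp add: len)
  then show ?thesis by (simp add: iterated_def len bump_def)
qed

section \<open>The generalised adjoint actions\<close>

text \<open>Going from \<open>I\<close> to the left hand list moves \<open>i\<close> into position
  \<open>r\<close> and \<open>k\<close> into the last position; a transposition restores the
  order.\<close>

lemma minor_swap_columns:
  assumes "r < i" "1 \<le> r" "length as = i"
  shows "minor as (lead[i - 1 := k, r - 1 := i]) = - minor as (lead[r - 1 := k])"
proof -
  let ?s = "transpose (r - 1) (i - 1)" and ?T = "T_cut :: nat \<Rightarrow> nat \<Rightarrow> 'n yangian fps"
  have "quantum_minor ?T as (lead[i - 1 := k, r - 1 := i])
      = minor_fun i ?T ((!) as) ((!) (lead[r - 1 := k]) \<circ> ?s)"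
    unfolding quantum_minor_conv_fun assms(3) using assms(1,2)
    by (intro minor_fun_cong) (auto simp: nth_list_update lead_nth transpose_def)
  also have "\<dots> = - minor_fun i ?T ((!) as) ((!) (lead[r - 1 := k]))"
    using assms by (subst minor_fun_permute_columns[OF exchange_relation_T_cut])
      (auto simp: permutes_swap_id sign_swap_id)
  also have "\<dots> = - quantum_minor ?T as (lead[r - 1 := k])"
    by (simp add: quantum_minor_conv_fun assms(3))
  finally show ?thesis
    unfolding minor_def translate_uminus[symmetric] by (rule arg_cong)
qed

lemma minor_swap_rows:
  assumes "r < i" "1 \<le> r"
  shows "minor (lead[i - 1 := k, r - 1 := i]) bs = - minor (lead[r - 1 := k]) bs"
proof -
  let ?s = "transpose (r - 1) (i - 1)" and ?T = "T_cut :: nat \<Rightarrow> nat \<Rightarrow> 'n yangian fps"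
  have "quantum_minor ?T (lead[i - 1 := k, r - 1 := i]) bs
      = minor_fun i ?T ((!) (lead[r - 1 := k]) \<circ> ?s) ((!) bs)"
    unfolding quantum_minor_conv_fun using assms(1,2)
    by (simp only: length_list_update length_lead, intro minor_fun_cong)
       (auto simp: nth_list_update lead_nth transpose_def)
  also have "\<dots> = - minor_fun i ?T ((!) (lead[r - 1 := k])) ((!) bs)"
    using assms by (subst minor_fun_permute_rows) (auto simp: permutes_swap_id sign_swap_id)
  also have "\<dots> = - quantum_minor ?T (lead[r - 1 := k]) bs"
    by (simp add: quantum_minor_conv_fun)
  finally show ?thesis
    unfolding minor_def translate_uminus[symmetric] by (rule arg_cong)
qed

lemma level_one_Q_0:
  assumes "s \<in> {1..CARD('n)}" "t \<in> {1..CARD('n)}" "s \<noteq> t" "s \<le> i \<longleftrightarrow> t \<le> i"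
  shows "comm (level_one s t) Q = 0"
  unfolding Q_def using assms by (intro minor_comm_0) (auto simp: set_lead)

lemma level_one_Q_raise:
  assumes "r \<in> {1..i}" "k \<in> {i<..CARD('n)}"
  shows "comm (level_one r k) Q = minor lead (lead[r - 1 := k])"
    and "comm (level_one k r) Q = - minor (lead[r - 1 := k]) lead"
  unfolding Q_def using assms i
  by (auto intro!: minor_comm_column minor_comm_row simp: set_lead lead_nth)

text \<open>Multiplication by \<open>Q\<inverse>\<close> on either side, so that the correction series is
  computed once for both kinds of action.\<close>

definition Q_scaling :: "('n yangian fps \<Rightarrow> 'n yangian fps) \<Rightarrow> bool" where
  "Q_scaling L \<longleftrightarrow> L = (\<lambda>F. Q_inv * F) \<or> L = (\<lambda>F. F * Q_inv)"

lemma comm_Q_inv: "comm x Q_inv = - (Q_inv * comm x Q * Q_inv)"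
proof -
  have "Q_inv * comm x (Q * Q_inv) = Q_inv * comm x Q * Q_inv + comm x Q_inv"
    by (simp add: comm_mult distrib_left Q_cancel mult.assoc)
  then show ?thesis by (simp add: Q_inverse eq_neg_iff_add_eq_0 add.commute)
qed

lemma Q_scaling_comm: "Q_scaling L \<Longrightarrow> comm x Q = 0 \<Longrightarrow> comm x (L F) = L (comm x F)"
  by (auto simp: Q_scaling_def comm_mult comm_Q_inv)

lemma Q_scaling_uminus: "Q_scaling L \<Longrightarrow> L (- F) = - L F"
  and Q_scaling_0: "Q_scaling L \<Longrightarrow> L 0 = 0"
  by (auto simp: Q_scaling_def)

text \<open>The inner commutator replaces the last column \<open>i + 1\<close> of \<open>t I J\<close> by
  \<open>k\<close>, the outer one the column \<open>r\<close> by \<open>i\<close>; up to the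
  transposition accounted for by the sign of \<open>Ad_minus\<close>, this is \<open>Q\<close>
  with column \<open>r\<close> replaced by \<open>k\<close>, that is, the commutator of
  \<open>T\<^sub>r\<^sub>k\<close> with \<open>Q\<close>. Both commutators leave \<open>Q\<close>
  alone. Where the correction is defined to be zero, so is the commutator with \<open>Q\<close>.\<close>

lemma e_corr_eq:
  assumes L: "Q_scaling L" and e: "translate c (e_ser \<phi> i) = L (minor lead bump)"
    and rk: "1 \<le> r" "r < k" "k \<le> CARD('n)"
  shows "e_corr \<phi> c i r k = L (comm (level_one r k) Q)"
proof (cases "r \<le> i \<and> i < k")
  case True
  have "Ad_plus (i + 1) k (L (minor lead bump)) = L (minor lead (lead[i - 1 := k]))"
  proof (cases "k = i + 1")
    case True
    then show ?thesis by (simp add: Ad_plus_def lead_update_bump[simplified])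
  next
    case False
    have "comm (level_one (Suc i) k) Q = 0"
      using False True rk by (intro level_one_Q_0) auto
    moreover have "comm (level_one (Suc i) k) (minor lead bump) = minor lead (bump[i - 1 := k])"
      using False True rk i by (intro minor_comm_column) (auto simp: set_lead bump_nth)
    ultimately show ?thesis
      using False by (simp add: Ad_plus_def Q_scaling_comm[OF L] level_one_def lead_update[simplified])
  qed
  moreover have "Ad_minus r i (L (minor lead (lead[i - 1 := k]))) = L (minor lead (lead[r - 1 := k]))"
  proof (cases "r = i")
    case False
    have "comm (level_one r i) Q = 0"
      using False True rk i by (intro level_one_Q_0) auto
    moreover have "comm (level_one r i) (minor lead (lead[i - 1 := k])) = minor lead (lead[i - 1 := k, r - 1 := i])"
      using False True rk i by (intro minor_comm_column) (auto simp: set_lead lead_nth nth_list_update)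
    ultimately show ?thesis
      using False True rk
      by (simp add: Ad_minus_def Q_scaling_comm[OF L] level_one_def[symmetric] minor_swap_columns[of r lead k]
          Q_scaling_uminus[OF L] del: One_nat_def)
  qed (simp add: Ad_minus_def)
  ultimately show ?thesis
    using True rk by (simp add: e_corr_def e level_one_Q_raise del: One_nat_def)
next
  case False
  then have "comm (level_one r k) Q = 0"
    using rk by (intro level_one_Q_0) auto
  with False show ?thesis by (auto simp: e_corr_def Q_scaling_0[OF L])
qed

lemma f_corr_eq:
  assumes L: "Q_scaling L" and f: "translate c (f_ser \<phi> i) = L (minor bump lead)"
    and rk: "1 \<le> r" "r < k" "k \<le> CARD('n)"
  shows "f_corr \<phi> c i k r = - L (comm (level_one k r) Q)"
proof (cases "r \<le> i \<and> i < k")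
  case True
  have "Ad_minus k (i + 1) (L (minor bump lead)) = L (minor (lead[i - 1 := k]) lead)"
  proof (cases "k = i + 1")
    case True
    then show ?thesis by (simp add: Ad_minus_def lead_update_bump[simplified])
  next
    case False
    have "comm (level_one k (Suc i)) Q = 0"
      using False True rk by (intro level_one_Q_0) auto
    moreover have "comm (level_one k (Suc i)) (minor bump lead) = - minor (bump[i - 1 := k]) lead"
      using False True rk i by (intro minor_comm_row) (auto simp: set_lead bump_nth)
    ultimately show ?thesis
      using False by (simp add: Ad_minus_def Q_scaling_comm[OF L] Q_scaling_uminus[OF L]
          level_one_def lead_update[simplified])
  qed
  moreover have "Ad_plus i r (L (minor (lead[i - 1 := k]) lead)) = L (minor (lead[r - 1 := k]) lead)"
  proof (cases "r = i")
    case False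
    have "comm (level_one i r) Q = 0"
      using False True rk i by (intro level_one_Q_0) auto
    moreover have "comm (level_one i r) (minor (lead[i - 1 := k]) lead) = - minor (lead[i - 1 := k, r - 1 := i]) lead"
      using False True rk i by (intro minor_comm_row) (auto simp: set_lead lead_nth nth_list_update)
    ultimately show ?thesis
      using False True rk
      by (simp add: Ad_plus_def Q_scaling_comm[OF L] level_one_def[symmetric] minor_swap_rows[of r k lead]
          Q_scaling_uminus[OF L] del: One_nat_def)
  qed (simp add: Ad_plus_def)
  ultimately show ?thesis
    using True rk by (simp add: f_corr_def f level_one_Q_raise Q_scaling_uminus[OF L] del: One_nat_def)
next
  case False
  then have "comm (level_one k r) Q = 0"
    using rk by (intro level_one_Q_0) auto
  with False show ?thesis by (auto simp: f_corr_def Q_scaling_0[OF L])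
qed

lemma Q_scaling_left: "Q_scaling (\<lambda>F. Q_inv * F)" and Q_scaling_right: "Q_scaling (\<lambda>F. F * Q_inv)"
  by (simp_all add: Q_scaling_def)

context
  fixes r k :: nat
  assumes rk: "1 \<le> r" "r < k" "k \<le> CARD('n)"
begin

text \<open>The commutator of \<open>T\<^sub>r\<^sub>k\<close> with \<open>Q\<inverse> F\<close> contains
  the term \<open>- Q\<inverse> [T\<^sub>r\<^sub>k, Q] Q\<inverse> F\<close>, which the correction
  cancels.\<close>

lemma gen_E_left_eq: "gen_E_left \<phi> 0 i r k (Q_inv * F) = Q_inv * comm (level_one r k) F"
proof -
  have "e_corr \<phi> 0 i r k = Q_inv * comm (level_one r k) Q"
    using e_corr_eq[OF Q_scaling_left _ rk, of 0] e_ser_eq by simp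
  with rk show ?thesis
    by (simp add: gen_E_left_def Ad_plus_def level_one_def[symmetric] comm_mult comm_Q_inv mult.assoc
        del: One_nat_def)
qed

lemma gen_E_right_eq: "gen_E_right \<phi> 1 i r k (F * Q_inv) = comm (level_one r k) F * Q_inv"
proof -
  have "e_corr \<phi> 1 i r k = comm (level_one r k) Q * Q_inv"
    using e_corr_eq[OF Q_scaling_right _ rk, of 1] translate_e_ser by simp
  with rk show ?thesis
    by (simp add: gen_E_right_def Ad_plus_def level_one_def[symmetric] comm_mult comm_Q_inv mult.assoc
        del: One_nat_def)
qed

lemma gen_F_left_eq: "gen_F_left \<phi> 1 i k r (Q_inv * F) = - (Q_inv * comm (level_one k r) F)"
proof -
  have "f_corr \<phi> 1 i k r = - (Q_inv * comm (level_one k r) Q)"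
    using f_corr_eq[OF Q_scaling_left _ rk, of 1] translate_f_ser by simp
  with rk show ?thesis
    by (simp add: gen_F_left_def Ad_minus_def level_one_def[symmetric] comm_mult comm_Q_inv mult.assoc
        del: One_nat_def)
qed

lemma gen_F_right_eq: "gen_F_right \<phi> 0 i k r (F * Q_inv) = - (comm (level_one k r) F * Q_inv)"
proof -
  have "f_corr \<phi> 0 i k r = - (comm (level_one k r) Q * Q_inv)"
    using f_corr_eq[OF Q_scaling_right _ rk, of 0] f_ser_eq by simp
  with rk show ?thesis
    by (simp add: gen_F_right_def Ad_minus_def level_one_def[symmetric] comm_mult comm_Q_inv mult.assoc
        del: One_nat_def)
qed

end

lemma gen_same:
  "gen_E_left \<phi> c \<alpha> r r X = X" "gen_E_right \<phi> c \<alpha> r r X = X"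
  "gen_F_left \<phi> c \<alpha> r r X = X" "gen_F_right \<phi> c \<alpha> r r X = X"
  by (auto simp: gen_E_left_def gen_E_right_def gen_F_left_def gen_F_right_def Ad_plus_def
      Ad_minus_def e_corr_def f_corr_def)

text \<open>The other index list is not affected: it contains \<open>r\<close> whenever it contains
  \<open>k\<close>, because \<open>r < k\<close> is itself an entry of \<open>bump\<close>, so
  that the replacement would produce a repeated index.\<close>

lemma comm_replace:
  assumes A: "A = lead \<or> A = bump" and B: "length B = i" "p < i" "B ! p = r"
    "\<And>q. q < i \<Longrightarrow> q \<noteq> p \<Longrightarrow> B ! q \<noteq> r" and r: "r \<in> set bump" "r < k" and k: "k \<le> CARD('n)"
  shows "comm (level_one r k) (minor A B) = minor A (B[p := k])"
    and "comm (level_one k r) (minor B A) = - minor (B[p := k]) A"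
proof -
  have range: "r \<in> {1..CARD('n)}" "k \<in> {1..CARD('n)}" "r \<noteq> k"
    using r k lead_in_range(2) by auto
  have A': "length A = i" "k \<in> set A \<Longrightarrow> r \<in> set A"
    using A r by (auto simp: set_lead set_bump)
  show "comm (level_one r k) (minor A B) = minor A (B[p := k])"
    by (rule minor_comm_column) (use range A' B in auto)
  show "comm (level_one k r) (minor B A) = - minor (B[p := k]) A"
    by (rule minor_comm_row) (use range A' B in auto)
qed

lemma bump_ge_1: "r \<in> set bump \<Longrightarrow> 1 \<le> r"
  using lead_in_range(2) by auto

lemma iterated_actions:
  assumes ks: "ks \<in> index_lists CARD('n) i" and A: "A = lead \<or> A = bump"
  shows "E_left \<phi> 0 i ks (Q_inv * minor A bump) = Q_inv * minor A ks"
    and "E_right \<phi> 1 i ks (minor A bump * Q_inv) = minor A ks * Q_inv"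
    and "F_left \<phi> 1 i ks (Q_inv * minor bump A) = Q_inv * minor ks A"
    and "F_right \<phi> 0 i ks (minor bump A * Q_inv) = minor ks A * Q_inv"
proof -
  note replace = comm_replace[OF A]
  show "E_left \<phi> 0 i ks (Q_inv * minor A bump) = Q_inv * minor A ks"
    unfolding E_left_def
    by (rule iterated_replaces[OF ks gen_same(1), where V = "\<lambda>B. Q_inv * minor A B"], subst gen_E_left_eq) (simp_all add: bump_ge_1[simplified] replace)
  show "E_right \<phi> 1 i ks (minor A bump * Q_inv) = minor A ks * Q_inv"
    unfolding E_right_def
    by (rule iterated_replaces[OF ks gen_same(2), where V = "\<lambda>B. minor A B * Q_inv"], subst gen_E_right_eq)
       (simp_all add: bump_ge_1[simplified] replace)
  show "F_left \<phi> 1 i ks (Q_inv * minor bump A) = Q_inv * minor ks A"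
    unfolding F_left_def
    by (rule iterated_replaces[OF ks gen_same(3), where V = "\<lambda>B. Q_inv * minor B A"], subst gen_F_left_eq)
       (simp_all add: bump_ge_1[simplified] replace)
  show "F_right \<phi> 0 i ks (minor bump A * Q_inv) = minor ks A * Q_inv"
    unfolding F_right_def
    by (rule iterated_replaces[OF ks gen_same(4), where V = "\<lambda>B. minor B A * Q_inv"], subst gen_F_right_eq)
       (simp_all add: bump_ge_1[simplified] replace)
qed

section \<open>The comultiplication formulas\<close>

context
  fixes \<Delta> :: "'n yangian \<Rightarrow> ('n yangian, 'n yangian) tensor"
  assumes \<Delta>: "is_comultiplication \<Delta>"
begin

lemma algebra_hom_\<Delta>: "algebra_hom \<Delta>"
  using \<Delta> by (simp add: is_comultiplication_def)

lemma comultiplication_minor: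
  assumes "length as = i" "length bs = i"
  shows "fps_map \<Delta> (minor as bs)
       = minor as lead \<otimes> minor lead bs + (\<Sum>b\<in>index_lists CARD('n) i. minor as b \<otimes> minor b bs)"
proof -
  have "fps_map \<Delta> (minor as bs)
      = translate (- shift) (fps_map \<Delta> (quantum_minor T_cut as bs))"
    by (simp add: minor_def translate_fps_map[OF algebra_hom_\<Delta>])
  also have "\<dots> = (\<Sum>b\<in>increasing_lists {1..CARD('n)} i. minor as b \<otimes> minor b bs)"
    using fps_map_quantum_minor_comultiplication[OF exchange_relation_T_cut finite_atLeastAtMost
        algebra_hom_\<Delta> comultiplication_T_cut[OF \<Delta>] assms]
    by (simp add: translate_sum translate_tensor_fps minor_def)
  also have "finite (index_lists CARD('n) i)"
    by (rule finite_subset[OF _ finite_lists_length_eq[of "{1..CARD('n)}" i]])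
       (auto simp: index_lists_def)
  then have "(\<Sum>b\<in>increasing_lists {1..CARD('n)} i. minor as b \<otimes> minor b bs)
      = minor as lead \<otimes> minor lead bs + (\<Sum>b\<in>index_lists CARD('n) i. minor as b \<otimes> minor b bs)"
    unfolding increasing_lists_eq(1) using increasing_lists_eq(2) by (rule sum.insert)
  finally show ?thesis .
qed

lemma scaled_comultiplication_left:
  assumes "length as = i" "length bs = i"
  shows "(Q_inv \<otimes> Q_inv) * fps_map \<Delta> (minor as bs)
       = (Q_inv * minor as lead) \<otimes> (Q_inv * minor lead bs)
       + (\<Sum>b\<in>index_lists CARD('n) i. (Q_inv * minor as b) \<otimes> (Q_inv * minor b bs))"
  by (simp add: comultiplication_minor[OF assms] distrib_left sum_distrib_left tensor_fps_mult)

lemma scaled_comultiplication_right: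
  assumes "length as = i" "length bs = i"
  shows "fps_map \<Delta> (minor as bs) * (Q_inv \<otimes> Q_inv)
       = (minor as lead * Q_inv) \<otimes> (minor lead bs * Q_inv)
       + (\<Sum>b\<in>index_lists CARD('n) i. (minor as b * Q_inv) \<otimes> (minor b bs * Q_inv))"
  by (simp add: comultiplication_minor[OF assms] distrib_right sum_distrib_right tensor_fps_mult)

lemma Q_constant: "fps_nth ((Q_inv \<otimes> Q_inv) * fps_map \<Delta> Q) 0 = 1" "fps_nth (fps_map \<Delta> Q * (Q_inv \<otimes> Q_inv)) 0 = 1"
  by (simp_all add: tensor_fps_nth_0 Q_nth_0 tensor_elem_1 algebra_hom_1[OF algebra_hom_\<Delta>])

text \<open>Multiply the comultiplications of \<open>Q\<close> and of \<open>t I J = Q e\<close> by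
  \<open>Q\<inverse> \<otimes> Q\<inverse>\<close> from the left; the first one becomes \<open>1 +
  S\<close>, the second one the last factor of the claim.\<close>

lemma comultiplication_e:
  "fps_map \<Delta> (e_ser \<phi> i) =
     suminf (\<lambda>m. (-1) ^ m *
        (\<Sum>b\<in>index_lists CARD('n) i.
           E_left \<phi> 0 i b (e_ser \<phi> i) \<otimes> F_left \<phi> 1 i b (translate 1 (f_ser \<phi> i))) ^ m)
     * (1 \<otimes> e_ser \<phi> i +
        (\<Sum>a\<in>index_lists CARD('n) i.
           E_left \<phi> 0 i a (e_ser \<phi> i) \<otimes> F_left \<phi> 1 i a (g_tilde_ser \<phi> i)))"
proof -
  let ?I = "index_lists CARD('n) i" and ?q = "Q_inv \<otimes> Q_inv"
  let ?S = "\<Sum>b\<in>?I. E_left \<phi> 0 i b (e_ser \<phi> i) \<otimes> F_left \<phi> 1 i b (translate 1 (f_ser \<phi> i))"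
  let ?G = "suminf (\<lambda>m. (-1) ^ m * ?S ^ m)"
  let ?R = "1 \<otimes> e_ser \<phi> i + (\<Sum>a\<in>?I. E_left \<phi> 0 i a (e_ser \<phi> i) \<otimes> F_left \<phi> 1 i a (g_tilde_ser \<phi> i))"
  have S: "?S = (\<Sum>b\<in>?I. (Q_inv * minor lead b) \<otimes> (Q_inv * minor b lead))"
    by (intro sum.cong refl) (simp add: e_ser_eq translate_f_ser iterated_actions)
  have one: "?q * fps_map \<Delta> Q = 1 + ?S"
    unfolding S unfolding Q_def using scaled_comultiplication_left[of lead lead]
    by (simp add: Q_def[symmetric] Q_inverse tensor_fps_1)
  have "fps_nth ?S 0 = 0"
    using Q_constant(1) unfolding one by simp
  note G = geometric_series_inverse[OF this]
  have "?R = ?q * fps_map \<Delta> (minor lead bump)"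
  proof -
    have "(\<Sum>a\<in>?I. E_left \<phi> 0 i a (e_ser \<phi> i) \<otimes> F_left \<phi> 1 i a (g_tilde_ser \<phi> i))
        = (\<Sum>a\<in>?I. (Q_inv * minor lead a) \<otimes> (Q_inv * minor a bump))"
      by (intro sum.cong refl) (simp add: e_ser_eq g_tilde_ser_eq iterated_actions)
    then show ?thesis
      using scaled_comultiplication_left[of lead bump] by (simp add: Q_def[symmetric] Q_inverse e_ser_eq)
  qed
  also have "minor lead bump = Q * e_ser \<phi> i"
    by (simp add: e_ser_eq Q_cancel)
  also have "?q * fps_map \<Delta> (Q * e_ser \<phi> i) = (1 + ?S) * fps_map \<Delta> (e_ser \<phi> i)"
    unfolding one[symmetric] by (simp add: fps_map_mult[OF algebra_hom_\<Delta>] mult.assoc)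
  finally have "?G * ?R = (?G * (1 + ?S)) * fps_map \<Delta> (e_ser \<phi> i)"
    by (simp only: mult.assoc)
  then show ?thesis unfolding G(1) by simp
qed

text \<open>The mirror image, stated for any series \<open>X\<close> with \<open>X Q = t J A\<close> since
  it serves for \<open>X = f\<close> and for \<open>X = g\<close>.\<close>

lemma comultiplication_right_multiple:
  fixes F X :: "'n yangian fps"
  defines "S \<equiv> \<Sum>b\<in>index_lists CARD('n) i.
       E_right \<phi> 1 i b (translate 1 (e_ser \<phi> i)) \<otimes> F_right \<phi> 0 i b (f_ser \<phi> i)"
  assumes A: "length A = i" and X: "X * Q = minor bump A"
  shows "fps_map \<Delta> X
       = ((minor bump lead * Q_inv) \<otimes> (minor lead A * Q_inv)
          + (\<Sum>a\<in>index_lists CARD('n) i. (minor bump a * Q_inv) \<otimes> (minor a A * Q_inv)))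
         * suminf (\<lambda>m. (-1) ^ m * S ^ m)"
proof -
  let ?q = "Q_inv \<otimes> Q_inv"
  have S: "S = (\<Sum>b\<in>index_lists CARD('n) i. (minor lead b * Q_inv) \<otimes> (minor b lead * Q_inv))"
    unfolding S_def by (intro sum.cong refl) (simp add: f_ser_eq translate_e_ser iterated_actions)
  have one: "fps_map \<Delta> Q * ?q = 1 + S"
    unfolding S unfolding Q_def using scaled_comultiplication_right[of lead lead]
    by (simp add: Q_def[symmetric] Q_inverse tensor_fps_1)
  have "fps_nth S 0 = 0"
    using Q_constant(2) unfolding one by simp
  note G = geometric_series_inverse[OF this]
  have "fps_map \<Delta> (minor bump A) * ?q = fps_map \<Delta> X * (1 + S)"
    unfolding one[symmetric] X[symmetric] by (simp add: fps_map_mult[OF algebra_hom_\<Delta>] mult.assoc)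
  then have "fps_map \<Delta> (minor bump A) * ?q * suminf (\<lambda>m. (-1) ^ m * S ^ m)
      = fps_map \<Delta> X * ((1 + S) * suminf (\<lambda>m. (-1) ^ m * S ^ m))"
    by (simp only: mult.assoc)
  then show ?thesis
    unfolding G(2) scaled_comultiplication_right[OF length_lead(2) A] by simp
qed

lemma comultiplication_f:
  "fps_map \<Delta> (f_ser \<phi> i) =
     (f_ser \<phi> i \<otimes> 1 +
        (\<Sum>a\<in>index_lists CARD('n) i.
           E_right \<phi> 1 i a (g_ser \<phi> i) \<otimes> F_right \<phi> 0 i a (f_ser \<phi> i)))
     * suminf (\<lambda>m. (-1) ^ m *
        (\<Sum>b\<in>index_lists CARD('n) i.
           E_right \<phi> 1 i b (translate 1 (e_ser \<phi> i)) \<otimes> F_right \<phi> 0 i b (f_ser \<phi> i)) ^ m)"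
proof -
  have "(\<Sum>a\<in>index_lists CARD('n) i. E_right \<phi> 1 i a (g_ser \<phi> i) \<otimes> F_right \<phi> 0 i a (f_ser \<phi> i))
      = (\<Sum>a\<in>index_lists CARD('n) i. (minor bump a * Q_inv) \<otimes> (minor a lead * Q_inv))"
    by (intro sum.cong refl) (simp add: f_ser_eq g_ser_eq iterated_actions)
  then show ?thesis
    by (subst comultiplication_right_multiple[of lead])
       (simp_all add: f_ser_eq mult.assoc Q_inverse flip: Q_def)
qed

lemma comultiplication_h:
  "fps_map \<Delta> (h_ser \<phi> i) =
     (f_ser \<phi> i \<otimes> translate 1 (e_ser \<phi> i) +
        (\<Sum>a\<in>index_lists CARD('n) i.
           E_right \<phi> 1 i a (g_ser \<phi> i) \<otimes> F_right \<phi> 0 i a (g_ser \<phi> i)))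
     * suminf (\<lambda>m. (-1) ^ m *
        (\<Sum>b\<in>index_lists CARD('n) i.
           E_right \<phi> 1 i b (translate 1 (e_ser \<phi> i)) \<otimes> F_right \<phi> 0 i b (f_ser \<phi> i)) ^ m)
     - fps_map \<Delta> (f_ser \<phi> i) * fps_map \<Delta> (translate 1 (e_ser \<phi> i))"
proof -
  have sum: "(\<Sum>a\<in>index_lists CARD('n) i. E_right \<phi> 1 i a (g_ser \<phi> i) \<otimes> F_right \<phi> 0 i a (g_ser \<phi> i))
      = (\<Sum>a\<in>index_lists CARD('n) i. (minor bump a * Q_inv) \<otimes> (minor a bump * Q_inv))"
    by (intro sum.cong refl) (simp add: g_ser_eq iterated_actions)
  have "g_ser \<phi> i * Q = minor bump bump"
    by (simp add: g_ser_eq mult.assoc Q_inverse)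
  note g = comultiplication_right_multiple[OF length_lead(2) this]
  have "fps_map \<Delta> (g_ser \<phi> i) = fps_map \<Delta> (h_ser \<phi> i)
      + fps_map \<Delta> (f_ser \<phi> i) * fps_map \<Delta> (translate 1 (e_ser \<phi> i))"
    by (simp add: g_ser_def fps_map_add[OF algebra_hom_\<Delta>] fps_map_mult[OF algebra_hom_\<Delta>])
  then show ?thesis
    unfolding sum using g by (simp add: f_ser_eq[symmetric] translate_e_ser[symmetric] eq_diff_eq)
qed

end

end

theorem theorem4p5:
  fixes \<phi> :: "'n drinfeld_yangian \<Rightarrow> 'n yangian"
    and \<Delta> :: "'n yangian \<Rightarrow> ('n yangian, 'n yangian) tensor"
    and i :: nat
  assumes n: "2 \<le> CARD('n)"
    and i: "1 \<le> i" "i \<le> CARD('n) - 1"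
    and \<phi>: "is_drinfeld_iso \<phi>"
    and \<Delta>: "is_comultiplication \<Delta>"
  shows
    "(fps_map \<Delta> (e_ser \<phi> i) =
       suminf (\<lambda>m. (-1) ^ m *
          (\<Sum>b\<in>index_lists CARD('n) i.
             E_left \<phi> 0 i b (e_ser \<phi> i) \<otimes> F_left \<phi> 1 i b (translate 1 (f_ser \<phi> i))) ^ m)
       * (1 \<otimes> e_ser \<phi> i +
          (\<Sum>a\<in>index_lists CARD('n) i.
             E_left \<phi> 0 i a (e_ser \<phi> i) \<otimes> F_left \<phi> 1 i a (g_tilde_ser \<phi> i))))
     \<and>
     (fps_map \<Delta> (f_ser \<phi> i) =
       (f_ser \<phi> i \<otimes> 1 +
          (\<Sum>a\<in>index_lists CARD('n) i.
             E_right \<phi> 1 i a (g_ser \<phi> i) \<otimes> F_right \<phi> 0 i a (f_ser \<phi> i)))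
       * suminf (\<lambda>m. (-1) ^ m *
          (\<Sum>b\<in>index_lists CARD('n) i.
             E_right \<phi> 1 i b (translate 1 (e_ser \<phi> i)) \<otimes> F_right \<phi> 0 i b (f_ser \<phi> i)) ^ m))
     \<and>
     (fps_map \<Delta> (h_ser \<phi> i) =
       (f_ser \<phi> i \<otimes> translate 1 (e_ser \<phi> i) +
          (\<Sum>a\<in>index_lists CARD('n) i.
             E_right \<phi> 1 i a (g_ser \<phi> i) \<otimes> F_right \<phi> 0 i a (g_ser \<phi> i)))
       * suminf (\<lambda>m. (-1) ^ m *
          (\<Sum>b\<in>index_lists CARD('n) i.
             E_right \<phi> 1 i b (translate 1 (e_ser \<phi> i)) \<otimes> F_right \<phi> 0 i b (f_ser \<phi> i)) ^ m)
       - fps_map \<Delta> (f_ser \<phi> i) * fps_map \<Delta> (translate 1 (e_ser \<phi> i)))"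
proof -
  interpret drinfeld_node \<phi> i
    using n i \<phi> by unfold_locales auto
  show ?thesis
    using comultiplication_e[OF \<Delta>] comultiplication_f[OF \<Delta>] comultiplication_h[OF \<Delta>] by blast
qed

end
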